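(* Let $A=\Bbbk\mathcal{Q}/\mathcal{I}$ be gentle or locally gentle. The prime ideals of $A$ are exactly the following: (1) the ideal $\mathfrak{m}_v$ for each $v\in\mathcal{Q}_0$; (2) the ideal $\operatorname{ann}_A(\mathcal{J}_\gamma)$ for each infinite maximal path $\gamma$ of $A$; (3) the ideal $\mathfrak{p}(\gamma,p):=\operatorname{ann}_A(\mathcal{J}_\gamma)+\langle p(m_\gamma)\rangle$ for each infinite maximal path $\gamma$ and each irreducible polynomial $p(t)\in\Bbbk[t]$ with $\deg(p)\ge 1$ and $p(0)\neq 0$. In particular, $A$ is prime (i.e. $0$ is a prime ideal) if and only if $A$ has only one maximal path and that path has infinite length. The height zero prime ideals of $A$ are the ideals $\operatorname{ann}_A(\mathcal{J}_\gamma)$ for $\gamma$ an infinite maximal path and the ideals $\mathfrak{m}_v$ for those vertices $v$ which no infinite maximal path passes through. If $\gamma$ is an infinite maximal path in $A$ which passes through $v$ and $p\neq t$ is an irreducible monic polynomial, then the inclusions among $\operatorname{ann}_A(\mathcal{J}_\gamma)$, $\mathfrak{m}_v$ and $\mathfrak{p}(\gamma,p)$ are $\operatorname{ann}_A(\mathcal{J}_\gamma)\subset\mathfrak{m}_v$ and $\operatorname{ann}_A(\mathcal{J}_\gamma)\subset\mathfrak{p}(\gamma,p)$.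
   Context: $\Bbbk$ is a field of characteristic $0$. A quiver $\mathcal{Q}=(\mathcal{Q}_0,\mathcal{Q}_1,s,t)$ has vertex set $\mathcal{Q}_0$, arrow set $\mathcal{Q}_1$, source and target maps $s,t:\mathcal{Q}_1\to\mathcal{Q}_0$; all quivers are finite and connected with $|\mathcal{Q}_0|,|\mathcal{Q}_1|\ge 1$. $\operatorname{indeg}(v)$, $\operatorname{outdeg}(v)$ are the numbers of arrows with target, respectively source, $v$. Paths are composed left to right ($\alpha\beta$ is a path iff $t(\alpha)=s(\beta)$); $\epsilon_v$ is the stationary path of length $0$ at $v$; $\Bbbk\mathcal{Q}$ is the path algebra. $A=\Bbbk\mathcal{Q}/\mathcal{I}$ is gentle if: (i) $\operatorname{indeg}(v),\operatorname{outdeg}(v)\le 2$ for all $v$; (ii) whenever $s(\alpha)=t(\beta)=t(\beta')$ with $\beta\ne\beta'$ arrows, exactly one of $\beta\alpha,\beta'\alpha$ is in $\mathcal{I}$; (iii) whenever $t(\alpha)=s(\beta)=s(\beta')$ with $\beta\neq\beta'$, exactly one of $\alpha\beta,\alpha\beta'$ is in $\mathcal{I}$; (iv) $\mathcal{I}$ is generated by paths of length $2$; (v) $A$ is finite dimensional. It is locally gentle if it satisfies (i)-(iv) and is infinite dimensional. $\mathcal{B}$ is the basis of $A$ consisting of the paths not in $\mathcal{I}$. Maximal paths: a path $p\in\mathcal{B}$ is right (left) maximal if $p\alpha\in\mathcal{I}$ ($\alpha p\in\mathcal{I}$) for every arrow $\alpha$, and is a finite maximal path if both. A cycle (closed path of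 positive length) $c$ is primitive if it is not $(c')^k$ for a cycle $c'$ and $k>1$. For a primitive cycle $c$ with $c^2\notin\mathcal{I}$, $c^\infty$ is called an infinite maximal path, where $c^\infty=(c')^\infty$ if $c'$ is a rotation of $c$; a path $w$ is a subpath of $c^\infty$, $w\le c^\infty$, if it is a subpath of $c^k$ for some $k>0$; $c^\infty$ passes through $v$ if $v$ is a vertex on $c$. A maximal path is a finite or an infinite maximal path. Each arrow $\alpha$ lies in a unique maximal path $\gamma_\alpha$. For an arrow $\alpha$, $\gamma_r(\alpha)$ is the unique longest path in $\mathcal{B}$ with first arrow $\alpha$ and no repeated arrows; if $\gamma_\alpha$ is infinite, $\gamma_r(\alpha)$ is a primitive cycle with $\gamma_\alpha=\gamma_r(\alpha)^\infty$. Ideals are two-sided and not necessarily graded. $\mathfrak{m}_v$ is the ideal generated by $\{\epsilon_{v'}: v'\in\mathcal{Q}_0\setminus\{v\}\}\cup\{\alpha\in\mathcal{Q}_1: s(\alpha)=t(\alpha)=v\}$. For a maximal path $\gamma$, $\mathcal{J}_\gamma=\langle\alpha\in\mathcal{Q}_1:\gamma_\alpha=\gamma\rangle$, and $\operatorname{ann}_A(\mathcal{J}_\gamma)=\{x\in A: x\mathcal{J}_\gamma=0\}$. For an infinite maximal path $\gamma$, $m_\gamma=\sum_{\alpha\in\mathcal{Q}_1,\,\gamma_\alpha=\gamma}\gamma_r(\alpha)$. *)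

theory Defs
  imports
    "HOL-Algebra.Algebra"
    "HOL-Library.Poly_Mapping"
    "HOL-Library.Extended_Nat"
    "HOL-Computational_Algebra.Polynomial_Factorial"
    "Graph_Theory.Graph_Theory"
begin

section \<open>Prime ideals of noncommutative rings\<close>

text \<open>
  The library locale \<open>primeideal\<close> presupposes a commutative ring. As everywhere in HOL-Algebra,
  \<^const>\<open>ideal\<close> and \<^const>\<open>genideal\<close> refer to two-sided ideals.
\<close>

definition nc_prime_ideal :: "('r, 'm) ring_scheme \<Rightarrow> 'r set \<Rightarrow> bool" where
  "nc_prime_ideal R P \<longleftrightarrow>
     ideal P R \<and> P \<noteq> carrier R \<and>
     (\<forall>J K. ideal J R \<longrightarrow> ideal K R \<longrightarrow> ideal_prod R J K \<subseteq> P \<longrightarrow> J \<subseteq> P \<or> K \<subseteq> P)"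

definition nc_prime_ring :: "('r, 'm) ring_scheme \<Rightarrow> bool" where
  "nc_prime_ring R \<longleftrightarrow> nc_prime_ideal R {\<zero>\<^bsub>R\<^esub>}"

text \<open>The supremum of the lengths \<open>n\<close> of chains \<open>C 0 \<subset> \<dots> \<subset> C n = P\<close> of prime ideals.\<close>

definition prime_height :: "('r, 'm) ring_scheme \<Rightarrow> 'r set \<Rightarrow> enat" where
  "prime_height R P =
     Sup {enat n | n. \<exists>C. (\<forall>i\<le>n. nc_prime_ideal R (C i)) \<and> (\<forall>i<n. C i \<subset> C (Suc i)) \<and> C n = P}"

text \<open>The annihilator with respect to multiplication by \<open>J\<close> from the right.\<close>

definition annihilator :: "('r, 'm) ring_scheme \<Rightarrow> 'r set \<Rightarrow> 'r set" where
  "annihilator R J = {x \<in> carrier R. \<forall>y\<in>J. x \<otimes>\<^bsub>R\<^esub> y = \<zero>\<^bsub>R\<^esub>}"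


section \<open>Quivers, paths and path algebras\<close>

definition quiver :: "('v, 'a) pre_digraph \<Rightarrow> bool" where
  "quiver Q \<longleftrightarrow> fin_digraph Q \<and> Digraph_Component.connected Q \<and> arcs Q \<noteq> {}"

text \<open>
  A path is its source together with the list of its arrows, read from left to right;
  \<open>(v, [])\<close> is the stationary path at \<open>v\<close>.
\<close>

type_synonym ('v, 'a) path = "'v \<times> 'a list"

definition paths :: "('v, 'a) pre_digraph \<Rightarrow> ('v, 'a) path set" where
  "paths Q = {(u, as) | u as. \<exists>v. pre_digraph.awalk Q u as v}"

definition plen :: "('v, 'a) path \<Rightarrow> nat" where
  "plen p = length (snd p)"

definition ptarget :: "('v, 'a) pre_digraph \<Rightarrow> ('v, 'a) path \<Rightarrow> 'v" where
  "ptarget Q p = pre_digraph.awlast Q (fst p) (snd p)"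

definition path_verts :: "('v, 'a) pre_digraph \<Rightarrow> ('v, 'a) path \<Rightarrow> 'v set" where
  "path_verts Q p = set (pre_digraph.awalk_verts Q (fst p) (snd p))"

definition stat_path :: "'v \<Rightarrow> ('v, 'a) path" where
  "stat_path v = (v, [])"

definition arrow_path :: "('v, 'a) pre_digraph \<Rightarrow> 'a \<Rightarrow> ('v, 'a) path" where
  "arrow_path Q \<alpha> = (tail Q \<alpha>, [\<alpha>])"

definition composable :: "('v, 'a) pre_digraph \<Rightarrow> ('v, 'a) path \<Rightarrow> ('v, 'a) path \<Rightarrow> bool" where
  "composable Q p q \<longleftrightarrow> ptarget Q p = fst q"

definition pcomp :: "('v, 'a) path \<Rightarrow> ('v, 'a) path \<Rightarrow> ('v, 'a) path" where
  "pcomp p q = (fst p, snd p @ snd q)"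

definition ppow :: "('v, 'a) path \<Rightarrow> nat \<Rightarrow> ('v, 'a) path" where
  "ppow c k = (pcomp c ^^ k) (stat_path (fst c))"

definition subpath :: "('v, 'a) pre_digraph \<Rightarrow> ('v, 'a) path \<Rightarrow> ('v, 'a) path \<Rightarrow> bool" where
  "subpath Q w p \<longleftrightarrow> w \<in> paths Q \<and>
     (\<exists>x\<in>paths Q. \<exists>y\<in>paths Q. composable Q x w \<and> composable Q w y \<and> p = pcomp x (pcomp w y))"

definition path_algebra :: "('v, 'a) pre_digraph \<Rightarrow> (('v, 'a) path \<Rightarrow>\<^sub>0 'k::field) ring" where
  "path_algebra Q =
     \<lparr> carrier = {f. Poly_Mapping.keys f \<subseteq> paths Q},
       monoid.mult = (\<lambda>f g. \<Sum>p\<in>Poly_Mapping.keys f. \<Sum>q\<in>Poly_Mapping.keys g.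
                 if composable Q p q
                 then Poly_Mapping.single (pcomp p q) (Poly_Mapping.lookup f p * Poly_Mapping.lookup g q) else 0),
       one = (\<Sum>v\<in>verts Q. Poly_Mapping.single (stat_path v) 1),
       ring.zero = 0,
       ring.add = (+) \<rparr>"

definition path_el :: "('v, 'a) path \<Rightarrow> (('v, 'a) path \<Rightarrow>\<^sub>0 'k::field)" where
  "path_el p = Poly_Mapping.single p 1"

definition scalar_el :: "('v, 'a) pre_digraph \<Rightarrow> 'k \<Rightarrow> (('v, 'a) path \<Rightarrow>\<^sub>0 'k::field)" where
  "scalar_el Q c = (\<Sum>v\<in>verts Q. Poly_Mapping.single (stat_path v) c)"


section \<open>Gentle and locally gentle algebras\<close>

text \<open>Throughout, \<open>I\<close> is a subset of the path algebra of \<open>Q\<close>, and the algebra under consideration is:\<close>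

abbreviation quiver_algebra ::
    "('v, 'a) pre_digraph \<Rightarrow> (('v, 'a) path \<Rightarrow>\<^sub>0 'k::field) set \<Rightarrow> (('v, 'a) path \<Rightarrow>\<^sub>0 'k) set ring" where
  "quiver_algebra Q I \<equiv> path_algebra Q Quot I"

definition quot_el ::
    "('v, 'a) pre_digraph \<Rightarrow> (('v, 'a) path \<Rightarrow>\<^sub>0 'k::field) set \<Rightarrow> (('v, 'a) path \<Rightarrow>\<^sub>0 'k) \<Rightarrow> (('v, 'a) path \<Rightarrow>\<^sub>0 'k) set" where
  "quot_el Q I f = I +>\<^bsub>path_algebra Q\<^esub> f"

text \<open>\<open>prod_in Q I p q\<close>: the product \<open>p q\<close> lies in \<open>I\<close>; it is \<open>0\<close> if \<open>p\<close> and \<open>q\<close> are not composable.\<close>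

definition prod_in ::
    "('v, 'a) pre_digraph \<Rightarrow> (('v, 'a) path \<Rightarrow>\<^sub>0 'k::field) set \<Rightarrow> ('v, 'a) path \<Rightarrow> ('v, 'a) path \<Rightarrow> bool" where
  "prod_in Q I p q \<longleftrightarrow> path_el p \<otimes>\<^bsub>path_algebra Q\<^esub> path_el q \<in> I"

definition gentle_relations ::
    "('v, 'a) pre_digraph \<Rightarrow> (('v, 'a) path \<Rightarrow>\<^sub>0 'k::field) set \<Rightarrow> bool" where
  "gentle_relations Q I \<longleftrightarrow>
     (\<forall>v\<in>verts Q. in_degree Q v \<le> 2 \<and> out_degree Q v \<le> 2) \<and>
     (\<forall>\<alpha>\<in>arcs Q. \<forall>\<beta>\<in>arcs Q. \<forall>\<beta>'\<in>arcs Q.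
        tail Q \<alpha> = head Q \<beta> \<and> tail Q \<alpha> = head Q \<beta>' \<and> \<beta> \<noteq> \<beta>' \<longrightarrow>
        (prod_in Q I (arrow_path Q \<beta>) (arrow_path Q \<alpha>) \<longleftrightarrow>
         \<not> prod_in Q I (arrow_path Q \<beta>') (arrow_path Q \<alpha>))) \<and>
     (\<forall>\<alpha>\<in>arcs Q. \<forall>\<beta>\<in>arcs Q. \<forall>\<beta>'\<in>arcs Q.
        head Q \<alpha> = tail Q \<beta> \<and> head Q \<alpha> = tail Q \<beta>' \<and> \<beta> \<noteq> \<beta>' \<longrightarrow>
        (prod_in Q I (arrow_path Q \<alpha>) (arrow_path Q \<beta>) \<longleftrightarrow>
         \<not> prod_in Q I (arrow_path Q \<alpha>) (arrow_path Q \<beta>'))) \<and>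
     (\<exists>S \<subseteq> {p \<in> paths Q. plen p = 2}. I = Idl\<^bsub>path_algebra Q\<^esub> (path_el ` S))"

definition finite_dim_algebra ::
    "('v, 'a) pre_digraph \<Rightarrow> (('v, 'a) path \<Rightarrow>\<^sub>0 'k::field) set \<Rightarrow> bool" where
  "finite_dim_algebra Q I \<longleftrightarrow>
     ring.finite_dimension (quiver_algebra Q I)
       (range (\<lambda>c. quot_el Q I (scalar_el Q c))) (carrier (quiver_algebra Q I))"

definition gentle ::
    "('v, 'a) pre_digraph \<Rightarrow> (('v, 'a) path \<Rightarrow>\<^sub>0 'k::field) set \<Rightarrow> bool" where
  "gentle Q I \<longleftrightarrow> gentle_relations Q I \<and> finite_dim_algebra Q I"

definition locally_gentle ::
    "('v, 'a) pre_digraph \<Rightarrow> (('v, 'a) path \<Rightarrow>\<^sub>0 'k::field) set \<Rightarrow> bool" where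
  "locally_gentle Q I \<longleftrightarrow> gentle_relations Q I \<and> \<not> finite_dim_algebra Q I"


section \<open>Maximal paths\<close>

definition basis_paths ::
    "('v, 'a) pre_digraph \<Rightarrow> (('v, 'a) path \<Rightarrow>\<^sub>0 'k::field) set \<Rightarrow> ('v, 'a) path set" where
  "basis_paths Q I = {p \<in> paths Q. path_el p \<notin> I}"

definition finite_maximal ::
    "('v, 'a) pre_digraph \<Rightarrow> (('v, 'a) path \<Rightarrow>\<^sub>0 'k::field) set \<Rightarrow> ('v, 'a) path \<Rightarrow> bool" where
  "finite_maximal Q I p \<longleftrightarrow> p \<in> basis_paths Q I \<and>
     (\<forall>\<alpha>\<in>arcs Q. prod_in Q I p (arrow_path Q \<alpha>)) \<and>
     (\<forall>\<alpha>\<in>arcs Q. prod_in Q I (arrow_path Q \<alpha>) p)"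

definition is_cycle :: "('v, 'a) pre_digraph \<Rightarrow> ('v, 'a) path \<Rightarrow> bool" where
  "is_cycle Q c \<longleftrightarrow> c \<in> paths Q \<and> plen c > 0 \<and> ptarget Q c = fst c"

definition primitive_cycle :: "('v, 'a) pre_digraph \<Rightarrow> ('v, 'a) path \<Rightarrow> bool" where
  "primitive_cycle Q c \<longleftrightarrow> is_cycle Q c \<and> \<not> (\<exists>c' k. is_cycle Q c' \<and> k > 1 \<and> c = ppow c' k)"

definition rotations :: "('v, 'a) pre_digraph \<Rightarrow> ('v, 'a) path \<Rightarrow> ('v, 'a) path set" where
  "rotations Q c =
     {pcomp y x | x y. x \<in> paths Q \<and> y \<in> paths Q \<and> composable Q x y \<and> pcomp x y = c}"

text \<open>
  The infinite path of a primitive cycle is encoded as the set of all rotations of the cycle,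
  so that two primitive cycles give the same infinite path iff they are rotations of each other.
\<close>

datatype ('v, 'a) max_path = Fin_Path "('v, 'a) path" | Inf_Path "('v, 'a) path set"

definition cycle_inf :: "('v, 'a) pre_digraph \<Rightarrow> ('v, 'a) path \<Rightarrow> ('v, 'a) max_path" where
  "cycle_inf Q c = Inf_Path (rotations Q c)"

definition infinite_max_paths ::
    "('v, 'a) pre_digraph \<Rightarrow> (('v, 'a) path \<Rightarrow>\<^sub>0 'k::field) set \<Rightarrow> ('v, 'a) max_path set" where
  "infinite_max_paths Q I = {cycle_inf Q c | c. primitive_cycle Q c \<and> \<not> prod_in Q I c c}"

definition max_paths ::
    "('v, 'a) pre_digraph \<Rightarrow> (('v, 'a) path \<Rightarrow>\<^sub>0 'k::field) set \<Rightarrow> ('v, 'a) max_path set" where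
  "max_paths Q I = {Fin_Path p | p. finite_maximal Q I p} \<union> infinite_max_paths Q I"

fun subpath_max :: "('v, 'a) pre_digraph \<Rightarrow> ('v, 'a) path \<Rightarrow> ('v, 'a) max_path \<Rightarrow> bool" where
  "subpath_max Q w (Fin_Path p) \<longleftrightarrow> subpath Q w p"
| "subpath_max Q w (Inf_Path C) \<longleftrightarrow> (\<exists>c\<in>C. \<exists>k>0. subpath Q w (ppow c k))"

fun passes_through :: "('v, 'a) pre_digraph \<Rightarrow> ('v, 'a) max_path \<Rightarrow> 'v \<Rightarrow> bool" where
  "passes_through Q (Fin_Path p) v \<longleftrightarrow> v \<in> path_verts Q p"
| "passes_through Q (Inf_Path C) v \<longleftrightarrow> (\<exists>c\<in>C. v \<in> path_verts Q c)"

definition max_path_of ::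
    "('v, 'a) pre_digraph \<Rightarrow> (('v, 'a) path \<Rightarrow>\<^sub>0 'k::field) set \<Rightarrow> 'a \<Rightarrow> ('v, 'a) max_path" where
  "max_path_of Q I \<alpha> = (THE \<gamma>. \<gamma> \<in> max_paths Q I \<and> subpath_max Q (arrow_path Q \<alpha>) \<gamma>)"

definition simple_basis_path_from ::
    "('v, 'a) pre_digraph \<Rightarrow> (('v, 'a) path \<Rightarrow>\<^sub>0 'k::field) set \<Rightarrow> 'a \<Rightarrow> ('v, 'a) path \<Rightarrow> bool" where
  "simple_basis_path_from Q I \<alpha> p \<longleftrightarrow>
     p \<in> basis_paths Q I \<and> snd p \<noteq> [] \<and> hd (snd p) = \<alpha> \<and> distinct (snd p)"

definition gamma_r ::
    "('v, 'a) pre_digraph \<Rightarrow> (('v, 'a) path \<Rightarrow>\<^sub>0 'k::field) set \<Rightarrow> 'a \<Rightarrow> ('v, 'a) path" where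
  "gamma_r Q I \<alpha> = (THE p. simple_basis_path_from Q I \<alpha> p \<and>
     (\<forall>q. simple_basis_path_from Q I \<alpha> q \<longrightarrow> plen q \<le> plen p))"


section \<open>The ideals in the classification\<close>

definition vertex_ideal ::
    "('v, 'a) pre_digraph \<Rightarrow> (('v, 'a) path \<Rightarrow>\<^sub>0 'k::field) set \<Rightarrow> 'v \<Rightarrow> (('v, 'a) path \<Rightarrow>\<^sub>0 'k) set set" where
  "vertex_ideal Q I v =
     Idl\<^bsub>quiver_algebra Q I\<^esub>
       ({quot_el Q I (path_el (stat_path v')) | v'. v' \<in> verts Q - {v}} \<union>
        {quot_el Q I (path_el (arrow_path Q \<alpha>)) | \<alpha>. \<alpha> \<in> arcs Q \<and> tail Q \<alpha> = v \<and> head Q \<alpha> = v})"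

definition path_ideal ::
    "('v, 'a) pre_digraph \<Rightarrow> (('v, 'a) path \<Rightarrow>\<^sub>0 'k::field) set \<Rightarrow> ('v, 'a) max_path \<Rightarrow> (('v, 'a) path \<Rightarrow>\<^sub>0 'k) set set" where
  "path_ideal Q I \<gamma> =
     Idl\<^bsub>quiver_algebra Q I\<^esub>
       {quot_el Q I (path_el (arrow_path Q \<alpha>)) | \<alpha>. \<alpha> \<in> arcs Q \<and> max_path_of Q I \<alpha> = \<gamma>}"

definition ann_ideal ::
    "('v, 'a) pre_digraph \<Rightarrow> (('v, 'a) path \<Rightarrow>\<^sub>0 'k::field) set \<Rightarrow> ('v, 'a) max_path \<Rightarrow> (('v, 'a) path \<Rightarrow>\<^sub>0 'k) set set" where
  "ann_ideal Q I \<gamma> = annihilator (quiver_algebra Q I) (path_ideal Q I \<gamma>)"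

definition m_elem ::
    "('v, 'a) pre_digraph \<Rightarrow> (('v, 'a) path \<Rightarrow>\<^sub>0 'k::field) set \<Rightarrow> ('v, 'a) max_path \<Rightarrow> (('v, 'a) path \<Rightarrow>\<^sub>0 'k) set" where
  "m_elem Q I \<gamma> =
     finsum (quiver_algebra Q I) (\<lambda>\<alpha>. quot_el Q I (path_el (gamma_r Q I \<alpha>)))
       {\<alpha> \<in> arcs Q. max_path_of Q I \<alpha> = \<gamma>}"

text \<open>Evaluation of \<open>f\<close> at \<open>x\<close>; the constant term is multiplied by the identity of the algebra.\<close>

definition poly_eval ::
    "('v, 'a) pre_digraph \<Rightarrow> (('v, 'a) path \<Rightarrow>\<^sub>0 'k::field) set \<Rightarrow> 'k poly \<Rightarrow> (('v, 'a) path \<Rightarrow>\<^sub>0 'k) set \<Rightarrow> (('v, 'a) path \<Rightarrow>\<^sub>0 'k) set" where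
  "poly_eval Q I f x =
     finsum (quiver_algebra Q I)
       (\<lambda>i. quot_el Q I (scalar_el Q (Polynomial.coeff f i))
              \<otimes>\<^bsub>quiver_algebra Q I\<^esub> (x [^]\<^bsub>quiver_algebra Q I\<^esub> i))
       {..Polynomial.degree f}"

definition poly_ideal ::
    "('v, 'a) pre_digraph \<Rightarrow> (('v, 'a) path \<Rightarrow>\<^sub>0 'k::field) set \<Rightarrow> ('v, 'a) max_path \<Rightarrow> 'k poly \<Rightarrow> (('v, 'a) path \<Rightarrow>\<^sub>0 'k) set set" where
  "poly_ideal Q I \<gamma> f =
     ann_ideal Q I \<gamma> <+>\<^bsub>quiver_algebra Q I\<^esub>
       Idl\<^bsub>quiver_algebra Q I\<^esub> {poly_eval Q I f (m_elem Q I \<gamma>)}"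

end

theory Submission
  imports Defs
begin

text \<open>
  An element of \<open>A\<close> is determined by its coefficients at the basis paths, and any ideal containing the
  basis paths in the support of an element contains the element. If a prime ideal \<open>P\<close> contains all
  arrows, it is a vertex ideal. Otherwise let \<open>\<alpha>\<close> be an arrow outside \<open>P\<close>. Then \<open>\<alpha> A \<alpha>\<close> is not contained
  in \<open>P\<close>, so some basis path starts and ends with \<open>\<alpha>\<close>; as every arrow has at most one continuation, \<open>\<alpha>\<close>
  lies on an infinite maximal path \<open>\<gamma>\<close>. Every basis path outside \<open>\<gamma>\<close> is annihilated from the left by
  \<open>\<alpha> A\<close>, whence \<open>P\<close> contains the annihilator of the ideal of \<open>\<gamma>\<close>. The element \<open>m\<close> of \<open>\<gamma>\<close> is central and
  multiplying \<open>x\<close> by cycles from both sides gives \<open>w f(m)\<close> for a path \<open>w\<close> and a polynomial \<open>f\<close> read off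
  from the coefficients of \<open>x\<close>. Hence \<open>P\<close> is determined by the prime ideal of all \<open>f\<close> with \<open>f(m)\<close> in \<open>P\<close>,
  and the same computation shows that a zero or irreducible \<open>p \<noteq> t\<close> conversely yields a prime ideal.
\<close>

section \<open>Elementwise criteria for ideals\<close>

text \<open>The obstacle sits at the vertices: a cycle may pass through a vertex twice, so a
  stationary path does not reveal at which arrow of the cycle it stands, and p(m) has a constant
  term made of stationary paths. The nonstationary paths of a cycle are instead indexed uniquely by
  their first arrow, counted modulo the period n, and their length. Multiplying by a full turn on
  both sides moves every element into their span, at the price of a factor t^2 in the polynomials.
  This price explains the exclusion of t: powers of t must not vanish modulo p, which holds for
  \<open>p = 0\<close> and for irreducible p with p(0) nonzero. A prime ideal containing m, in
  contrast, contains all long paths of the cycle and therefore, by primeness, its arrows. Letting p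
  be zero for the annihilator makes one primality argument serve for the families (2) and
  (3).\<close>

lemma (in ring) nc_prime_idealI:
  assumes P: "ideal P R" "P \<noteq> carrier R"
    and step: "\<And>x y. \<lbrakk>x \<in> carrier R; y \<in> carrier R; x \<notin> P; y \<notin> P\<rbrakk> \<Longrightarrow> \<exists>z\<in>carrier R. x \<otimes> z \<otimes> y \<notin> P"
  shows "nc_prime_ideal R P"
  unfolding nc_prime_ideal_def
proof (intro conjI allI impI P)
  fix J K assume J: "ideal J R" and K: "ideal K R" and sub: "ideal_prod R J K \<subseteq> P"
  show "J \<subseteq> P \<or> K \<subseteq> P"
  proof (rule ccontr)
    assume "\<not> (J \<subseteq> P \<or> K \<subseteq> P)"
    then obtain x y where xy: "x \<in> J" "x \<notin> P" "y \<in> K" "y \<notin> P" by blast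
    then obtain z where z: "z \<in> carrier R" "x \<otimes> z \<otimes> y \<notin> P"
      using step[of x y] ideal.Icarr[OF J] ideal.Icarr[OF K] by blast
    have "x \<otimes> z \<otimes> y \<in> ideal_prod R J K"
      by (intro ideal_prod.prod ideal.I_r_closed[OF J] xy z)
    then show False using z sub by blast
  qed
qed

text \<open>Conditions replace generators: \<open>J\<close> collects all a with a R y inside
  \<open>P\<close>, and \<open>K\<close> all b with J R b inside \<open>P\<close>. Both are
  two-sided, \<open>J\<close> contains \<open>x\<close>, \<open>K\<close> contains \<open>y\<close>,
  and inserting 1 in the middle shows that J K lies in \<open>P\<close>. So elements of generated
  ideals never have to be described.\<close>

lemma (in ring) nc_prime_idealD:
  assumes P: "nc_prime_ideal R P" and x: "x \<in> carrier R" and y: "y \<in> carrier R"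
    and all: "\<And>z. z \<in> carrier R \<Longrightarrow> x \<otimes> z \<otimes> y \<in> P"
  shows "x \<in> P \<or> y \<in> P"
proof -
  have idP: "ideal P R" using P by (simp add: nc_prime_ideal_def)
  interpret P: ideal P R by fact
  define J where "J = {a \<in> carrier R. \<forall>z\<in>carrier R. a \<otimes> z \<otimes> y \<in> P}"
  define K where "K = {b \<in> carrier R. \<forall>a\<in>J. \<forall>z\<in>carrier R. a \<otimes> z \<otimes> b \<in> P}"
  have J: "ideal J R"
  proof (rule idealI[OF ring_axioms])
    show "subgroup J (add_monoid R)"
    proof
      fix a assume "a \<in> J"
      then show "inv\<^bsub>add_monoid R\<^esub> a \<in> J"
        by (auto simp: J_def a_inv_def[symmetric] l_minus y)
    qed (auto simp: J_def l_distr y)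
  next
    fix a b assume a: "a \<in> J" and b: "b \<in> carrier R"
    then show "b \<otimes> a \<in> J"
      by (auto simp: J_def m_assoc y P.I_l_closed)
    have "a \<otimes> b \<otimes> z \<otimes> y = a \<otimes> (b \<otimes> z) \<otimes> y" if "z \<in> carrier R" for z
      using a b y that by (simp add: J_def m_assoc)
    then show "a \<otimes> b \<in> J" using a b by (auto simp: J_def)
  qed
  have JD: "a \<in> carrier R" if "a \<in> J" for a using that by (simp add: J_def)
  have K: "ideal K R"
  proof (rule idealI[OF ring_axioms])
    show "subgroup K (add_monoid R)"
    proof
      fix a assume "a \<in> K"
      then show "inv\<^bsub>add_monoid R\<^esub> a \<in> K"
        by (auto simp: K_def a_inv_def[symmetric] r_minus JD)
    qed (auto simp: K_def r_distr JD)
  next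
    fix b c assume b: "b \<in> K" and c: "c \<in> carrier R"
    then show "b \<otimes> c \<in> K"
      by (auto simp: K_def m_assoc[symmetric] JD P.I_r_closed)
    have "a \<otimes> z \<otimes> (c \<otimes> b) = a \<otimes> (z \<otimes> c) \<otimes> b" if "a \<in> J" "z \<in> carrier R" for a z
      using that b c by (simp add: K_def m_assoc JD)
    then show "c \<otimes> b \<in> K" using b c by (auto simp: K_def)
  qed
  have "ideal_prod R J K \<subseteq> P"
  proof
    fix s assume "s \<in> ideal_prod R J K"
    then show "s \<in> P"
    proof induct
      case (prod i j)
      then have "i \<otimes> \<one> \<otimes> j \<in> P" unfolding K_def by blast
      then show ?case using prod JD by simp
    qed (rule P.a_closed)
  qed
  then have "J \<subseteq> P \<or> K \<subseteq> P" using P J K by (simp add: nc_prime_ideal_def)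
  moreover have "x \<in> J" using x all by (simp add: J_def)
  moreover have "y \<in> K" using y by (simp add: K_def J_def)
  ultimately show ?thesis by blast
qed

lemma (in ring) annihilator_ideal:
  assumes J: "ideal J R"
  shows "ideal (annihilator R J) R"
proof (rule idealI[OF ring_axioms])
  interpret J: ideal J R by fact
  show "subgroup (annihilator R J) (add_monoid R)"
  proof
    fix a assume "a \<in> annihilator R J"
    then show "inv\<^bsub>add_monoid R\<^esub> a \<in> annihilator R J"
      by (auto simp: annihilator_def a_inv_def[symmetric] l_minus J.Icarr)
  qed (auto simp: annihilator_def l_distr J.Icarr)
  fix a x assume "a \<in> annihilator R J" "x \<in> carrier R"
  then show "x \<otimes> a \<in> annihilator R J" "a \<otimes> x \<in> annihilator R J"
    by (auto simp: annihilator_def m_assoc J.Icarr J.I_l_closed)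
qed

lemma (in ideal) finsum_closed_ideal:
  "(\<And>i. i \<in> T \<Longrightarrow> f i \<in> I) \<Longrightarrow> finsum R f T \<in> I"
proof (induction T rule: infinite_finite_induct)
  case (insert i T)
  then show ?case
    using a_Hcarr by (subst finsum_insert) (auto intro!: a_closed)
qed auto

text \<open>The left multiples of a central element already form a two-sided ideal, since a factor
  on the right can be moved past \<open>c\<close>. This form of the elements makes the ideal
  generated by p(m) testable on coefficients.\<close>

lemma (in ring) Idl_central:
  assumes c: "c \<in> carrier R" and central: "\<And>x. x \<in> carrier R \<Longrightarrow> c \<otimes> x = x \<otimes> c"
  shows "Idl {c} \<subseteq> {x \<otimes> c | x. x \<in> carrier R}"
proof (rule genideal_minimal)
  show "{c} \<subseteq> {x \<otimes> c |x. x \<in> carrier R}" using c by (force intro: exI[of _ \<one>])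
  show "ideal {x \<otimes> c |x. x \<in> carrier R} R"
  proof (rule idealI[OF ring_axioms])
    show "subgroup {x \<otimes> c |x. x \<in> carrier R} (add_monoid R)"
    proof (unfold_locales, goal_cases)
      case 1
      then show ?case using c by auto
    next
      case (2 x y)
      then obtain s t where st: "s \<in> carrier R" "t \<in> carrier R" "x = s \<otimes> c" "y = t \<otimes> c" by auto
      then have "x \<oplus> y = (s \<oplus> t) \<otimes> c" using c by (simp add: l_distr)
      then show ?case using st by auto
    next
      case 3
      then show ?case using c by (auto intro!: exI[of _ \<zero>])
    next
      case (4 x)
      then obtain s where s: "s \<in> carrier R" "x = s \<otimes> c" by auto
      then have "\<ominus> x = (\<ominus> s) \<otimes> c" using c by (simp add: l_minus)
      then show ?case using s by (auto simp: a_inv_def[symmetric])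
    qed
  next
    fix y x assume "y \<in> {x \<otimes> c |x. x \<in> carrier R}" and x: "x \<in> carrier R"
    then obtain s where s: "s \<in> carrier R" "y = s \<otimes> c" by auto
    have "x \<otimes> y = (x \<otimes> s) \<otimes> c" using s x c by (simp add: m_assoc)
    then show "x \<otimes> y \<in> {x \<otimes> c |x. x \<in> carrier R}" using s x by auto
    have "y \<otimes> x = (s \<otimes> x) \<otimes> c" using s x c by (simp add: m_assoc central)
    then show "y \<otimes> x \<in> {x \<otimes> c |x. x \<in> carrier R}" using s x by auto
  qed
qed

section \<open>Path algebras\<close>

lemma ptarget_simp: "ptarget Q (u, as) = (if as = [] then u else head Q (last as))"
proof -
  have ne: "pre_digraph.awalk_verts Q v bs \<noteq> []" for v bs
    by (cases bs) (simp_all add: pre_digraph.awalk_verts.simps)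
  have "pre_digraph.awlast Q u as = (if as = [] then u else head Q (last as))"
    by (induction as arbitrary: u) (simp_all add: pre_digraph.awalk_verts.simps ne)
  then show ?thesis by (simp add: ptarget_def)
qed

text \<open>Same value as \<open>ptarget\<close>, but read off the last arrow instead of a vertex
  list; this gives rules for append and Cons that hold for every list of arrows, walk or
  not.\<close>

definition tgt :: "('v, 'a) pre_digraph \<Rightarrow> 'v \<Rightarrow> 'a list \<Rightarrow> 'v" where
  "tgt Q u as = (if as = [] then u else head Q (last as))"

lemma ptarget_eq_tgt [simp]: "ptarget Q (u, as) = tgt Q u as"
  by (simp add: tgt_def ptarget_simp)

lemma tgt_Nil [simp]: "tgt Q u [] = u" by (simp add: tgt_def)
lemma tgt_append [simp]: "tgt Q u (as @ bs) = tgt Q (tgt Q u as) bs" by (simp add: tgt_def)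
lemma tgt_Cons [simp]: "tgt Q u (a # bs) = tgt Q (head Q a) bs" by (simp add: tgt_def)

lemma mem_paths_Nil [simp]: "(u, []) \<in> paths Q \<longleftrightarrow> u \<in> verts Q"
proof -
  have "pre_digraph.cas Q u [] = (\<lambda>v. u = v)"
    by (rule ext) (rule pre_digraph.cas.simps(1))
  then show ?thesis by (simp add: paths_def pre_digraph.awalk_def)
qed

context wf_digraph
begin

lemma awlast_eq_tgt: "awlast u as = tgt G u as"
  using ptarget_eq_tgt[of G u as] unfolding ptarget_def by simp

lemma mem_paths_awalk: "(u, as) \<in> paths G \<longleftrightarrow> awalk u as (tgt G u as)"
  unfolding paths_def using awlast_eq_tgt[of u as] by auto

lemma mem_paths_append [simp]:
  "(u, as @ bs) \<in> paths G \<longleftrightarrow> (u, as) \<in> paths G \<and> (tgt G u as, bs) \<in> paths G"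
  by (simp add: mem_paths_awalk awlast_eq_tgt)

lemma mem_paths_single [simp]: "(u, [a]) \<in> paths G \<longleftrightarrow> a \<in> arcs G \<and> u = tail G a"
  by (auto simp: mem_paths_awalk awalk_simps)

lemma mem_paths_Cons:
  "(u, a # as) \<in> paths G \<longleftrightarrow> a \<in> arcs G \<and> u = tail G a \<and> (head G a, as) \<in> paths G"
  using mem_paths_append[of u "[a]" as] by auto

lemma paths_fst: "(u, as) \<in> paths G \<Longrightarrow> u \<in> verts G"
  by (auto simp: mem_paths_awalk)

lemma paths_tgt: "(u, as) \<in> paths G \<Longrightarrow> tgt G u as \<in> verts G"
  by (auto simp: mem_paths_awalk)

lemma paths_arcs: "(u, as) \<in> paths G \<Longrightarrow> set as \<subseteq> arcs G"
  by (auto simp: mem_paths_awalk awalk_def)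

lemma paths_take_drop:
  assumes "(u, as) \<in> paths G"
  shows "(u, take i as) \<in> paths G" "(tgt G u (take i as), drop i as) \<in> paths G"
  using assms mem_paths_append[of u "take i as" "drop i as"] by auto

end

text \<open>The coefficient of a product at \<open>q\<close>: all ways to cut \<open>q\<close> after
  \<open>i\<close> arrows. Stated for arbitrary coefficient functions, without supports or
  membership in \<open>paths\<close>, so that associativity is a bare identity of finite
  sums.\<close>

definition conv ::
  "('v, 'a) pre_digraph \<Rightarrow> (('v, 'a) path \<Rightarrow> 'k::comm_ring_1) \<Rightarrow> (('v, 'a) path \<Rightarrow> 'k) \<Rightarrow> ('v, 'a) path \<Rightarrow> 'k" where
  "conv Q F G q = (\<Sum>i\<le>length (snd q). F (fst q, take i (snd q)) * G (tgt Q (fst q) (take i (snd q)), drop i (snd q)))"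

lemma conv_assoc: "conv Q (conv Q F G) H q = conv Q F (conv Q G H) q"
proof -
  obtain u as where q: "q = (u, as)" by (cases q)
  define n where "n = length as"
  define T where "T i j = F (u, take j as) * G (tgt Q u (take j as), take (i - j) (drop j as))
    * H (tgt Q u (take i as), drop i as)" for i j
  have tt: "tgt Q (tgt Q u (take j as)) (take i (drop j as)) = tgt Q u (take (j + i) as)" for i j
    by (simp add: take_add)
  have "conv Q (conv Q F G) H q = (\<Sum>i\<le>n. \<Sum>j\<le>i. T i j)"
    unfolding conv_def q T_def
    by (auto simp: sum_distrib_right n_def drop_take min_def intro!: sum.cong)
  also have "\<dots> = (\<Sum>(i, j)\<in>(SIGMA i:{..n}. {..i}). T i j)"
    by (simp add: sum.Sigma)
  \<comment> \<open>Two cuts \<open>j \<le> i\<close> are renamed to the first cut and the distance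
    to the second, the order in which the other bracketing cuts.\<close>
  also have "\<dots> = (\<Sum>(j, i)\<in>(SIGMA j:{..n}. {..n - j}). T (j + i) j)"
    by (rule sum.reindex_bij_witness[where i = "\<lambda>(j, i). (j + i, j)" and j = "\<lambda>(i, j). (j, i - j)"]) auto
  also have "\<dots> = (\<Sum>j\<le>n. \<Sum>i\<le>n - j. T (j + i) j)"
    by (simp add: sum.Sigma)
  also have "\<dots> = conv Q F (conv Q G H) q"
    unfolding conv_def q T_def
    by (simp add: sum_distrib_left n_def[symmetric] tt mult.assoc add.commute)
  finally show ?thesis .
qed

lemma path_algebra_simps [simp]:
  "carrier (path_algebra Q) = {f. Poly_Mapping.keys f \<subseteq> paths Q}"
  "\<zero>\<^bsub>path_algebra Q\<^esub> = 0" "f \<oplus>\<^bsub>path_algebra Q\<^esub> g = f + g"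
  "\<one>\<^bsub>path_algebra Q\<^esub> = scalar_el Q 1"
  by (simp_all add: path_algebra_def scalar_el_def)

context fin_digraph
begin

lemma lookup_scalar_el:
  "Poly_Mapping.lookup (scalar_el G c) q = (if snd q = [] \<and> fst q \<in> verts G then c else 0)"
  by (cases q) (auto simp: scalar_el_def lookup_sum lookup_single stat_path_def when_def sum.delta
      intro!: sum.neutral)

lemma keys_scalar_el: "Poly_Mapping.keys (scalar_el G c) \<subseteq> paths G"
  by (auto simp: in_keys_iff lookup_scalar_el split: if_splits)

text \<open>Composable pairs with product \<open>q\<close> correspond bijectively to the cuts of
  \<open>q\<close>, so the double sum over the supports collapses to one over cut positions. If
  \<open>q\<close> is not a path, no cut consists of two paths and the coefficient vanishes.\<close>

lemma lookup_mult:
  assumes f: "Poly_Mapping.keys f \<subseteq> paths G" and g: "Poly_Mapping.keys g \<subseteq> paths G"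
  shows "Poly_Mapping.lookup (f \<otimes>\<^bsub>path_algebra G\<^esub> g) q =
    (if q \<in> paths G then conv G (Poly_Mapping.lookup f) (Poly_Mapping.lookup g) q else 0)"
proof -
  obtain u as where q: "q = (u, as)" by (cases q)
  let ?K = "Poly_Mapping.keys f \<times> Poly_Mapping.keys g"
  let ?D = "\<lambda>i. ((u, take i as), (tgt G u (take i as), drop i as))"
  let ?t = "\<lambda>(p, p'). Poly_Mapping.lookup f p * Poly_Mapping.lookup g p'"
  let ?C = "{(p, p'). composable G p p' \<and> pcomp p p' = q}"
  have C: "?C = ?D ` {..length as}"
  proof
    show "?D ` {..length as} \<subseteq> ?C" by (auto simp: q composable_def pcomp_def)
    show "?C \<subseteq> ?D ` {..length as}"
    proof
      fix x assume x: "x \<in> ?C"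
      then obtain w bs v cs where "x = ((w, bs), (v, cs))" by (metis surj_pair)
      with x have "x = ?D (length bs)" "length bs \<le> length as"
        by (auto simp: q composable_def pcomp_def)
      then show "x \<in> ?D ` {..length as}" by blast
    qed
  qed
  have inj: "inj_on ?D {..length as}"
    by (rule inj_onI) (metis Pair_inject atMost_iff length_take min.absorb2)
  have "Poly_Mapping.lookup (f \<otimes>\<^bsub>path_algebra G\<^esub> g) q = (\<Sum>x\<in>?K. if x \<in> ?C then ?t x else 0)"
    unfolding path_algebra_def
    by (simp add: lookup_sum sum.cartesian_product)
       (intro sum.cong refl, auto simp: lookup_single when_def split: if_splits)
  also have "\<dots> = sum ?t (?K \<inter> ?C)"
    by (simp add: sum.inter_restrict)
  finally have *: "Poly_Mapping.lookup (f \<otimes>\<^bsub>path_algebra G\<^esub> g) q = sum ?t (?K \<inter> ?C)" .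
  show ?thesis
  proof (cases "q \<in> paths G")
    case True
    have "sum ?t (?K \<inter> ?C) = sum ?t ?C"
      by (rule sum.mono_neutral_left) (auto simp: C in_keys_iff)
    also have "\<dots> = conv G (Poly_Mapping.lookup f) (Poly_Mapping.lookup g) q"
      unfolding C by (subst sum.reindex[OF inj]) (simp add: conv_def q)
    finally show ?thesis using * True by simp
  next
    case False
    have "?K \<inter> ?C = {}"
    proof (rule ccontr)
      assume "?K \<inter> ?C \<noteq> {}"
      then obtain i where "?D i \<in> ?K" by (auto simp: C)
      then have "(u, take i as) \<in> paths G" "(tgt G u (take i as), drop i as) \<in> paths G"
        using f g by auto
      then have "(u, take i as @ drop i as) \<in> paths G" unfolding mem_paths_append by blast
      then show False using False q by simp
    qed
    then show ?thesis using * False by simp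
  qed
qed

lemma keys_mult:
  assumes "Poly_Mapping.keys f \<subseteq> paths G" "Poly_Mapping.keys g \<subseteq> paths G"
  shows "Poly_Mapping.keys (f \<otimes>\<^bsub>path_algebra G\<^esub> g) \<subseteq> paths G"
  by (auto simp: in_keys_iff lookup_mult[OF assms] split: if_splits)

lemma conv_cong:
  assumes "q \<in> paths G" "\<And>p. p \<in> paths G \<Longrightarrow> F p = F' p" "\<And>p. p \<in> paths G \<Longrightarrow> H p = H' p"
  shows "conv G F H q = conv G F' H' q"
  unfolding conv_def using assms paths_take_drop[of "fst q" "snd q"] by (intro sum.cong refl) auto

lemma conv_scalar_left:
  assumes "q \<in> paths G"
  shows "conv G (Poly_Mapping.lookup (scalar_el G c)) F q = c * F q"
proof -
  obtain u as where q: "q = (u, as)" by (cases q)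
  have "conv G (Poly_Mapping.lookup (scalar_el G c)) F q = (\<Sum>i\<le>length as. if i = 0 then c * F q else 0)"
    unfolding conv_def q using assms paths_fst
    by (intro sum.cong refl) (auto simp: lookup_scalar_el q)
  then show ?thesis by simp
qed

lemma conv_scalar_right:
  assumes "q \<in> paths G"
  shows "conv G F (Poly_Mapping.lookup (scalar_el G c)) q = F q * c"
proof -
  obtain u as where q: "q = (u, as)" by (cases q)
  have "conv G F (Poly_Mapping.lookup (scalar_el G c)) q = (\<Sum>i\<le>length as. if i = length as then F q * c else 0)"
    unfolding conv_def q using assms paths_tgt
    by (intro sum.cong refl) (auto simp: lookup_scalar_el q)
  then show ?thesis by simp
qed

lemma path_algebra_ring: "ring (path_algebra G :: (('a, 'b) path \<Rightarrow>\<^sub>0 'k::field) ring)"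
  (is "ring ?R")
proof (rule ringI)
  show "abelian_group ?R"
  proof (rule abelian_groupI)
    fix x assume "x \<in> carrier ?R"
    then show "\<exists>y\<in>carrier ?R. y \<oplus>\<^bsub>?R\<^esub> x = \<zero>\<^bsub>?R\<^esub>"
      by (intro bexI[of _ "- x"]) auto
  next
    fix x y assume "x \<in> carrier ?R" "y \<in> carrier ?R"
    then show "x \<oplus>\<^bsub>?R\<^esub> y \<in> carrier ?R" using keys_add[of x y] by auto
  qed (auto simp: algebra_simps)
  show "Group.monoid ?R"
  proof (rule monoidI)
    fix x y z assume xyz: "x \<in> carrier ?R" "y \<in> carrier ?R" "z \<in> carrier ?R"
    show "x \<otimes>\<^bsub>?R\<^esub> y \<in> carrier ?R" using xyz keys_mult by simp
    show "x \<otimes>\<^bsub>?R\<^esub> y \<otimes>\<^bsub>?R\<^esub> z = x \<otimes>\<^bsub>?R\<^esub> (y \<otimes>\<^bsub>?R\<^esub> z)"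
    proof (rule poly_mapping_eqI)
      fix q
      have "conv G (Poly_Mapping.lookup (x \<otimes>\<^bsub>?R\<^esub> y)) (Poly_Mapping.lookup z) q =
            conv G (Poly_Mapping.lookup x) (Poly_Mapping.lookup (y \<otimes>\<^bsub>?R\<^esub> z)) q" if "q \<in> paths G"
      proof -
        have "conv G (Poly_Mapping.lookup (x \<otimes>\<^bsub>?R\<^esub> y)) (Poly_Mapping.lookup z) q =
          conv G (conv G (Poly_Mapping.lookup x) (Poly_Mapping.lookup y)) (Poly_Mapping.lookup z) q"
          using xyz by (intro conv_cong that) (auto simp: lookup_mult)
        also have "\<dots> = conv G (Poly_Mapping.lookup x) (Poly_Mapping.lookup (y \<otimes>\<^bsub>?R\<^esub> z)) q"
          unfolding conv_assoc using xyz by (intro conv_cong that) (auto simp: lookup_mult)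
        finally show ?thesis .
      qed
      then show "Poly_Mapping.lookup (x \<otimes>\<^bsub>?R\<^esub> y \<otimes>\<^bsub>?R\<^esub> z) q = Poly_Mapping.lookup (x \<otimes>\<^bsub>?R\<^esub> (y \<otimes>\<^bsub>?R\<^esub> z)) q"
        using xyz by (simp add: lookup_mult keys_mult)
    qed
  next
    show "\<one>\<^bsub>?R\<^esub> \<in> carrier ?R" by (simp add: keys_scalar_el)
  next
    fix x assume x: "x \<in> carrier ?R"
    then have x0: "Poly_Mapping.lookup x q = 0" if "q \<notin> paths G" for q
      using that by (auto simp: in_keys_iff)
    show "\<one>\<^bsub>?R\<^esub> \<otimes>\<^bsub>?R\<^esub> x = x" "x \<otimes>\<^bsub>?R\<^esub> \<one>\<^bsub>?R\<^esub> = x"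
      using x x0
      by (auto intro!: poly_mapping_eqI simp: lookup_mult keys_scalar_el conv_scalar_left conv_scalar_right)
  qed
next
  fix x y z assume xyz: "x \<in> carrier ?R" "y \<in> carrier ?R" "z \<in> carrier ?R"
  have k: "Poly_Mapping.keys (x + y) \<subseteq> paths G" using xyz keys_add by fastforce
  show "(x \<oplus>\<^bsub>?R\<^esub> y) \<otimes>\<^bsub>?R\<^esub> z = x \<otimes>\<^bsub>?R\<^esub> z \<oplus>\<^bsub>?R\<^esub> y \<otimes>\<^bsub>?R\<^esub> z"
    "z \<otimes>\<^bsub>?R\<^esub> (x \<oplus>\<^bsub>?R\<^esub> y) = z \<otimes>\<^bsub>?R\<^esub> x \<oplus>\<^bsub>?R\<^esub> z \<otimes>\<^bsub>?R\<^esub> y"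
    using xyz k
    by (auto intro!: poly_mapping_eqI simp: lookup_mult lookup_add conv_def algebra_simps sum.distrib)
qed

end

section \<open>Coefficients of elements of a gentle algebra\<close>

lemma path_el_mult:
  "path_el p \<otimes>\<^bsub>path_algebra Q\<^esub> path_el q = (if composable Q p q then path_el (pcomp p q) else (0 :: _ \<Rightarrow>\<^sub>0 'k::field))"
  by (simp add: path_algebra_def path_el_def)

lemma scalar_el_mult_single:
  assumes "fin_digraph Q" "q \<in> paths Q"
  shows "scalar_el Q c \<otimes>\<^bsub>path_algebra Q\<^esub> path_el q = Poly_Mapping.single q (c :: 'k::field)"
proof (rule poly_mapping_eqI)
  interpret fin_digraph Q by fact
  fix p
  show "Poly_Mapping.lookup (scalar_el Q c \<otimes>\<^bsub>path_algebra Q\<^esub> path_el q) p = Poly_Mapping.lookup (Poly_Mapping.single q c) p"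
    using assms(2) by (auto simp: lookup_mult keys_scalar_el path_el_def conv_scalar_left lookup_single when_def)
qed

text \<open>The basis coefficients are well-defined because elements of \<open>I\<close> have none.\<close>

definition cf :: "(('v, 'a) path \<Rightarrow>\<^sub>0 'k::field) set \<Rightarrow> ('v, 'a) path \<Rightarrow> 'k" where
  "cf x q = Poly_Mapping.lookup (SOME f. f \<in> x) q"

lemma sum_single_lookup: "(\<Sum>q\<in>Poly_Mapping.keys f. Poly_Mapping.single q (Poly_Mapping.lookup f q)) = f"
  by (rule poly_mapping_eqI) (auto simp: lookup_sum lookup_single when_def sum.delta' in_keys_iff)

text \<open>The common core of gentle and locally gentle; both cases of the theorem are treated in
  it at once.\<close>

locale gentle_quiver =
  fixes Q :: "('v, 'a) pre_digraph" and I :: "(('v, 'a) path \<Rightarrow>\<^sub>0 'k::field) set"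
  assumes quiver: "quiver Q" and relations: "gentle_relations Q I"

sublocale gentle_quiver \<subseteq> fin_digraph Q
  using quiver by (simp add: quiver_def)

context gentle_quiver
begin

abbreviation R :: "(('v, 'a) path \<Rightarrow>\<^sub>0 'k) ring" where "R \<equiv> path_algebra Q"
abbreviation A :: "(('v, 'a) path \<Rightarrow>\<^sub>0 'k) set ring" where "A \<equiv> quiver_algebra Q I"
abbreviation B :: "('v, 'a) path set" where "B \<equiv> basis_paths Q I"

lemma ring_R: "ring R" by (rule path_algebra_ring)

text \<open>Basis paths turn out to be the chains of this relation, and gentleness makes it a
  partial injection on arrows. The combinatorics of paths is carried out with it instead of with
  \<open>I\<close>.\<close>

definition good :: "'a \<Rightarrow> 'a \<Rightarrow> bool" where
  "good \<alpha> \<beta> \<longleftrightarrow> \<alpha> \<in> arcs Q \<and> \<beta> \<in> arcs Q \<and> head Q \<alpha> = tail Q \<beta> \<and> path_el (tail Q \<alpha>, [\<alpha>, \<beta>]) \<notin> I"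

text \<open>\<open>I\<close> is monomial: it consists of the elements supported on the set
  \<open>N\<close> of paths that have a relation from \<open>S\<close> as a factor. Such elements
  form an ideal \<open>M\<close> containing the generators; conversely each path of \<open>N\<close>
  is a relation multiplied by paths on both sides. The three facts depend on the same choice of
  \<open>S\<close>, hence the joint proof.\<close>

lemma I_props:
  shows I_ideal: "ideal I R"
    and I_eq: "I = {f. Poly_Mapping.keys f \<subseteq> paths Q - B}"
    and B_iff: "(u, as) \<in> B \<longleftrightarrow> (u, as) \<in> paths Q \<and> successively good as"
proof -
  obtain S where S: "S \<subseteq> {p \<in> paths Q. plen p = 2}" and I: "I = Idl\<^bsub>R\<^esub> (path_el ` S)"
    using relations by (auto simp: gentle_relations_def)
  interpret R: ring R by (rule ring_R)
  have SR: "path_el ` S \<subseteq> carrier R" using S by (auto simp: path_el_def)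
  show idI: "ideal I R" unfolding I by (rule R.genideal_ideal[OF SR])
  define N where "N = {(u, as). (u, as) \<in> paths Q \<and>
      (\<exists>xs a b ys. as = xs @ [a, b] @ ys \<and> (tail Q a, [a, b]) \<in> S)}"
  have NI: "(u, as) \<in> N"
    if "as = xs @ [a, b] @ ys" "(u, as) \<in> paths Q" "(tail Q a, [a, b]) \<in> S" for u as xs a b ys
    unfolding N_def using that by (intro CollectI case_prodI conjI exI) (assumption | rule refl)+
  have NP: "N \<subseteq> paths Q" by (auto simp: N_def)
  have SN: "S \<subseteq> N"
  proof
    fix p assume p: "p \<in> S"
    obtain u as where ua: "p = (u, as)" by (cases p)
    then have "length as = 2" "(u, as) \<in> paths Q" using p S by (auto simp: plen_def)
    then obtain a b where as: "as = [a, b]" "u = tail Q a"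
      by (auto simp: length_Suc_conv numeral_2_eq_2 mem_paths_Cons)
    have "as = [] @ [a, b] @ []" using as by simp
    then show "p \<in> N" unfolding ua by (rule NI) (use p as ua \<open>(u, as) \<in> paths Q\<close> in auto)
  qed
  have N_I: "path_el q \<in> I" if "q \<in> N" for q
  proof -
    obtain u as where ua: "q = (u, as)" by (cases q)
    then obtain xs a b ys where as: "as = xs @ [a, b] @ ys" "(u, as) \<in> paths Q" "(tail Q a, [a, b]) \<in> S"
      using \<open>q \<in> N\<close> by (auto simp: N_def)
    note q = ua[unfolded as(1)] as(2)[unfolded as(1)] as(3)
    have t: "tgt Q u xs = tail Q a" using q(2) by (auto simp: mem_paths_Cons)
    have "path_el (tail Q a, [a, b]) \<in> I" using q(3) R.genideal_self[OF SR] unfolding I by blast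
    moreover have "path_el (u, xs) \<in> carrier R" "path_el (head Q b, ys) \<in> carrier R"
      using q(2) by (auto simp: path_el_def mem_paths_Cons)
    ultimately have "path_el (u, xs) \<otimes>\<^bsub>R\<^esub> path_el (tail Q a, [a, b]) \<otimes>\<^bsub>R\<^esub> path_el (head Q b, ys) \<in> I"
      by (meson ideal.I_l_closed ideal.I_r_closed idI)
    then show ?thesis
      by (simp add: path_el_mult composable_def pcomp_def t q(1))
  qed
  define M where "M = {f :: ('v, 'a) path \<Rightarrow>\<^sub>0 'k. Poly_Mapping.keys f \<subseteq> N}"
  \<comment> \<open>Read backwards: no cut of a path outside \<open>N\<close> has a piece in
    \<open>N\<close>. This is what makes \<open>M\<close> absorb products.\<close>
  have factor: "(u, as @ bs) \<in> N" if "(u, as) \<in> N \<or> (tgt Q u as, bs) \<in> N" "(u, as @ bs) \<in> paths Q" for u as bs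
    using that(1)
  proof
    assume "(u, as) \<in> N"
    then obtain xs a b ys where "as = xs @ [a, b] @ ys" "(tail Q a, [a, b]) \<in> S" by (auto simp: N_def)
    then have "as @ bs = xs @ [a, b] @ (ys @ bs)" "(tail Q a, [a, b]) \<in> S" by auto
    then show ?thesis using that(2) by (intro NI)
  next
    assume "(tgt Q u as, bs) \<in> N"
    then obtain xs a b ys where "bs = xs @ [a, b] @ ys" "(tail Q a, [a, b]) \<in> S" by (auto simp: N_def)
    then have "as @ bs = (as @ xs) @ [a, b] @ ys" "(tail Q a, [a, b]) \<in> S" by auto
    then show ?thesis using that(2) by (intro NI)
  qed
  have M: "ideal M R"
  proof (rule idealI[OF ring_R])
    show "subgroup M (add_monoid R)"
    proof
      fix x assume x: "x \<in> M"
      then have "- x \<in> M" "- x \<in> carrier R" using NP by (auto simp: M_def)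
      moreover have "inv\<^bsub>add_monoid R\<^esub> x = - x"
        unfolding a_inv_def[symmetric] using x NP by (intro R.minus_equality) (auto simp: M_def)
      ultimately show "inv\<^bsub>add_monoid R\<^esub> x \<in> M" by simp
    next
      fix x y assume "x \<in> M" "y \<in> M"
      then show "x \<otimes>\<^bsub>add_monoid R\<^esub> y \<in> M" using keys_add[of x y] by (auto simp: M_def)
    qed (use NP in \<open>auto simp: M_def\<close>)
  next
    fix f g assume f: "f \<in> M" and g: "g \<in> carrier R"
    have f0: "Poly_Mapping.lookup f q = 0" if "q \<notin> N" for q
      using that f by (auto simp: M_def in_keys_iff)
    have fk: "Poly_Mapping.keys f \<subseteq> paths Q" using f NP by (auto simp: M_def)
    have gk: "Poly_Mapping.keys g \<subseteq> paths Q" using g by simp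
    have split0: "(u, take i as) \<notin> N \<and> (tgt Q u (take i as), drop i as) \<notin> N"
      if "(u, as) \<in> paths Q" "(u, as) \<notin> N" for u as i
      using factor[of u "take i as" "drop i as"] that by auto
    have "Poly_Mapping.lookup (f \<otimes>\<^bsub>R\<^esub> g) q = 0" "Poly_Mapping.lookup (g \<otimes>\<^bsub>R\<^esub> f) q = 0" if "q \<notin> N" for q
      using that split0[of "fst q" "snd q"]
      by (auto simp: lookup_mult[OF fk gk] lookup_mult[OF gk fk] conv_def f0 intro!: sum.neutral)
    then show "g \<otimes>\<^bsub>R\<^esub> f \<in> M" "f \<otimes>\<^bsub>R\<^esub> g \<in> M" unfolding M_def mem_Collect_eq subset_iff in_keys_iff by blast+
  qed
  have "path_el ` S \<subseteq> M" using SN by (auto simp: M_def path_el_def)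
  then have IM: "I \<subseteq> M" unfolding I by (rule R.genideal_minimal[OF M])
  have el_I: "path_el q \<in> I \<longleftrightarrow> q \<in> N" for q
  proof
    assume "path_el q \<in> I"
    then have "path_el q \<in> M" using IM by blast
    then show "q \<in> N" by (simp add: M_def path_el_def)
  qed (rule N_I)
  then have B: "B = paths Q - N" by (auto simp: basis_paths_def)
  interpret I: ideal I R by (rule idI)
  have MI: "f \<in> I" if "f \<in> M" for f
  proof -
    have "(\<Sum>q\<in>T. Poly_Mapping.single q (Poly_Mapping.lookup f q)) \<in> I" if "finite T" "T \<subseteq> N" for T
      using that
    proof (induction T)
      case empty
      then show ?case using I.zero_closed by simp
    next
      case (insert q T)
      have "scalar_el Q (Poly_Mapping.lookup f q) \<otimes>\<^bsub>R\<^esub> path_el q \<in> I"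
        using insert N_I by (intro I.I_l_closed) (auto simp: keys_scalar_el)
      then have "Poly_Mapping.single q (Poly_Mapping.lookup f q) \<in> I"
        using insert NP by (subst (asm) scalar_el_mult_single) (auto intro: fin_digraph_axioms)
      then show ?case using insert I.a_closed by simp
    qed
    from this[of "Poly_Mapping.keys f"] show "f \<in> I"
      using that by (simp add: M_def sum_single_lookup)
  qed
  have "paths Q - B = N" using B NP by auto
  then show "I = {f. Poly_Mapping.keys f \<subseteq> paths Q - B}" using IM MI unfolding M_def by auto
  \<comment> \<open>A path of length two has no other factor of length two, so for it membership in
    \<open>N\<close> and in \<open>S\<close> agree, and \<open>good\<close> is exactly the absence
    of a relation.\<close>
  have nS: "(tail Q a, [a, b]) \<notin> S \<longleftrightarrow> good a b" if "(u, xs @ [a, b] @ ys) \<in> paths Q" for u xs a b ys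
  proof -
    have ab: "a \<in> arcs Q" "b \<in> arcs Q" "head Q a = tail Q b" using that by (auto simp: mem_paths_Cons)
    have "(tail Q a, [a, b]) \<in> N \<longleftrightarrow> (tail Q a, [a, b]) \<in> S"
      using SN by (auto simp: N_def append_eq_Cons_conv Cons_eq_append_conv)
    then show ?thesis using ab el_I by (auto simp: good_def)
  qed
  show "(u, as) \<in> B \<longleftrightarrow> (u, as) \<in> paths Q \<and> successively good as"
  proof (cases "(u, as) \<in> paths Q")
    case True
    have "(u, as) \<notin> N \<longleftrightarrow> (\<forall>xs a b ys. as = xs @ [a, b] @ ys \<longrightarrow> good a b)"
    proof (intro iffI allI impI)
      fix xs a b ys assume N: "(u, as) \<notin> N" and as: "as = xs @ [a, b] @ ys"
      show "good a b" using NI[OF as True] N nS[of u xs a b ys] True as by blast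
    next
      assume *: "\<forall>xs a b ys. as = xs @ [a, b] @ ys \<longrightarrow> good a b"
      show "(u, as) \<notin> N"
      proof
        assume "(u, as) \<in> N"
        then obtain xs a b ys where as: "as = xs @ [a, b] @ ys" "(tail Q a, [a, b]) \<in> S"
          by (auto simp: N_def)
        then show False using *[rule_format, OF as(1)] nS[of u xs a b ys] True by simp
      qed
    qed
    also have "\<dots> \<longleftrightarrow> successively good as"
      unfolding successively_conv_nth
    proof (intro iffI allI impI)
      fix i assume *: "\<forall>xs a b ys. as = xs @ [a, b] @ ys \<longrightarrow> good a b" and i: "Suc i < length as"
      have "as = take i as @ [as ! i, as ! Suc i] @ drop (Suc (Suc i)) as"
        using i by (simp add: Cons_nth_drop_Suc)
      then show "good (as ! i) (as ! Suc i)" using * by blast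
    next
      fix xs a b ys assume *: "\<forall>i. Suc i < length as \<longrightarrow> good (as ! i) (as ! Suc i)" and as: "as = xs @ [a, b] @ ys"
      show "good a b" using *[rule_format, of "length xs"] by (simp add: as nth_append)
    qed
    finally show ?thesis using True B by simp
  qed (simp add: B)
qed

lemma mem_I_iff: "f \<in> I \<longleftrightarrow> Poly_Mapping.keys f \<subseteq> paths Q - B"
  using I_eq by blast

lemma B_paths: "q \<in> B \<Longrightarrow> q \<in> paths Q" by (simp add: basis_paths_def)

lemma prod_in_arrows: "\<lbrakk>a \<in> arcs Q; b \<in> arcs Q\<rbrakk> \<Longrightarrow>
    \<not> prod_in Q I (arrow_path Q a) (arrow_path Q b) \<longleftrightarrow> good a b"
  using additive_subgroup.zero_closed[OF ideal.axioms(1)[OF I_ideal]]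
  by (auto simp: prod_in_def path_el_mult composable_def arrow_path_def pcomp_def good_def)

text \<open>Of two arrows leaving the head of \<open>a\<close>, exactly one has a product with
  \<open>a\<close> in \<open>I\<close>, so at most one continuation survives. Together with the
  mirror image that follows, a chain extends in at most one way at either end.\<close>

lemma good_right_unique: "\<lbrakk>good a b; good a c\<rbrakk> \<Longrightarrow> b = c"
proof (rule ccontr)
  assume ab: "good a b" and ac: "good a c" and "b \<noteq> c"
  have "a \<in> arcs Q" "b \<in> arcs Q" "c \<in> arcs Q" "head Q a = tail Q b" "head Q a = tail Q c"
    using ab ac by (simp_all add: good_def)
  then have "prod_in Q I (arrow_path Q a) (arrow_path Q b) \<longleftrightarrow> \<not> prod_in Q I (arrow_path Q a) (arrow_path Q c)"
    using relations \<open>b \<noteq> c\<close> unfolding gentle_relations_def by blast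
  then show False using prod_in_arrows[of a b] prod_in_arrows[of a c] \<open>a \<in> arcs Q\<close> \<open>b \<in> arcs Q\<close> \<open>c \<in> arcs Q\<close> ab ac
    by blast
qed

lemma good_left_unique: "\<lbrakk>good a c; good b c\<rbrakk> \<Longrightarrow> a = b"
proof (rule ccontr)
  assume ac: "good a c" and bc: "good b c" and "a \<noteq> b"
  have "a \<in> arcs Q" "b \<in> arcs Q" "c \<in> arcs Q" "tail Q c = head Q a" "tail Q c = head Q b"
    using ac bc by (simp_all add: good_def)
  then have "prod_in Q I (arrow_path Q a) (arrow_path Q c) \<longleftrightarrow> \<not> prod_in Q I (arrow_path Q b) (arrow_path Q c)"
    using relations \<open>a \<noteq> b\<close> unfolding gentle_relations_def by blast
  then show False using prod_in_arrows[of a c] prod_in_arrows[of b c] \<open>a \<in> arcs Q\<close> \<open>b \<in> arcs Q\<close> \<open>c \<in> arcs Q\<close> ac bc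
    by blast
qed

lemma B_append: "(u, as @ bs) \<in> B \<longleftrightarrow> (u, as) \<in> B \<and> (tgt Q u as, bs) \<in> B \<and>
    (as \<noteq> [] \<longrightarrow> bs \<noteq> [] \<longrightarrow> good (last as) (hd bs))"
  by (auto simp: B_iff successively_append_iff)

lemma B_Nil [simp]: "(u, []) \<in> B \<longleftrightarrow> u \<in> verts Q"
  by (simp add: B_iff)

lemma B_single [simp]: "(u, [a]) \<in> B \<longleftrightarrow> a \<in> arcs Q \<and> u = tail Q a"
  by (simp add: B_iff)

lemma B_split:
  assumes "(u, as) \<in> B"
  shows "(u, take i as) \<in> B" "(tgt Q u (take i as), drop i as) \<in> B"
  using assms B_append[of u "take i as" "drop i as"] by auto

lemma prod_in_paths:
  assumes "(u, as) \<in> paths Q" "(w, bs) \<in> paths Q"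
  shows "\<not> prod_in Q I (u, as) (w, bs) \<longleftrightarrow> tgt Q u as = w \<and> (u, as @ bs) \<in> B"
  using additive_subgroup.zero_closed[OF ideal.axioms(1)[OF I_ideal]] assms
  by (auto simp: prod_in_def path_el_mult composable_def pcomp_def basis_paths_def)

section \<open>The quotient algebra in coordinates with respect to the basis paths\<close>

abbreviation el :: "('v, 'a) path \<Rightarrow> (('v, 'a) path \<Rightarrow>\<^sub>0 'k) set" where
  "el q \<equiv> quot_el Q I (path_el q)"

abbreviation sc :: "'k \<Rightarrow> (('v, 'a) path \<Rightarrow>\<^sub>0 'k) set" where
  "sc c \<equiv> quot_el Q I (scalar_el Q c)"

sublocale A: ring A
  by (rule ideal.quotient_is_ring[OF I_ideal])

lemma quot_hom: "quot_el Q I \<in> ring_hom R A"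
proof -
  have "quot_el Q I = (+>\<^bsub>R\<^esub>) I" by (rule ext) (simp add: quot_el_def)
  then show ?thesis using ideal.rcos_ring_hom[OF I_ideal] by simp
qed

lemma quot_closed [simp]: "Poly_Mapping.keys f \<subseteq> paths Q \<Longrightarrow> quot_el Q I f \<in> carrier A"
  using ring_hom_closed[OF quot_hom] by simp

lemma quot_mult: "\<lbrakk>Poly_Mapping.keys f \<subseteq> paths Q; Poly_Mapping.keys g \<subseteq> paths Q\<rbrakk> \<Longrightarrow>
    quot_el Q I f \<otimes>\<^bsub>A\<^esub> quot_el Q I g = quot_el Q I (f \<otimes>\<^bsub>R\<^esub> g)"
  using ring_hom_mult[OF quot_hom, of f g] by simp

lemma quot_add: "\<lbrakk>Poly_Mapping.keys f \<subseteq> paths Q; Poly_Mapping.keys g \<subseteq> paths Q\<rbrakk> \<Longrightarrow>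
    quot_el Q I f \<oplus>\<^bsub>A\<^esub> quot_el Q I g = quot_el Q I (f + g)"
  using ring_hom_add[OF quot_hom, of f g] by simp

lemma quot_one: "\<one>\<^bsub>A\<^esub> = sc 1"
  using ring_hom_one[OF quot_hom] by simp

lemma quot_zero: "\<zero>\<^bsub>A\<^esub> = quot_el Q I 0"
  using ring_hom_zero[OF quot_hom ring_R A.ring_axioms] by simp

lemma carrier_A_E:
  assumes "x \<in> carrier A"
  obtains f where "Poly_Mapping.keys f \<subseteq> paths Q" "x = quot_el Q I f"
  using assms by (auto simp: FactRing_def A_RCOSETS_def' quot_el_def)

lemma quot_eq_iff:
  assumes "Poly_Mapping.keys f \<subseteq> paths Q" "Poly_Mapping.keys g \<subseteq> paths Q"
  shows "quot_el Q I f = quot_el Q I g \<longleftrightarrow> f - g \<in> I"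
proof -
  interpret R: ring R by (rule ring_R)
  have k: "Poly_Mapping.keys (- g) \<subseteq> paths Q" "Poly_Mapping.keys (f - g) \<subseteq> paths Q"
    using assms keys_diff[of f g] by auto
  have m: "\<ominus>\<^bsub>R\<^esub> g = - g" using assms k by (intro R.minus_equality) auto
  show ?thesis
    using R.quotient_eq_iff_same_a_r_cos[OF I_ideal, of f g] assms
    by (simp add: a_minus_def m quot_el_def)
qed

lemma cf_quot:
  assumes f: "Poly_Mapping.keys f \<subseteq> paths Q" and q: "q \<in> B"
  shows "cf (quot_el Q I f) q = Poly_Mapping.lookup f q"
proof -
  interpret I: ideal I R by (rule I_ideal)
  have "f \<in> quot_el Q I f" unfolding quot_el_def using f by (intro I.a_rcos_self) simp
  then have "(SOME g. g \<in> quot_el Q I f) \<in> quot_el Q I f" by (rule someI)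
  then obtain h where h: "h \<in> I" "(SOME g. g \<in> quot_el Q I f) = h + f"
    by (auto simp: quot_el_def a_r_coset_def')
  then have "Poly_Mapping.lookup h q = 0" using q mem_I_iff[of h] by (auto simp: in_keys_iff)
  then show ?thesis by (simp add: cf_def h(2) lookup_add)
qed

lemma cf_eqI:
  assumes x: "x \<in> carrier A" and y: "y \<in> carrier A" and eq: "\<And>q. q \<in> B \<Longrightarrow> cf x q = cf y q"
  shows "x = y"
proof -
  obtain f g where f: "Poly_Mapping.keys f \<subseteq> paths Q" "x = quot_el Q I f"
    and g: "Poly_Mapping.keys g \<subseteq> paths Q" "y = quot_el Q I g"
    using carrier_A_E[OF x] carrier_A_E[OF y] by metis
  have "Poly_Mapping.lookup f q = Poly_Mapping.lookup g q" if "q \<in> B" for q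
    using eq[OF that] f g cf_quot that by simp
  moreover have "Poly_Mapping.keys (f - g) \<subseteq> paths Q" using f g keys_diff[of f g] by auto
  ultimately have "Poly_Mapping.keys (f - g) \<subseteq> paths Q - B"
    by (auto simp: in_keys_iff lookup_minus)
  then have "f - g \<in> I" using mem_I_iff by blast
  then show ?thesis using f g quot_eq_iff by simp
qed

lemma cf_add:
  assumes "x \<in> carrier A" "y \<in> carrier A" "q \<in> B"
  shows "cf (x \<oplus>\<^bsub>A\<^esub> y) q = cf x q + cf y q"
proof -
  obtain f g where f: "Poly_Mapping.keys f \<subseteq> paths Q" "x = quot_el Q I f"
    and g: "Poly_Mapping.keys g \<subseteq> paths Q" "y = quot_el Q I g"
    using carrier_A_E assms by metis
  have "Poly_Mapping.keys (f + g) \<subseteq> paths Q" using f g keys_add[of f g] by auto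
  then show ?thesis using f g assms by (simp add: quot_add cf_quot lookup_add)
qed

text \<open>Pieces of a basis path are basis paths, so every coefficient in the cut formula is one
  that \<open>cf\<close> records independently of the representative.\<close>

lemma cf_mult:
  assumes "x \<in> carrier A" "y \<in> carrier A" "(u, as) \<in> B"
  shows "cf (x \<otimes>\<^bsub>A\<^esub> y) (u, as) =
    (\<Sum>i\<le>length as. cf x (u, take i as) * cf y (tgt Q u (take i as), drop i as))"
proof -
  obtain f g where f: "Poly_Mapping.keys f \<subseteq> paths Q" "x = quot_el Q I f"
    and g: "Poly_Mapping.keys g \<subseteq> paths Q" "y = quot_el Q I g"
    using carrier_A_E assms by metis
  show ?thesis
    using f g assms B_split[OF assms(3)] B_paths[OF assms(3)]
    by (simp add: quot_mult cf_quot keys_mult lookup_mult conv_def)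
qed

lemma cf_zero [simp]: "q \<in> B \<Longrightarrow> cf \<zero>\<^bsub>A\<^esub> q = 0"
  by (simp add: quot_zero cf_quot)

lemma cf_neg:
  assumes "x \<in> carrier A" "q \<in> B"
  shows "cf (\<ominus>\<^bsub>A\<^esub> x) q = - cf x q"
proof -
  have "cf (x \<oplus>\<^bsub>A\<^esub> \<ominus>\<^bsub>A\<^esub> x) q = 0" using assms by (simp add: A.r_neg)
  then show ?thesis using assms by (simp add: cf_add add_eq_0_iff del: A.r_neg)
qed

lemma el_closed [simp]: "q \<in> paths Q \<Longrightarrow> el q \<in> carrier A"
  by (simp add: path_el_def)

lemma sc_closed [simp]: "sc c \<in> carrier A"
  by (simp add: keys_scalar_el)

lemma cf_el: "\<lbrakk>p \<in> paths Q; q \<in> B\<rbrakk> \<Longrightarrow> cf (el p) q = (if p = q then 1 else 0)"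
  by (subst cf_quot) (auto simp: path_el_def lookup_single when_def)

lemma cf_sc: "q \<in> B \<Longrightarrow> cf (sc c) q = (if snd q = [] then c else 0)"
  using B_Nil[of "fst q"] by (cases q) (auto simp: cf_quot keys_scalar_el lookup_scalar_el)

lemma cf_one: "q \<in> B \<Longrightarrow> cf \<one>\<^bsub>A\<^esub> q = (if snd q = [] then 1 else 0)"
  by (simp add: quot_one cf_sc)

lemma el_mult:
  assumes "(u, as) \<in> paths Q" "(tgt Q u as, bs) \<in> paths Q"
  shows "el (u, as) \<otimes>\<^bsub>A\<^esub> el (tgt Q u as, bs) = el (u, as @ bs)"
  using assms by (simp add: quot_mult path_el_mult composable_def pcomp_def path_el_def[where p = "(u, as)"] path_el_def[where p = "(tgt Q u as, bs)"] path_el_mult[unfolded path_el_def])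
    (simp add: path_el_def)

lemma cf_sc_mult:
  assumes "x \<in> carrier A" "q \<in> B"
  shows "cf (sc c \<otimes>\<^bsub>A\<^esub> x) q = c * cf x q" "cf (x \<otimes>\<^bsub>A\<^esub> sc c) q = cf x q * c"
proof -
  obtain f where f: "Poly_Mapping.keys f \<subseteq> paths Q" "x = quot_el Q I f"
    using carrier_A_E assms by metis
  show "cf (sc c \<otimes>\<^bsub>A\<^esub> x) q = c * cf x q" "cf (x \<otimes>\<^bsub>A\<^esub> sc c) q = cf x q * c"
    using f assms B_paths[OF assms(2)]
    by (simp_all add: quot_mult cf_quot keys_scalar_el keys_mult lookup_mult conv_scalar_left conv_scalar_right)
qed

lemma finite_cf:
  assumes "x \<in> carrier A"
  shows "finite {q \<in> B. cf x q \<noteq> 0}"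
proof -
  obtain f where f: "Poly_Mapping.keys f \<subseteq> paths Q" "x = quot_el Q I f"
    using carrier_A_E assms by metis
  have "{q \<in> B. cf x q \<noteq> 0} \<subseteq> Poly_Mapping.keys f"
    using f by (auto simp: cf_quot in_keys_iff)
  then show ?thesis using finite_subset finite_keys by blast
qed

lemma mem_ideal_if_support:
  assumes P: "ideal P A" and x: "x \<in> carrier A"
    and supp: "\<And>q. \<lbrakk>q \<in> B; cf x q \<noteq> 0\<rbrakk> \<Longrightarrow> el q \<in> P"
  shows "x \<in> P"
proof -
  interpret P: ideal P A by (rule P)
  obtain f where f: "Poly_Mapping.keys f \<subseteq> paths Q" "x = quot_el Q I f"
    using carrier_A_E x by metis
  have "quot_el Q I (\<Sum>q\<in>T. Poly_Mapping.single q (Poly_Mapping.lookup f q)) \<in> P"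
    if "finite T" "T \<subseteq> Poly_Mapping.keys f" for T
    using that
  proof (induction T)
    case empty
    then show ?case using P.zero_closed by (simp add: quot_zero)
  next
    case (insert q T)
    let ?s = "\<lambda>q. Poly_Mapping.single q (Poly_Mapping.lookup f q)"
    have q: "q \<in> paths Q" using insert f by auto
    have kq: "Poly_Mapping.keys (?s q) \<subseteq> paths Q" using q by simp
    have "Poly_Mapping.keys (sum ?s T) \<subseteq> (\<Union>q\<in>T. Poly_Mapping.keys (?s q))" by (rule keys_sum)
    also have "\<dots> \<subseteq> paths Q" using insert f by auto
    finally have kT: "Poly_Mapping.keys (sum ?s T) \<subseteq> paths Q" .
    have "quot_el Q I (?s q) \<in> P"
    proof (cases "q \<in> B")
      case True
      have "sc (Poly_Mapping.lookup f q) \<otimes>\<^bsub>A\<^esub> el q \<in> P"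
        using insert f True supp[of q] by (intro P.I_l_closed) (auto simp: cf_quot in_keys_iff)
      then show ?thesis
        using q by (simp add: quot_mult keys_scalar_el scalar_el_mult_single[OF fin_digraph_axioms] path_el_def[of q] scalar_el_mult_single[OF fin_digraph_axioms, unfolded path_el_def])
    next
      case False
      then have "?s q \<in> I" using q mem_I_iff by simp
      then have "quot_el Q I (?s q) = \<zero>\<^bsub>A\<^esub>" using kq by (simp add: quot_zero quot_eq_iff)
      then show ?thesis using P.zero_closed by simp
    qed
    then show ?case using insert kq kT P.a_closed by (simp add: quot_add[symmetric])
  qed
  from this[of "Poly_Mapping.keys f"] show ?thesis
    using f by (simp add: sum_single_lookup)
qed

text \<open>Only the cut after \<open>length as - length bs\<close> arrows can have
  \<open>bs\<close> as its right piece, so the sum has at most one nonzero term. For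
  \<open>bs = []\<close> the condition merely asks that the path end at \<open>w\<close>.\<close>

lemma cf_mult_el:
  assumes x: "x \<in> carrier A" and p: "(w, bs) \<in> paths Q" and q: "(u, as) \<in> B"
  shows "cf (x \<otimes>\<^bsub>A\<^esub> el (w, bs)) (u, as) =
    (if \<exists>cs. as = cs @ bs \<and> tgt Q u cs = w then cf x (u, take (length as - length bs) as) else 0)"
proof -
  let ?n = "length as - length bs"
  define E where "E \<longleftrightarrow> (\<exists>cs. as = cs @ bs \<and> tgt Q u cs = w)"
  have "cf (x \<otimes>\<^bsub>A\<^esub> el (w, bs)) (u, as) = (\<Sum>i\<le>length as. if i = ?n then
      (if E then cf x (u, take ?n as) else 0) else 0)"
    unfolding cf_mult[OF x el_closed[OF p] q]
  proof (intro sum.cong refl)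
    fix i assume i: "i \<in> {..length as}"
    have "(w, bs) = (tgt Q u (take i as), drop i as) \<longleftrightarrow> i = ?n \<and> E"
    proof
      assume "(w, bs) = (tgt Q u (take i as), drop i as)"
      then show "i = ?n \<and> E"
        using i by (auto simp: E_def intro!: exI[of _ "take i as"])
    qed (auto simp: E_def)
    then show "cf x (u, take i as) * cf (el (w, bs)) (tgt Q u (take i as), drop i as) = (if i = ?n then
      (if E then cf x (u, take ?n as) else 0) else 0)"
      using B_split[OF q] by (auto simp: cf_el p)
  qed
  then show ?thesis unfolding E_def by simp
qed

lemma cf_el_mult:
  assumes x: "x \<in> carrier A" and p: "(w, bs) \<in> paths Q" and q: "(u, as) \<in> B"
  shows "cf (el (w, bs) \<otimes>\<^bsub>A\<^esub> x) (u, as) =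
    (if u = w \<and> (\<exists>cs. as = bs @ cs) then cf x (tgt Q u bs, drop (length bs) as) else 0)"
proof -
  have "cf (el (w, bs) \<otimes>\<^bsub>A\<^esub> x) (u, as) = (\<Sum>i\<le>length as. if i = length bs then
      (if u = w \<and> (\<exists>cs. as = bs @ cs) then cf x (tgt Q u bs, drop (length bs) as) else 0) else 0)"
    unfolding cf_mult[OF el_closed[OF p] x q]
  proof (intro sum.cong refl)
    fix i assume i: "i \<in> {..length as}"
    have "(w, bs) = (u, take i as) \<longleftrightarrow> i = length bs \<and> u = w \<and> (\<exists>cs. as = bs @ cs)"
    proof
      assume "(w, bs) = (u, take i as)"
      then show "i = length bs \<and> u = w \<and> (\<exists>cs. as = bs @ cs)"
        using i by (auto intro!: exI[of _ "drop i as"])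
    qed auto
    then show "cf (el (w, bs)) (u, take i as) * cf x (tgt Q u (take i as), drop i as) = (if i = length bs then
      (if u = w \<and> (\<exists>cs. as = bs @ cs) then cf x (tgt Q u bs, drop (length bs) as) else 0) else 0)"
      using B_split[OF q] by (auto simp: cf_el p)
  qed
  then show ?thesis by auto
qed

end

section \<open>Maximal paths\<close>

text \<open>An infinite maximal path is described by its periodic arrow sequence \<open>a\<close>.\<close>

definition cycle_path :: "('v, 'a) pre_digraph \<Rightarrow> (nat \<Rightarrow> 'a) \<Rightarrow> nat \<Rightarrow> nat \<Rightarrow> ('v, 'a) path" where
  "cycle_path Q a i l = (tail Q (a i), map a [i..<i + l])"

definition cycle_max_path :: "('v, 'a) pre_digraph \<Rightarrow> (nat \<Rightarrow> 'a) \<Rightarrow> nat \<Rightarrow> ('v, 'a) max_path" where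
  "cycle_max_path Q a n = Inf_Path {cycle_path Q a i n | i. True}"

text \<open>One turn of an infinite maximal path, unrolled along the natural numbers.
  \<open>a_eq_iff\<close> expresses at once that the sequence has period \<open>n\<close> and that
  the arrows of one turn are distinct. Unrolling avoids case distinctions for paths that wrap
  around.\<close>

locale gentle_cycle = gentle_quiver Q I
  for Q :: "('v, 'a) pre_digraph" and I :: "(('v, 'a) path \<Rightarrow>\<^sub>0 'k::field) set" +
  fixes a :: "nat \<Rightarrow> 'a" and n :: nat
  assumes n_pos: "n > 0"
    and good_a: "good (a i) (a (Suc i))"
    and a_eq_iff: "a i = a j \<longleftrightarrow> i mod n = j mod n"
begin

abbreviation pth :: "nat \<Rightarrow> nat \<Rightarrow> ('v, 'a) path" where "pth \<equiv> cycle_path Q a"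
abbreviation gam :: "('v, 'a) max_path" where "gam \<equiv> cycle_max_path Q a n"

lemma a_arcs [simp]: "a i \<in> arcs Q" using good_a[of i] by (simp add: good_def)

lemma head_a: "head Q (a i) = tail Q (a (Suc i))" using good_a[of i] by (simp add: good_def)

lemma tgt_pth [simp]: "tgt Q (tail Q (a i)) (map a [i..<i + l]) = tail Q (a (i + l))"
  by (cases l) (simp_all add: tgt_def head_a)

lemma length_pth [simp]: "length (snd (pth i l)) = l" by (simp add: cycle_path_def)

lemma snd_pth_Nil [simp]: "snd (pth i l) = [] \<longleftrightarrow> l = 0" by (auto simp: cycle_path_def)

lemma pth_B [simp]: "pth i l \<in> B"
proof (induction l)
  case 0
  then show ?case by (simp add: cycle_path_def)
next
  case (Suc l)
  have "l > 0 \<Longrightarrow> good (last (map a [i..<i + l])) (a (i + l))"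
    using good_a[of "i + l - 1"] by (cases l) auto
  then show ?case using Suc by (auto simp: cycle_path_def B_append)
qed

lemma pth_paths [simp]: "pth i l \<in> paths Q" using B_paths pth_B by blast

lemma a_cong: "i mod n = j mod n \<Longrightarrow> a (i + t) = a (j + t)"
  by (simp add: a_eq_iff) (metis mod_add_left_eq)

lemma pth_cong: "i mod n = j mod n \<Longrightarrow> pth i l = pth j l"
  using a_cong[of i j] a_cong[of i j 0] by (auto simp: cycle_path_def list_eq_iff_nth_eq)

lemma pth_mod: "pth (i mod n) l = pth i l" by (rule pth_cong) simp

lemma pth_add_n [simp]: "pth (i + n) l = pth i l" "pth (n + i) l = pth i l"
  by (rule pth_cong; simp)+

lemma pth_length_eq: "pth i l = pth j l' \<Longrightarrow> l = l'"
  by (metis length_pth)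

text \<open>The start is read off the first arrow. A stationary path has none, and a vertex passed
  twice gives \<open>pth i 0 = pth j 0\<close> for incongruent indices; hence
  \<open>l > 0\<close>.\<close>

lemma pth_eq_iff: "l > 0 \<Longrightarrow> pth i l = pth j l' \<longleftrightarrow> l = l' \<and> i mod n = j mod n"
proof
  assume l: "l > 0" and eq: "pth i l = pth j l'"
  have "l = l'" using pth_length_eq eq .
  moreover have "a i = a j" using eq l \<open>l = l'\<close> by (auto simp: cycle_path_def upt_conv_Cons)
  ultimately show "l = l' \<and> i mod n = j mod n" by (simp add: a_eq_iff)
qed (auto intro: pth_cong)

lemma pth_take: "t \<le> l \<Longrightarrow> (tail Q (a i), take t (map a [i..<i + l])) = pth i t"
  by (simp add: cycle_path_def take_map)

lemma pth_drop: "t \<le> l \<Longrightarrow> (tail Q (a (i + t)), drop t (map a [i..<i + l])) = pth (i + t) (l - t)"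
  by (simp add: cycle_path_def drop_map)

lemma pth_append: "map a [i..<i + l] @ map a [i + l..<i + l + l'] = map a [i..<i + (l + l')]"
  by (simp add: add.assoc[symmetric] upt_add_eq_append[of i "i + l" l'])

text \<open>One common arrow suffices: \<open>good\<close> determines both the successor and the
  predecessor of an arrow, so the agreement with \<open>a\<close> propagates from that arrow to both
  ends of the path.\<close>

lemma basis_path_in_cycle:
  assumes B: "(u, bs) \<in> B" and k: "a j \<in> set bs"
  shows "\<exists>i. (u, bs) = pth i (length bs)"
proof -
  obtain k where k: "k < length bs" "bs ! k = a j" using k by (auto simp: in_set_conv_nth)
  \<comment> \<open>An index congruent to \<open>j\<close> and at least \<open>k\<close>, so that
    going back to the first arrow of \<open>bs\<close> never meets truncated subtraction.\<close>
  define m where "m = j + k * n"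
  have mk: "m \<ge> k" using n_pos by (simp add: m_def trans_le_add2)
  have m: "bs ! k = a m" using k a_eq_iff[of m j] by (simp add: m_def)
  have g: "good (bs ! t) (bs ! Suc t)" if "Suc t < length bs" for t
    using B that by (simp add: B_iff successively_conv_nth)
  have up: "k + t < length bs \<Longrightarrow> bs ! (k + t) = a (m + t)" for t
  proof (induction t)
    case (Suc t)
    then show ?case using good_right_unique[OF g[of "k + t"]] good_a[of "m + t"] by simp
  qed (simp add: m)
  have down: "t \<le> k \<Longrightarrow> bs ! (k - t) = a (m - t)" for t
  proof (induction t)
    case (Suc t)
    have "Suc (k - Suc t) = k - t" "Suc (m - Suc t) = m - t" using Suc mk by auto
    moreover have "bs ! (k - t) = a (m - t)" using Suc by simp
    ultimately have "good (bs ! (k - Suc t)) (a (m - t))" "good (a (m - Suc t)) (a (m - t))"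
      using g[of "k - Suc t"] k(1) good_a[of "m - Suc t"] by auto
    then show ?case by (rule good_left_unique)
  qed (simp add: m)
  have all: "bs ! t = a (m - k + t)" if "t < length bs" for t
  proof (cases "t \<ge> k")
    case True
    then show ?thesis using up[of "t - k"] that mk by simp
  next
    case False
    then show ?thesis using down[of "k - t"] mk by (simp add: algebra_simps)
  qed
  have bs: "bs = map a [m - k..<m - k + length bs]"
    by (rule nth_equalityI) (simp_all add: all)
  have "u = tail Q (a (m - k))"
    using B_paths[OF B] k(1) all[of 0] by (cases bs) (auto simp: mem_paths_Cons)
  then show ?thesis using bs by (auto simp: cycle_path_def)
qed

lemma basis_path_from_cycle:
  assumes B: "(u, bs) \<in> B" and ne: "bs \<noteq> []" and hd: "hd bs = a i"
  shows "(u, bs) = pth i (length bs)"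
proof -
  obtain j where j: "(u, bs) = pth j (length bs)"
    using basis_path_in_cycle[OF B, of i] ne hd hd_in_set[OF ne] by auto
  then have "a j = a i" using ne hd by (simp add: cycle_path_def) (metis hd_map hd_upt length_greater_0_conv less_add_same_cancel1 list.map_disc_iff upt_eq_Nil_conv)
  then show ?thesis using j pth_cong[of j i "length bs"] a_eq_iff by simp
qed

text \<open>The whole path contains an arrow of the cycle, hence runs along it, and so do its
  pieces. This includes \<open>bs = []\<close>, where it puts the vertex \<open>u\<close> on the
  cycle, as is needed for stationary terms in the annihilator.\<close>

lemma basis_path_in_cycle_prefix:
  assumes B: "(u, bs @ cs) \<in> B" and c: "(tgt Q u bs, cs) = pth j l" and l: "l > 0"
  shows "\<exists>i. (u, bs) = pth i (length bs)"
proof -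
  have "a j \<in> set (bs @ cs)" using c l by (auto simp: cycle_path_def)
  then obtain i where "(u, bs @ cs) = pth i (length (bs @ cs))" using basis_path_in_cycle[OF B] by blast
  then have "(u, take (length bs) (bs @ cs)) = pth i (length bs)"
    using pth_take[of "length bs" "length (bs @ cs)" i] by (simp add: cycle_path_def)
  then show ?thesis by auto
qed

lemma basis_path_in_cycle_suffix:
  assumes B: "(u, bs @ cs) \<in> B" and c: "(u, bs) = pth j l" and l: "l > 0"
  shows "\<exists>i. (tgt Q u bs, cs) = pth i (length cs)"
proof -
  have "a j \<in> set (bs @ cs)" using c l by (auto simp: cycle_path_def)
  then obtain i where i: "(u, bs @ cs) = pth i (length (bs @ cs))" using basis_path_in_cycle[OF B] by blast
  have "(tail Q (a (i + length bs)), drop (length bs) (bs @ cs)) = pth (i + length bs) (length cs)"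
    using pth_drop[of "length bs" "length (bs @ cs)" i] i by (simp add: cycle_path_def)
  moreover have "(u, bs) = pth i (length bs)"
    using pth_take[of "length bs" "length (bs @ cs)" i] i unfolding cycle_path_def
    by (metis append_eq_conv_conj length_append le_add1 prod.inject)
  then have "tgt Q u bs = tail Q (a (i + length bs))" by (metis cycle_path_def prod.inject tgt_pth)
  ultimately show ?thesis by auto
qed

lemma ppow_pth: "ppow (pth i n) k = pth i (k * n)"
proof (induction k)
  case (Suc k)
  have "ppow (pth i n) (Suc k) = pcomp (pth i n) (pth (i + n) (k * n))"
    using Suc by (simp add: ppow_def)
  also have "\<dots> = pth i (Suc k * n)" by (simp add: pcomp_def cycle_path_def pth_append)
  finally show ?case .
qed (simp add: ppow_def stat_path_def cycle_path_def)

end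

lemma ppow_eq: "ppow c k = (fst c, concat (replicate k (snd c)))"
proof -
  have "(pcomp c ^^ k) (stat_path (fst c)) = (fst c, concat (replicate k (snd c)))"
    by (induction k) (simp_all add: stat_path_def pcomp_def)
  then show ?thesis by (simp add: ppow_def)
qed

context wf_digraph
begin

lemma subpath_arrow:
  assumes "p \<in> paths G" "\<alpha> \<in> arcs G"
  shows "subpath G (arrow_path G \<alpha>) p \<longleftrightarrow> \<alpha> \<in> set (snd p)"
proof
  assume "\<alpha> \<in> set (snd p)"
  then obtain xs ys where s: "snd p = xs @ \<alpha> # ys" by (meson split_list)
  obtain u where p: "p = (u, xs @ \<alpha> # ys)" using s by (metis prod.collapse)
  have "arrow_path G \<alpha> \<in> paths G" using assms(2) by (simp add: arrow_path_def)
  moreover have "(u, xs) \<in> paths G" "(head G \<alpha>, ys) \<in> paths G" using assms(1) p by (auto simp: mem_paths_Cons)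
  moreover have "composable G (u, xs) (arrow_path G \<alpha>)" "composable G (arrow_path G \<alpha>) (head G \<alpha>, ys)"
    using assms(1) p by (auto simp: mem_paths_Cons composable_def arrow_path_def)
  moreover have "p = pcomp (u, xs) (pcomp (arrow_path G \<alpha>) (head G \<alpha>, ys))"
    by (simp add: p pcomp_def arrow_path_def)
  ultimately show "subpath G (arrow_path G \<alpha>) p" unfolding subpath_def by blast
qed (auto simp: subpath_def pcomp_def arrow_path_def)

end

context gentle_cycle
begin

lemma subpath_max_gam: "\<alpha> \<in> arcs Q \<Longrightarrow> subpath_max Q (arrow_path Q \<alpha>) gam \<longleftrightarrow> \<alpha> \<in> range a"
proof
  assume \<alpha>: "\<alpha> \<in> arcs Q" and "subpath_max Q (arrow_path Q \<alpha>) gam"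
  then obtain i k where "subpath Q (arrow_path Q \<alpha>) (pth i (k * n))"
    by (auto simp: cycle_max_path_def ppow_pth)
  then show "\<alpha> \<in> range a" using \<alpha> by (subst (asm) subpath_arrow) (auto, auto simp: cycle_path_def)
next
  assume \<alpha>: "\<alpha> \<in> arcs Q" "\<alpha> \<in> range a"
  then obtain i where i: "\<alpha> = a i" by auto
  have "subpath Q (arrow_path Q \<alpha>) (ppow (pth i n) 1)"
    unfolding ppow_pth using \<alpha> n_pos by (subst subpath_arrow) (simp, simp, simp add: cycle_path_def i)
  then show "subpath_max Q (arrow_path Q \<alpha>) gam"
    unfolding cycle_max_path_def subpath_max.simps using zero_less_one by blast
qed

lemma passes_through_gam: "passes_through Q gam v \<longleftrightarrow> (\<exists>i. v = tail Q (a i))"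
proof -
  have "path_verts Q (pth i n) = {tail Q (a i)} \<union> tail Q ` set (map a [i..<i + n]) \<union> head Q ` set (map a [i..<i + n])" for i
  proof -
    have "awalk (tail Q (a i)) (map a [i..<i + n]) (tgt Q (tail Q (a i)) (map a [i..<i + n]))"
      using pth_paths[of i n] unfolding cycle_path_def mem_paths_awalk .
    then show ?thesis unfolding path_verts_def cycle_path_def by (simp add: set_awalk_verts image_image)
  qed
  then have "v \<in> path_verts Q (pth i n) \<longleftrightarrow> v = tail Q (a i) \<or> (\<exists>j\<in>{i..<i + n}. v = tail Q (a j) \<or> v = head Q (a j))" for i
    by auto
  moreover have "passes_through Q gam v \<longleftrightarrow> (\<exists>i. v \<in> path_verts Q (pth i n))"
    unfolding cycle_max_path_def passes_through.simps by blast
  ultimately show ?thesis unfolding head_a by blast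
qed

text \<open>Cutting the turn that starts at index 0 after \<open>t\<close> arrows and swapping the
  pieces gives the turn that starts at \<open>t\<close>; by periodicity \<open>map a [0..<t]\<close>
  equals \<open>map a [n..<n + t]\<close>.\<close>

lemma rotations_pth: "rotations Q (pth 0 n) = {pth i n | i. True}"
proof (intro Set.set_eqI iffI)
  fix q assume "q \<in> rotations Q (pth 0 n)"
  then obtain x y where xy: "q = pcomp y x" "composable Q x y" "pcomp x y = pth 0 n" by (auto simp: rotations_def)
  define t where "t = length (snd x)"
  have e: "fst x = tail Q (a 0)" "snd x @ snd y = map a [0..<n]" using xy by (auto simp: pcomp_def cycle_path_def)
  have t: "t \<le> n" unfolding t_def by (metis e(2) diff_zero le_add1 length_append length_map length_upt)
  have x: "snd x = map a [0..<t]"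
    using t by (metis e(2) t_def append_eq_conv_conj take_map take_upt add_0)
  have y: "snd y = map a [t..<n]"
    by (metis e(2) t_def append_eq_conv_conj drop_map drop_upt add_0)
  have "fst y = tgt Q (fst x) (snd x)" using xy by (cases x) (simp add: composable_def)
  then have "fst y = tail Q (a t)" using tgt_pth[of 0 t] e x by simp
  moreover have "map a [0..<t] = map a [n..<n + t]"
    by (rule nth_equalityI) (auto simp: a_eq_iff)
  then have "map a [t..<n] @ map a [0..<t] = map a [t..<t + n]"
    using t pth_append[of t "n - t" t] by (simp add: add.commute)
  ultimately have "q = pth t n" using xy x y by (simp add: pcomp_def cycle_path_def)
  then show "q \<in> {pth i n |i. True}" by auto
next
  fix q assume "q \<in> {pth i n | i. True}"
  then obtain i where "q = pth i n" by auto
  then have q: "q = pth (i mod n) n" by (simp add: pth_mod)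
  define t where "t = i mod n"
  have t: "t \<le> n" using n_pos by (simp add: t_def less_imp_le)
  have "pcomp (pth t (n - t)) (pth 0 t) = pth t n"
  proof -
    have "map a [0..<t] = map a [n..<n + t]"
      by (rule nth_equalityI) (auto simp: a_eq_iff)
    then have "map a [t..<n] @ map a [0..<t] = map a [t..<t + n]"
      using t pth_append[of t "n - t" t] by (simp add: add.commute)
    then show ?thesis using t by (simp add: pcomp_def cycle_path_def)
  qed
  moreover have "composable Q (pth 0 t) (pth t (n - t))"
    using tgt_pth[of 0 t] by (simp add: composable_def cycle_path_def)
  moreover have "pcomp (pth 0 t) (pth t (n - t)) = pth 0 n"
    using t pth_append[of 0 t "n - t"] by (simp add: pcomp_def cycle_path_def)
  ultimately show "q \<in> rotations Q (pth 0 n)" unfolding rotations_def q t_def[symmetric]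
    by (metis (mono_tags, lifting) mem_Collect_eq pth_paths)
qed

text \<open>Primitivity comes from the distinctness of the arrows of one turn: a proper power would
  show its first arrow again at position \<open>length bs\<close>, which is less than
  \<open>n\<close>. Two turns form the basis path \<open>pth 0 (n + n)\<close>, so the square of the
  cycle is not in \<open>I\<close>.\<close>

lemma gam_infinite: "gam \<in> infinite_max_paths Q I"
proof -
  let ?c = "pth 0 n"
  have "is_cycle Q ?c"
    using n_pos tgt_pth[of 0 n] a_eq_iff[of n 0] pth_paths[of 0 n] by (simp add: is_cycle_def plen_def cycle_path_def)
  moreover have "?c \<noteq> ppow c' k" if "is_cycle Q c'" "k > 1" for c' k
  proof
    assume c: "?c = ppow c' k"
    define k' where "k' = k - 2"
    have k: "k = Suc (Suc k')" using \<open>k > 1\<close> by (simp add: k'_def)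
    define bs where "bs = snd c'"
    define cs where "cs = concat (replicate k' bs)"
    have bs: "bs \<noteq> []" using that by (auto simp: bs_def is_cycle_def plen_def)
    have e: "map a [0..<n] = bs @ bs @ cs"
      using c by (simp add: cycle_path_def ppow_eq k bs_def cs_def)
    have len: "length bs < n" using arg_cong[OF e, of length] bs by (cases bs) auto
    have "a (length bs) = (bs @ bs @ cs) ! length bs" using e len by (metis add_0 diff_zero length_upt nth_map nth_upt)
    also have "\<dots> = (bs @ bs @ cs) ! 0" using bs by (simp add: nth_append)
    also have "\<dots> = a 0" using e n_pos by (metis add_0 diff_zero length_upt nth_map nth_upt)
    finally show False using len bs by (simp add: a_eq_iff)
  qed
  moreover have "\<not> prod_in Q I ?c ?c"
    using prod_in_paths[of "tail Q (a 0)" "map a [0..<n]" "tail Q (a 0)" "map a [0..<n]"]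
      tgt_pth[of 0 n] a_eq_iff[of n 0] pth_paths[of 0 n] pth_B[of 0 "n + n"] pth_append[of 0 n n] pth_add_n[of 0 n]
    by (simp add: cycle_path_def)
  moreover have "rotations Q ?c = {pth i n | i. True}" by (rule rotations_pth)
  ultimately show ?thesis
    unfolding infinite_max_paths_def primitive_cycle_def cycle_inf_def cycle_max_path_def
    by (intro CollectI exI[of _ ?c]) simp
qed

lemma gam_max: "gam \<in> max_paths Q I" using gam_infinite by (simp add: max_paths_def)

end

section \<open>Periodic arrow sequences, finite maximal paths, and existence of a maximal path
  through an arrow\<close>

context gentle_quiver
begin

text \<open>The period is the time of first return to \<alpha>: \<open>w\<close> is cut before its
  first \<alpha>, or used entirely if \<alpha> does not occur in it.\<close>

lemma cycle_through:
  assumes w: "successively good (\<alpha> # w @ [\<alpha>])"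
  shows "\<exists>a n. gentle_cycle Q I a n \<and> a 0 = \<alpha>"
proof -
  define as where "as = \<alpha> # takeWhile (\<lambda>x. x \<noteq> \<alpha>) w"
  define n where "n = length as"
  define a where "a i = as ! (i mod n)" for i
  have n: "n > 0" by (simp add: n_def as_def)
  have "\<exists>zs. \<alpha> # w @ [\<alpha>] = (as @ [\<alpha>]) @ zs"
  proof (cases "dropWhile (\<lambda>x. x \<noteq> \<alpha>) w")
    case Nil
    then have "takeWhile (\<lambda>x. x \<noteq> \<alpha>) w = w" by (metis append_Nil2 takeWhile_dropWhile_id)
    then have "\<alpha> # w @ [\<alpha>] = (as @ [\<alpha>]) @ []" unfolding as_def by (simp del: takeWhile_eq_all_conv)
    then show ?thesis by blast
  next
    case (Cons b zs)
    then have "b = \<alpha>" by (simp add: dropWhile_eq_Cons_conv)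
    then have "w = takeWhile (\<lambda>x. x \<noteq> \<alpha>) w @ \<alpha> # zs"
      using Cons takeWhile_dropWhile_id[of "\<lambda>x. x \<noteq> \<alpha>" w] by simp
    then have "w @ [\<alpha>] = (takeWhile (\<lambda>x. x \<noteq> \<alpha>) w @ \<alpha> # zs) @ [\<alpha>]" by (rule arg_cong)
    then have "\<alpha> # w @ [\<alpha>] = (as @ [\<alpha>]) @ (zs @ [\<alpha>])" unfolding as_def by simp
    then show ?thesis by blast
  qed
  then have chain: "successively good (as @ [\<alpha>])" using w by (auto simp del: append_assoc simp: successively_append_iff)
  have g: "good (a i) (a (Suc i))" for i
  proof -
    let ?r = "i mod n"
    have r: "?r < n" using n by simp
    then have "good ((as @ [\<alpha>]) ! ?r) ((as @ [\<alpha>]) ! Suc ?r)"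
      using chain by (simp add: successively_conv_nth n_def)
    moreover have "(as @ [\<alpha>]) ! Suc ?r = a (Suc i)"
    proof (cases "Suc ?r = n")
      case True
      then have "Suc i mod n = 0" by (simp add: mod_Suc)
      then show ?thesis using True by (simp add: a_def n_def nth_append as_def)
    next
      case False
      then have "Suc i mod n = Suc ?r" by (simp add: mod_Suc)
      then show ?thesis using False r by (simp add: a_def n_def nth_append)
    qed
    ultimately show ?thesis using r by (simp add: a_def n_def nth_append)
  qed
  \<comment> \<open>Since \<open>good\<close> determines predecessors, a repetition at
    \<open>i < j\<close> moves back one step at a time to position 0; but \<alpha> does not occur
    again in \<open>as\<close>.\<close>
  have d: "i < j \<Longrightarrow> j < n \<Longrightarrow> as ! i \<noteq> as ! j" for i j
  proof (induction i arbitrary: j)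
    case 0
    then have "as ! j \<in> set (takeWhile (\<lambda>x. x \<noteq> \<alpha>) w)" by (cases j) (auto simp: as_def n_def)
    then show ?case by (auto dest: set_takeWhileD simp: as_def)
  next
    case (Suc i)
    then obtain j' where j: "j = Suc j'" by (cases j) auto
    have "good (as ! i) (as ! Suc i)" "good (as ! j') (as ! j)"
      using g[of i] g[of j'] Suc.prems j by (auto simp: a_def)
    then show ?case using Suc j good_left_unique[of "as ! i" "as ! j" "as ! j'"] by auto
  qed
  have "a i = a j \<longleftrightarrow> i mod n = j mod n" for i j
    using d[of "i mod n" "j mod n"] d[of "j mod n" "i mod n"] n unfolding a_def
    by (metis linorder_neqE_nat mod_less_divisor)
  then have "gentle_cycle Q I a n"
    using n g by unfold_locales auto
  moreover have "a 0 = \<alpha>" by (simp add: a_def as_def)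
  ultimately show ?thesis by blast
qed

text \<open>The doubled cycle is a basis path in which its first arrow recurs, so it runs along a
  periodic sequence. The cycle itself is then some number \<open>k\<close> of full turns, and
  primitivity forces \<open>k = 1\<close>.\<close>

lemma infinite_max_paths_iff:
  "\<gamma> \<in> infinite_max_paths Q I \<longleftrightarrow> (\<exists>a n. gentle_cycle Q I a n \<and> \<gamma> = cycle_max_path Q a n)"
proof
  assume "\<gamma> \<in> infinite_max_paths Q I"
  then obtain c where c: "\<gamma> = cycle_inf Q c" "primitive_cycle Q c" "\<not> prod_in Q I c c"
    by (auto simp: infinite_max_paths_def)
  obtain u as where ua: "c = (u, as)" by (cases c)
  define L where "L = length as"
  have p: "(u, as) \<in> paths Q" and ne: "as \<noteq> []" using c by (auto simp: ua primitive_cycle_def is_cycle_def plen_def)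
  have B: "(u, as @ as) \<in> B" using c(3) prod_in_paths[OF p p] by (simp add: ua)
  obtain \<alpha> w where as: "as = \<alpha> # w" using ne by (cases as) auto
  have "as @ as = (\<alpha> # w @ [\<alpha>]) @ w" by (simp add: as)
  then have "successively good ((\<alpha> # w @ [\<alpha>]) @ w)" using B B_iff by metis
  then have "successively good (\<alpha> # w @ [\<alpha>])" unfolding successively_append_iff by blast
  then obtain a n where cyc: "gentle_cycle Q I a n" and a0: "a 0 = \<alpha>" using cycle_through by blast
  interpret gentle_cycle Q I a n by (rule cyc)
  have "(u, as @ as) = pth 0 (length (as @ as))"
    by (rule basis_path_from_cycle[OF B]) (auto simp: as a0)
  then have u: "u = tail Q (a 0)" and asas: "as @ as = map a [0..<L + L]" by (auto simp: cycle_path_def L_def)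
  have L: "L > 0" using ne by (simp add: L_def)
  \<comment> \<open>Position \<open>L\<close> is where the second copy starts, so the arrow there is
    \<open>a 0\<close> again and \<open>L\<close> is a multiple of the period.\<close>
  have "a L = (as @ as) ! L" using asas L by (simp add: nth_append)
  also have "\<dots> = a 0" by (simp add: nth_append L_def as a0)
  finally have "n dvd L" by (simp add: a_eq_iff mod_0_imp_dvd)
  then obtain k where k: "L = k * n" by (metis dvdE mult.commute)
  have "as = take L (as @ as)" by (simp add: L_def)
  also have "\<dots> = map a [0..<0 + L]" unfolding asas by (simp add: take_map)
  finally have cp: "c = pth 0 L" using u by (simp add: ua cycle_path_def)
  then have "c = ppow (pth 0 n) k" by (simp add: ppow_pth k)
  moreover have "is_cycle Q (pth 0 n)"
    using n_pos tgt_pth[of 0 n] pth_paths[of 0 n] a_eq_iff[of n 0] by (simp add: is_cycle_def plen_def cycle_path_def)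
  ultimately have "\<not> k > 1" using c(2) unfolding primitive_cycle_def by blast
  then have "k = 1" using L k by (cases k) auto
  then have "c = pth 0 n" using cp k by simp
  then have "\<gamma> = gam" using c(1) rotations_pth by (simp add: cycle_inf_def cycle_max_path_def)
  then show "\<exists>a n. gentle_cycle Q I a n \<and> \<gamma> = cycle_max_path Q a n" using cyc by blast
qed (auto intro: gentle_cycle.gam_infinite)

text \<open>Connectedness of the quiver enters here: without an arrow at \<open>u\<close>, no walk
  in the symmetrised quiver leads from \<open>u\<close> to an existing arrow. Consequently no
  stationary path is maximal.\<close>

lemma vertex_has_arrow:
  assumes "u \<in> verts Q"
  shows "\<exists>\<beta>\<in>arcs Q. u = tail Q \<beta> \<or> u = head Q \<beta>"
proof (rule ccontr)
  assume none: "\<not> ?thesis"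
  obtain \<alpha> where \<alpha>: "\<alpha> \<in> arcs Q" using quiver by (auto simp: quiver_def)
  have "Digraph_Component.connected Q" using quiver by (simp add: quiver_def)
  then have "u \<rightarrow>\<^sup>*\<^bsub>mk_symmetric Q\<^esub> tail Q \<alpha>"
    using assms \<alpha> unfolding connected_def strongly_connected_def by auto
  then show False
    by (rule pre_digraph.converse_reachable_cases) (use none \<alpha> in \<open>auto simp: parcs_mk_symmetric\<close>)
qed

text \<open>For a stationary path both sides are false: the left one by an arrow at its vertex, the
  right one because \<open>(tail Q \<beta>, [\<beta>])\<close> is a basis path for every arrow. For
  longer paths, \<open>prod_in\<close> of a non-composable pair matches the failure of the prolonged
  list to be a path.\<close>

lemma finite_maximal_iff:
  "finite_maximal Q I (u, as) \<longleftrightarrow> (u, as) \<in> B \<and>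
    (\<forall>\<beta>\<in>arcs Q. (u, as @ [\<beta>]) \<notin> B) \<and> (\<forall>\<beta>\<in>arcs Q. (tail Q \<beta>, \<beta> # as) \<notin> B)"
proof (cases "(u, as) \<in> B \<and> as \<noteq> []")
  case True
  then have p: "(u, as) \<in> paths Q" using B_paths by blast
  have "prod_in Q I (u, as) (arrow_path Q \<beta>) \<longleftrightarrow> (u, as @ [\<beta>]) \<notin> B" if "\<beta> \<in> arcs Q" for \<beta>
    using prod_in_paths[OF p, of "tail Q \<beta>" "[\<beta>]"] that by (auto simp: arrow_path_def B_append)
  moreover have "prod_in Q I (arrow_path Q \<beta>) (u, as) \<longleftrightarrow> (tail Q \<beta>, \<beta> # as) \<notin> B" if "\<beta> \<in> arcs Q" for \<beta>
    using prod_in_paths[of "tail Q \<beta>" "[\<beta>]" u as] p that B_append[of "tail Q \<beta>" "[\<beta>]" as]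
    by (cases as) (use True in \<open>auto simp: arrow_path_def B_iff mem_paths_Cons\<close>)
  ultimately show ?thesis using True by (simp add: finite_maximal_def)
next
  case False
  show ?thesis
  proof (cases "(u, as) \<in> B")
    case True
    then have [simp]: "as = []" and u: "u \<in> verts Q" using False by auto
    obtain \<beta> where \<beta>: "\<beta> \<in> arcs Q" "u = tail Q \<beta> \<or> u = head Q \<beta>" using vertex_has_arrow[OF u] by blast
    have "\<not> prod_in Q I (u, []) (arrow_path Q \<beta>) \<or> \<not> prod_in Q I (arrow_path Q \<beta>) (u, [])"
      using prod_in_paths[of u "[]" "tail Q \<beta>" "[\<beta>]"] prod_in_paths[of "tail Q \<beta>" "[\<beta>]" u "[]"] u \<beta>
      by (auto simp: arrow_path_def)
    then show ?thesis using \<beta>(1) by (auto simp: finite_maximal_def)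
  qed (simp add: finite_maximal_def)
qed

text \<open>Kept abstract in \<open>r\<close> because it is applied twice: to \<open>good\<close>
  for the part of a maximal path after a given arrow, and to the converse relation for the reversed
  part before it.\<close>

lemma chain_end_unique:
  assumes "\<And>x y z. r x y \<Longrightarrow> r x z \<Longrightarrow> y = z"
    and "successively r (\<alpha> # ys)" "successively r (\<alpha> # zs)"
    and "\<And>\<beta>. \<not> r (last (\<alpha> # ys)) \<beta>" "\<And>\<beta>. \<not> r (last (\<alpha> # zs)) \<beta>"
  shows "ys = zs"
  using assms(2-)
proof (induction ys arbitrary: \<alpha> zs)
  case Nil
  then show ?case by (cases zs) auto
next
  case (Cons y ys)
  then obtain z zs' where zs: "zs = z # zs'" by (cases zs) auto
  then have "y = z" using Cons.prems(1,2) assms(1)[of \<alpha> y z] by simp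
  then show ?case using Cons zs by auto
qed

lemma finite_maximal_unique:
  assumes p: "finite_maximal Q I p" and q: "finite_maximal Q I q"
    and \<alpha>: "\<alpha> \<in> set (snd p)" "\<alpha> \<in> set (snd q)"
  shows "p = q"
proof -
  obtain u xs ys where p': "p = (u, xs @ \<alpha> # ys)" using \<alpha>(1) by (metis prod.collapse split_list)
  obtain w xs' ys' where q': "q = (w, xs' @ \<alpha> # ys')" using \<alpha>(2) by (metis prod.collapse split_list)
  have right: "\<not> good (last as) \<beta>" and left: "\<not> good \<beta> (hd as)"
    if fm: "finite_maximal Q I (u, as)" and ne: "as \<noteq> []" for u as \<beta>
  proof -
    have f: "(u, as) \<in> B" "\<forall>\<beta>\<in>arcs Q. (u, as @ [\<beta>]) \<notin> B" "\<forall>\<beta>\<in>arcs Q. (tail Q \<beta>, \<beta> # as) \<notin> B"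
      using fm by (auto simp: finite_maximal_iff)
    show "\<not> good (last as) \<beta>"
    proof
      assume g: "good (last as) \<beta>"
      then have "(u, as @ [\<beta>]) \<in> B" using f(1) ne by (auto simp: B_append good_def tgt_def)
      then show False using f(2) g by (auto simp: good_def)
    qed
    show "\<not> good \<beta> (hd as)"
    proof
      assume g: "good \<beta> (hd as)"
      obtain a bs where as: "as = a # bs" using ne by (cases as) auto
      have "u = tail Q a" using B_paths[OF f(1)] by (simp add: as mem_paths_Cons)
      then have "(tail Q \<beta>, [\<beta>] @ as) \<in> B"
        using f(1) g unfolding B_append by (auto simp: good_def as)
      then show False using f(3) g by (auto simp: good_def)
    qed
  qed
  have sp: "successively good (xs @ \<alpha> # ys)" "successively good (xs' @ \<alpha> # ys')"
    using p q by (auto simp: p' q' finite_maximal_iff B_iff)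
  have "ys = ys'"
  proof (rule chain_end_unique[where r = good and \<alpha> = \<alpha>])
    show "successively good (\<alpha> # ys)" "successively good (\<alpha> # ys')" using sp by (auto simp: successively_append_iff)
    show "\<not> good (last (\<alpha> # ys)) \<beta>" for \<beta> using right[of u "xs @ \<alpha> # ys" \<beta>] p by (simp add: p')
    show "\<not> good (last (\<alpha> # ys')) \<beta>" for \<beta> using right[of w "xs' @ \<alpha> # ys'" \<beta>] q by (simp add: q')
  qed (rule good_right_unique)
  moreover have "rev xs = rev xs'"
  proof (rule chain_end_unique[where r = "\<lambda>x y. good y x" and \<alpha> = \<alpha>])
    have "successively good (xs @ [\<alpha>])" "successively good (xs' @ [\<alpha>])"
      using sp by (auto simp: successively_append_iff)
    then show "successively (\<lambda>x y. good y x) (\<alpha> # rev xs)" "successively (\<lambda>x y. good y x) (\<alpha> # rev xs')"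
      using successively_rev[of good "\<alpha> # rev xs"] successively_rev[of good "\<alpha> # rev xs'"] by simp_all
    show "\<not> good \<beta> (last (\<alpha> # rev xs))" for \<beta>
      using left[of u "xs @ \<alpha> # ys" \<beta>] p by (cases xs) (auto simp: p')
    show "\<not> good \<beta> (last (\<alpha> # rev xs'))" for \<beta>
      using left[of w "xs' @ \<alpha> # ys'" \<beta>] q by (cases xs') (auto simp: q')
  qed (rule good_left_unique)
  ultimately have lists: "snd p = snd q" by (simp add: p' q')
  have "fst p = tail Q (hd (snd p))" "fst q = tail Q (hd (snd q))"
    using B_paths[of p] B_paths[of q] p q \<alpha>
    by (cases p; cases q; cases "snd p"; cases "snd q"; auto simp: finite_maximal_iff mem_paths_Cons)+
  then show ?thesis using lists by (simp add: prod_eq_iff)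
qed

lemma subpath_max_finite:
  "\<lbrakk>finite_maximal Q I p; \<alpha> \<in> arcs Q\<rbrakk> \<Longrightarrow> subpath_max Q (arrow_path Q \<alpha>) (Fin_Path p) \<longleftrightarrow> \<alpha> \<in> set (snd p)"
  using subpath_arrow[of p \<alpha>] B_paths[of p] by (auto simp: finite_maximal_def)

text \<open>A repeated arrow closes up to a cycle, and a basis path that meets a cycle runs along
  it, so all of its arrows lie there.\<close>

lemma cycle_contains_path:
  assumes "(u, bs) \<in> B" "\<not> distinct bs" "\<alpha> \<in> set bs"
  shows "\<exists>a n. gentle_cycle Q I a n \<and> \<alpha> \<in> range a"
proof -
  obtain xs ys zs \<beta> where bs: "bs = xs @ [\<beta>] @ ys @ [\<beta>] @ zs" using not_distinct_decomp[OF assms(2)] by blast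
  have "successively good bs" using assms by (simp add: B_iff)
  moreover have "bs = xs @ (\<beta> # ys @ [\<beta>]) @ zs" by (simp add: bs)
  ultimately have "successively good (\<beta> # ys @ [\<beta>])" by (metis successively_append_iff)
  then obtain a n where c: "gentle_cycle Q I a n" "a 0 = \<beta>" using cycle_through by blast
  interpret gentle_cycle Q I a n by (rule c(1))
  obtain i where "(u, bs) = pth i (length bs)" using basis_path_in_cycle[OF assms(1), of 0] bs c(2) by auto
  then have "bs = map a [i..<i + length bs]" by (simp add: cycle_path_def)
  then have "set bs = set (map a [i..<i + length bs])" by (rule arg_cong)
  then have "\<alpha> \<in> range a" using assms(3) unfolding set_map by blast
  then show ?thesis using c(1) by blast
qed

text \<open>If \<alpha> lies on no cycle, basis paths through \<alpha> repeat no arrow, which bounds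
  their length by the number of arrows; a longest one cannot be prolonged at either end.\<close>

lemma max_path_exists:
  assumes \<alpha>: "\<alpha> \<in> arcs Q"
  shows "\<exists>\<gamma>\<in>max_paths Q I. subpath_max Q (arrow_path Q \<alpha>) \<gamma>"
proof (cases "\<exists>a n. gentle_cycle Q I a n \<and> \<alpha> \<in> range a")
  case True
  then obtain a n where c: "gentle_cycle Q I a n" "\<alpha> \<in> range a" by blast
  then show ?thesis using gentle_cycle.subpath_max_gam[OF c(1) \<alpha>] gentle_cycle.gam_max[OF c(1)] by auto
next
  case False
  define T where "T p \<longleftrightarrow> p \<in> B \<and> \<alpha> \<in> set (snd p)" for p
  have bound: "length (snd p) < Suc (card (arcs Q))" if "T p" for p
  proof -
    have "distinct (snd p)" using False that cycle_contains_path[of "fst p" "snd p" \<alpha>] unfolding T_def by (metis prod.collapse)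
    then have "length (snd p) = card (set (snd p))" by (simp add: distinct_card)
    also have "\<dots> \<le> card (arcs Q)"
      using that paths_arcs[of "fst p" "snd p"] B_paths[of p] by (intro card_mono) (auto simp: T_def)
    finally show ?thesis by simp
  qed
  have "T (tail Q \<alpha>, [\<alpha>])" using \<alpha> by (simp add: T_def)
  then obtain p where p: "T p" and max: "\<And>q. T q \<Longrightarrow> length (snd q) \<le> length (snd p)"
    using ex_has_greatest_nat[of T _ "\<lambda>p. length (snd p)" "Suc (card (arcs Q))"] bound by (metis order.strict_implies_order)
  obtain u as where ua: "p = (u, as)" by (cases p)
  have "(u, as @ [\<beta>]) \<notin> B" for \<beta> using max[of "(u, as @ [\<beta>])"] p by (auto simp: T_def ua)
  moreover have "(tail Q \<beta>, \<beta> # as) \<notin> B" for \<beta> using max[of "(tail Q \<beta>, \<beta> # as)"] p by (auto simp: T_def ua)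
  ultimately have "finite_maximal Q I p" using p by (simp add: ua finite_maximal_iff T_def)
  moreover from this have "subpath_max Q (arrow_path Q \<alpha>) (Fin_Path p)"
    using subpath_max_finite \<alpha> p by (simp add: T_def)
  ultimately show ?thesis unfolding max_paths_def by blast
qed

end

section \<open>Uniqueness of the maximal path through an arrow\<close>

context gentle_cycle
begin

text \<open>A finite maximal path through \<open>a i\<close> would run along the cycle and could be
  prolonged by the next arrow. Another cycle through \<open>a i\<close> follows the same arrows from
  there on, and this fixes its period as well.\<close>

lemma max_path_through_unique:
  assumes \<gamma>: "\<gamma> \<in> max_paths Q I" "subpath_max Q (arrow_path Q (a i)) \<gamma>"
  shows "\<gamma> = gam"
  using \<gamma>(1) unfolding max_paths_def
proof
  assume "\<gamma> \<in> {Fin_Path p |p. finite_maximal Q I p}"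
  then obtain u bs where p: "\<gamma> = Fin_Path (u, bs)" "finite_maximal Q I (u, bs)" by auto
  then have "a i \<in> set bs" using subpath_max_finite[of "(u, bs)" "a i"] \<gamma>(2) by simp
  then obtain j where j: "(u, bs) = pth j (length bs)" using basis_path_in_cycle p finite_maximal_iff by blast
  then have "u = tail Q (a j)" "bs = map a [j..<j + length bs]" by (auto simp: cycle_path_def)
  then have "(u, bs @ [a (j + length bs)]) = pth j (Suc (length bs))"
    by (simp add: cycle_path_def)
  then have "(u, bs @ [a (j + length bs)]) \<in> B" using pth_B by metis
  then show ?thesis using p(2) by (simp add: finite_maximal_iff)
next
  assume "\<gamma> \<in> infinite_max_paths Q I"
  then obtain a' n' where c: "gentle_cycle Q I a' n'" "\<gamma> = cycle_max_path Q a' n'"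
    unfolding infinite_max_paths_iff by blast
  interpret c: gentle_cycle Q I a' n' by (rule c(1))
  obtain j where j: "a i = a' j" using c.subpath_max_gam[of "a i"] \<gamma>(2) c(2) by auto
  have eq: "a (i + t) = a' (j + t)" for t
  proof (induction t)
    case (Suc t)
    then show ?case using good_right_unique good_a[of "i + t"] c.good_a[of "j + t"] by simp
  qed (simp add: j)
  \<comment> \<open>Both periods are read off the same pattern of repetitions, so they have the same
    multiples.\<close>
  have "(i + t) mod n = (i + 0) mod n \<longleftrightarrow> (j + t) mod n' = (j + 0) mod n'" for t
    unfolding a_eq_iff[symmetric] c.a_eq_iff[symmetric] eq ..
  then have "n dvd t \<longleftrightarrow> n' dvd t" for t
    using mod_eq_dvd_iff_nat[of i "i + t" n] mod_eq_dvd_iff_nat[of j "j + t" n'] by simp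
  then have n: "n = n'" by (meson dvd_antisym dvd_refl)
  have "map a [i + t..<i + t + l] = map a' [j + t..<j + t + l]" for t l
    using eq[of "t + _"] by (auto simp: list_eq_iff_nth_eq add.assoc)
  then have path: "pth (i + t) l = c.pth (j + t) l" for t l
    using eq[of t] by (simp add: cycle_path_def)
  have "{pth k n' | k. True} = {pth (i + t) n' | t. True}"
    unfolding n[symmetric]
  proof (intro Set.set_eqI iffI)
    fix q assume "q \<in> {pth k n | k. True}"
    then obtain k where "q = pth k n" by auto
    \<comment> \<open>Every index is congruent to one of the form \<open>i + t\<close>; adding
      \<open>(n - 1) * i\<close> replaces the subtraction of \<open>i\<close>.\<close>
    also have "\<dots> = pth (i + (k + (n - 1) * i)) n"
    proof (rule pth_cong)
      have "i + (k + (n - 1) * i) = k + n * i" using n_pos by (cases n) auto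
      then show "k mod n = (i + (k + (n - 1) * i)) mod n" by (simp only: mod_mult_self2)
    qed
    finally show "q \<in> {pth (i + t) n | t. True}" by blast
  qed auto
  moreover have "{c.pth k n' | k. True} = {c.pth (j + t) n' | t. True}"
  proof (intro Set.set_eqI iffI)
    fix q assume "q \<in> {c.pth k n' | k. True}"
    then obtain k where "q = c.pth k n'" by auto
    also have "\<dots> = c.pth (j + (k + (n' - 1) * j)) n'"
    proof (rule c.pth_cong)
      have "j + (k + (n' - 1) * j) = k + n' * j" using c.n_pos by (cases n') auto
      then show "k mod n' = (j + (k + (n' - 1) * j)) mod n'" by (simp only: mod_mult_self2)
    qed
    finally show "q \<in> {c.pth (j + t) n' | t. True}" by blast
  qed auto
  ultimately show ?thesis
    unfolding c(2) cycle_max_path_def max_path.inject n by (simp only: path)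
qed

end

context gentle_quiver
begin

lemma max_path_unique:
  assumes \<alpha>: "\<alpha> \<in> arcs Q" and \<gamma>: "\<gamma> \<in> max_paths Q I" "subpath_max Q (arrow_path Q \<alpha>) \<gamma>"
    and \<delta>: "\<delta> \<in> max_paths Q I" "subpath_max Q (arrow_path Q \<alpha>) \<delta>"
  shows "\<gamma> = \<delta>"
proof -
  have inf: "\<gamma> = \<delta>" if \<gamma>: "\<gamma> \<in> infinite_max_paths Q I" "subpath_max Q (arrow_path Q \<alpha>) \<gamma>"
    "\<delta> \<in> max_paths Q I" "subpath_max Q (arrow_path Q \<alpha>) \<delta>" for \<gamma> \<delta>
  proof -
    obtain a n where c: "gentle_cycle Q I a n" "\<gamma> = cycle_max_path Q a n"
      using \<gamma>(1) unfolding infinite_max_paths_iff by blast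
    interpret gentle_cycle Q I a n by (rule c(1))
    obtain i where "\<alpha> = a i" using subpath_max_gam[OF \<alpha>] \<gamma>(2) c(2) by auto
    then show ?thesis using max_path_through_unique[of \<delta> i] \<gamma> c(2) by simp
  qed
  show ?thesis
  proof (cases "\<gamma> \<in> infinite_max_paths Q I \<or> \<delta> \<in> infinite_max_paths Q I")
    case True
    then show ?thesis using inf \<gamma> \<delta> by metis
  next
    case False
    then obtain p q where "\<gamma> = Fin_Path p" "\<delta> = Fin_Path q" "finite_maximal Q I p" "finite_maximal Q I q"
      using \<gamma> \<delta> by (auto simp: max_paths_def)
    then show ?thesis using finite_maximal_unique[of p q \<alpha>] subpath_max_finite \<alpha> \<gamma> \<delta> by metis
  qed
qed

lemma max_path_of_eq_iff:
  assumes "\<alpha> \<in> arcs Q"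
  shows "max_path_of Q I \<alpha> = \<gamma> \<longleftrightarrow> \<gamma> \<in> max_paths Q I \<and> subpath_max Q (arrow_path Q \<alpha>) \<gamma>"
proof -
  have "\<exists>!\<gamma>. \<gamma> \<in> max_paths Q I \<and> subpath_max Q (arrow_path Q \<alpha>) \<gamma>"
    using max_path_exists max_path_unique assms by metis
  from theI'[OF this] the1_equality[OF this] show ?thesis
    unfolding max_path_of_def by blast
qed

text \<open>Allows statements about all maximal paths to be checked on arrows, as in the criterion
  for \<open>A\<close> to be prime.\<close>

lemma max_path_has_arrow:
  assumes "\<gamma> \<in> max_paths Q I"
  shows "\<exists>\<alpha>\<in>arcs Q. max_path_of Q I \<alpha> = \<gamma>"
  using assms unfolding max_paths_def
proof
  assume "\<gamma> \<in> infinite_max_paths Q I"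
  then obtain a n where c: "gentle_cycle Q I a n" "\<gamma> = cycle_max_path Q a n"
    unfolding infinite_max_paths_iff by blast
  interpret gentle_cycle Q I a n by (rule c(1))
  have "max_path_of Q I (a 0) = \<gamma>" using max_path_of_eq_iff subpath_max_gam gam_max c(2) by simp
  then show ?thesis using a_arcs by blast
next
  assume "\<gamma> \<in> {Fin_Path p |p. finite_maximal Q I p}"
  then obtain u as where p: "\<gamma> = Fin_Path (u, as)" "finite_maximal Q I (u, as)" by auto
  have "as \<noteq> []"
  proof
    assume [simp]: "as = []"
    have u: "u \<in> verts Q" using p by (simp add: finite_maximal_iff)
    then obtain \<beta> where "\<beta> \<in> arcs Q" "u = tail Q \<beta> \<or> u = head Q \<beta>" using vertex_has_arrow by blast
    then show False using p(2) by (auto simp: finite_maximal_iff)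
  qed
  then obtain \<alpha> where "\<alpha> \<in> set as" by (meson last_in_set)
  moreover from this have "\<alpha> \<in> arcs Q" using p paths_arcs B_paths by (auto simp: finite_maximal_iff)
  ultimately have "max_path_of Q I \<alpha> = \<gamma>"
    using p subpath_max_finite[of "(u, as)" \<alpha>] by (subst max_path_of_eq_iff) (auto simp: max_paths_def)
  then show ?thesis using \<open>\<alpha> \<in> arcs Q\<close> by blast
qed

end

context gentle_cycle
begin

lemma max_path_of_gam: "\<alpha> \<in> arcs Q \<Longrightarrow> max_path_of Q I \<alpha> = gam \<longleftrightarrow> \<alpha> \<in> range a"
  using max_path_of_eq_iff gam_max subpath_max_gam by simp

text \<open>Basis paths with first arrow \<open>a i\<close> are forced along the cycle, and one of
  length \<open>l\<close> has distinct arrows iff \<open>l \<le> n\<close>; the longest is a full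
  turn.\<close>

lemma gamma_r_a: "gamma_r Q I (a i) = pth i n"
proof -
  have dist: "distinct (map a [i..<i + l]) \<longleftrightarrow> l \<le> n" for l
  proof
    assume "distinct (map a [i..<i + l])"
    then have inj: "inj_on a {i..<i + l}" by (simp add: distinct_map)
    show "l \<le> n"
    proof (rule ccontr)
      assume "\<not> l \<le> n"
      then have "i \<in> {i..<i + l}" "i + n \<in> {i..<i + l}" by auto
      moreover have "a i = a (i + n)" by (simp add: a_eq_iff)
      ultimately have "i = i + n" using inj inj_onD by metis
      then show False using n_pos by simp
    qed
  next
    assume "l \<le> n"
    have less: "j = k" if "j mod n = k mod n" "i \<le> j" "j \<le> k" "k < i + l" for j k
    proof -
      have "n dvd k - j" using that mod_eq_dvd_iff_nat[of j k n] by metis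
      moreover have "k - j < n" using that \<open>l \<le> n\<close> by simp
      ultimately show ?thesis using that by (metis dvd_imp_le le_antisym not_less zero_less_diff linorder_le_less_linear)
    qed
    have "inj_on a {i..<i + l}"
    proof (rule linorder_inj_onI)
      fix x y assume "x < y" "x \<in> {i..<i + l}" "y \<in> {i..<i + l}"
      then show "a x \<noteq> a y" using less[of x y] by (auto simp: a_eq_iff)
    qed auto
    then show "distinct (map a [i..<i + l])" by (simp add: distinct_map)
  qed
  have simple: "simple_basis_path_from Q I (a i) p \<longleftrightarrow> (\<exists>l. 0 < l \<and> l \<le> n \<and> p = pth i l)" for p
  proof
    assume p: "simple_basis_path_from Q I (a i) p"
    obtain u bs where ub: "p = (u, bs)" by (cases p)
    have "(u, bs) = pth i (length bs)"
      using p by (intro basis_path_from_cycle) (auto simp: simple_basis_path_from_def ub)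
    moreover from this have "bs = map a [i..<i + length bs]" by (simp add: cycle_path_def)
    moreover have "distinct bs" "bs \<noteq> []" using p by (auto simp: simple_basis_path_from_def ub)
    ultimately show "\<exists>l. 0 < l \<and> l \<le> n \<and> p = pth i l"
      using dist[of "length bs"] unfolding ub by (metis length_greater_0_conv)
  next
    assume "\<exists>l. 0 < l \<and> l \<le> n \<and> p = pth i l"
    then obtain l where l: "0 < l" "l \<le> n" "p = pth i l" by auto
    then show "simple_basis_path_from Q I (a i) p"
      using dist[of l] pth_B[of i l] by (simp add: simple_basis_path_from_def cycle_path_def hd_map)
  qed
  show ?thesis
    unfolding gamma_r_def
  proof (rule the_equality)
    show "simple_basis_path_from Q I (a i) (pth i n) \<and>
        (\<forall>q. simple_basis_path_from Q I (a i) q \<longrightarrow> plen q \<le> plen (pth i n))"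
      using n_pos unfolding simple by (metis le_refl length_pth plen_def)
  next
    fix p assume p: "simple_basis_path_from Q I (a i) p \<and>
        (\<forall>q. simple_basis_path_from Q I (a i) q \<longrightarrow> plen q \<le> plen p)"
    then obtain l where l: "l \<le> n" "p = pth i l" by (auto simp: simple)
    have "simple_basis_path_from Q I (a i) (pth i n)" using n_pos by (auto simp: simple)
    then have "plen (pth i n) \<le> plen p" using p by blast
    then show "p = pth i n" using l by (simp add: plen_def)
  qed
qed

end

section \<open>The ideals attached to vertices and cycles\<close>

context gentle_quiver
begin

lemma cf_finsum:
  assumes "\<And>i. i \<in> T \<Longrightarrow> f i \<in> carrier A" "finite T" "q \<in> B"
  shows "cf (finsum A f T) q = (\<Sum>i\<in>T. cf (f i) q)"
  using assms(2,1)
proof (induction T)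
  case (insert i T)
  then have "finsum A f (insert i T) = f i \<oplus>\<^bsub>A\<^esub> finsum A f T" by (intro A.finsum_insert) auto
  then show ?case using insert assms(3) by (simp add: cf_add A.finsum_closed Pi_def)
qed (simp add: assms(3))

lemma cf_mult_nonzero:
  assumes "x \<in> carrier A" "y \<in> carrier A" "(u, as) \<in> B" "cf (x \<otimes>\<^bsub>A\<^esub> y) (u, as) \<noteq> 0"
  shows "\<exists>bs cs. as = bs @ cs \<and> (u, bs) \<in> B \<and> (tgt Q u bs, cs) \<in> B \<and>
    cf x (u, bs) \<noteq> 0 \<and> cf y (tgt Q u bs, cs) \<noteq> 0"
proof -
  obtain i where "cf x (u, take i as) * cf y (tgt Q u (take i as), drop i as) \<noteq> 0"
    using assms(4) unfolding cf_mult[OF assms(1-3)] by (meson sum.neutral)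
  then show ?thesis using B_split[OF assms(3), of i]
    by (intro exI[of _ "take i as"] exI[of _ "drop i as"]) auto
qed

text \<open>A term of a product at a path comes from a cut of that path, so a set of basis paths
  that absorbs prolongation spans an ideal. It is applied to all basis paths except one stationary
  path, and to the nonstationary paths of a cycle.\<close>

lemma support_ideal:
  assumes M: "\<And>u as. (u, as) \<in> B \<Longrightarrow> (\<exists>bs cs. as = bs @ cs \<and> ((u, bs) \<in> M \<or> (tgt Q u bs, cs) \<in> M)) \<Longrightarrow> (u, as) \<in> M"
  shows "ideal {x \<in> carrier A. \<forall>q\<in>B. cf x q \<noteq> 0 \<longrightarrow> q \<in> M} A" (is "ideal ?J A")
proof (rule idealI[OF A.ring_axioms])
  show "subgroup ?J (add_monoid A)"
  proof
    fix x assume "x \<in> ?J"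
    then have "\<ominus>\<^bsub>A\<^esub> x \<in> ?J" by (simp add: cf_neg)
    then show "inv\<^bsub>add_monoid A\<^esub> x \<in> ?J" unfolding a_inv_def .
  next
    fix x y assume "x \<in> ?J" "y \<in> ?J"
    then have "x \<oplus>\<^bsub>A\<^esub> y \<in> ?J" by (auto simp: cf_add)
    then show "x \<otimes>\<^bsub>add_monoid A\<^esub> y \<in> ?J" by simp
  qed auto
next
  fix x y assume x: "x \<in> ?J" and y: "y \<in> carrier A"
  have "q \<in> M" if "q \<in> B" "cf (x \<otimes>\<^bsub>A\<^esub> y) q \<noteq> 0 \<or> cf (y \<otimes>\<^bsub>A\<^esub> x) q \<noteq> 0" for q
  proof -
    obtain u as where q: "q = (u, as)" by (cases q)
    have "\<exists>bs cs. as = bs @ cs \<and> ((u, bs) \<in> M \<or> (tgt Q u bs, cs) \<in> M)"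
      using that(2)
    proof
      assume "cf (x \<otimes>\<^bsub>A\<^esub> y) q \<noteq> 0"
      then show ?thesis using cf_mult_nonzero[of x y u as] x y that(1) q by blast
    next
      assume "cf (y \<otimes>\<^bsub>A\<^esub> x) q \<noteq> 0"
      then show ?thesis using cf_mult_nonzero[of y x u as] x y that(1) q by blast
    qed
    then show ?thesis using M that(1) q by blast
  qed
  then show "y \<otimes>\<^bsub>A\<^esub> x \<in> ?J" "x \<otimes>\<^bsub>A\<^esub> y \<in> ?J" using x y by auto
qed

lemma vertex_ideal_gens: "{el (stat_path v') | v'. v' \<in> verts Q - {v}} \<union>
    {el (arrow_path Q \<alpha>) | \<alpha>. \<alpha> \<in> arcs Q \<and> tail Q \<alpha> = v \<and> head Q \<alpha> = v} \<subseteq> carrier A"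
  by (auto simp: stat_path_def arrow_path_def simp del: quot_closed intro!: el_closed)

lemma vertex_ideal_ideal: "ideal (vertex_ideal Q I v) A"
  unfolding vertex_ideal_def by (rule A.genideal_ideal[OF vertex_ideal_gens])

text \<open>A path other than the stationary path at \<open>v\<close> starts at another vertex, or
  its first arrow is a loop at \<open>v\<close> or ends at another vertex. In each case a generator
  divides it, so the ideal is the kernel of a single coefficient.\<close>

lemma vertex_ideal_eq:
  assumes v: "v \<in> verts Q"
  shows "vertex_ideal Q I v = {x \<in> carrier A. cf x (v, []) = 0}"
proof
  have id: "ideal {x \<in> carrier A. \<forall>q\<in>B. cf x q \<noteq> 0 \<longrightarrow> q \<in> - {(v, [])}} A"
    by (rule support_ideal) auto
  have eq: "{x \<in> carrier A. \<forall>q\<in>B. cf x q \<noteq> 0 \<longrightarrow> q \<in> - {(v, [])}} = {x \<in> carrier A. cf x (v, []) = 0}"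
    using v by auto
  show "vertex_ideal Q I v \<subseteq> {x \<in> carrier A. cf x (v, []) = 0}"
    unfolding vertex_ideal_def
  proof (rule A.genideal_minimal[OF id[unfolded eq]])
    show "{el (stat_path v') | v'. v' \<in> verts Q - {v}} \<union>
      {el (arrow_path Q \<alpha>) | \<alpha>. \<alpha> \<in> arcs Q \<and> tail Q \<alpha> = v \<and> head Q \<alpha> = v} \<subseteq> {x \<in> carrier A. cf x (v, []) = 0}"
      using vertex_ideal_gens[of v] v by (auto simp: stat_path_def arrow_path_def cf_el)
  qed
  interpret V: ideal "vertex_ideal Q I v" A by (rule vertex_ideal_ideal)
  have stat: "el (w, []) \<in> vertex_ideal Q I v" if "w \<in> verts Q" "w \<noteq> v" for w
    using that A.genideal_self[OF vertex_ideal_gens[of v]] unfolding vertex_ideal_def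
    by (auto simp: stat_path_def)
  have loop: "el (v, [\<alpha>]) \<in> vertex_ideal Q I v" if "\<alpha> \<in> arcs Q" "tail Q \<alpha> = v" "head Q \<alpha> = v" for \<alpha>
    using that A.genideal_self[OF vertex_ideal_gens[of v]] unfolding vertex_ideal_def
    by (auto simp: arrow_path_def)
  show "{x \<in> carrier A. cf x (v, []) = 0} \<subseteq> vertex_ideal Q I v"
  proof
    fix x assume x: "x \<in> {x \<in> carrier A. cf x (v, []) = 0}"
    show "x \<in> vertex_ideal Q I v"
    proof (rule mem_ideal_if_support[OF vertex_ideal_ideal])
      fix q assume q: "q \<in> B" "cf x q \<noteq> 0"
      obtain u as where ua: "q = (u, as)" by (cases q)
      have p: "(u, as) \<in> paths Q" using q B_paths ua by blast
      show "el q \<in> vertex_ideal Q I v"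
      proof (cases "u = v")
        case False
        then have "el (u, []) \<otimes>\<^bsub>A\<^esub> el (tgt Q u [], as) \<in> vertex_ideal Q I v"
          using p paths_fst[OF p] by (intro V.I_r_closed stat) auto
        then show ?thesis using p paths_fst[OF p] by (subst (asm) el_mult) (auto simp: ua)
      next
        case True
        then obtain \<alpha> bs where as: "as = \<alpha> # bs" using x q ua by (cases as) auto
        have \<alpha>: "\<alpha> \<in> arcs Q" "tail Q \<alpha> = v" and bs: "(head Q \<alpha>, bs) \<in> paths Q"
          using p True by (auto simp: as mem_paths_Cons)
        have "el (v, [\<alpha>]) \<in> vertex_ideal Q I v"
        proof (cases "head Q \<alpha> = v")
          case False
          have "el (v, [\<alpha>]) \<otimes>\<^bsub>A\<^esub> el (tgt Q v [\<alpha>], []) \<in> vertex_ideal Q I v"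
            using \<alpha> False stat[OF head_in_verts[OF \<alpha>(1)]] by (intro V.I_l_closed) auto
          then show ?thesis using \<alpha> by (subst (asm) el_mult) auto
        qed (use loop \<alpha> in auto)
        then have "el (v, [\<alpha>]) \<otimes>\<^bsub>A\<^esub> el (tgt Q v [\<alpha>], bs) \<in> vertex_ideal Q I v"
          using bs by (intro V.I_r_closed) (auto intro!: el_closed)
        then show ?thesis using \<alpha> bs True by (subst (asm) el_mult) (auto simp: ua as)
      qed
    qed (use x in auto)
  qed
qed

text \<open>A stationary path has only one cut, so its coefficient is multiplicative and 1 serves as
  the middle factor.\<close>

lemma vertex_ideal_prime:
  assumes v: "v \<in> verts Q"
  shows "nc_prime_ideal A (vertex_ideal Q I v)"
proof (rule A.nc_prime_idealI[OF vertex_ideal_ideal])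
  show "vertex_ideal Q I v \<noteq> carrier A"
  proof
    assume "vertex_ideal Q I v = carrier A"
    then have "\<one>\<^bsub>A\<^esub> \<in> vertex_ideal Q I v" by simp
    then show False using v by (simp add: vertex_ideal_eq cf_one)
  qed
  fix x y assume "x \<in> carrier A" "y \<in> carrier A" "x \<notin> vertex_ideal Q I v" "y \<notin> vertex_ideal Q I v"
  then show "\<exists>z\<in>carrier A. x \<otimes>\<^bsub>A\<^esub> z \<otimes>\<^bsub>A\<^esub> y \<notin> vertex_ideal Q I v"
    using v by (intro bexI[of _ "\<one>\<^bsub>A\<^esub>"]) (auto simp: vertex_ideal_eq cf_mult)
qed

text \<open>An element with nonzero coefficient c at the stationary path of \<open>v\<close> is,
  after division by c, congruent to 1 modulo the vertex ideal.\<close>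

lemma vertex_ideal_maximal:
  assumes v: "v \<in> verts Q" and P: "ideal P A" "P \<noteq> carrier A" "vertex_ideal Q I v \<subseteq> P"
  shows "P = vertex_ideal Q I v"
proof (rule ccontr)
  interpret P: ideal P A by (rule P)
  assume "P \<noteq> vertex_ideal Q I v"
  then obtain x where x: "x \<in> P" "x \<notin> vertex_ideal Q I v" using P(3) by blast
  then have xc: "x \<in> carrier A" and nz: "cf x (v, []) \<noteq> 0" using P.Icarr v by (auto simp: vertex_ideal_eq)
  let ?c = "sc (inverse (cf x (v, [])))"
  have cx: "?c \<otimes>\<^bsub>A\<^esub> x \<in> P" using x by (intro P.I_l_closed) auto
  have "\<one>\<^bsub>A\<^esub> \<ominus>\<^bsub>A\<^esub> (?c \<otimes>\<^bsub>A\<^esub> x) \<in> vertex_ideal Q I v"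
    using v xc nz by (simp add: vertex_ideal_eq a_minus_def cf_add cf_neg cf_sc_mult cf_one)
  then have "(\<one>\<^bsub>A\<^esub> \<ominus>\<^bsub>A\<^esub> (?c \<otimes>\<^bsub>A\<^esub> x)) \<oplus>\<^bsub>A\<^esub> (?c \<otimes>\<^bsub>A\<^esub> x) \<in> P"
    using cx P(3) by (intro P.a_closed) auto
  moreover have "(\<one>\<^bsub>A\<^esub> \<ominus>\<^bsub>A\<^esub> (?c \<otimes>\<^bsub>A\<^esub> x)) \<oplus>\<^bsub>A\<^esub> (?c \<otimes>\<^bsub>A\<^esub> x) = \<one>\<^bsub>A\<^esub>"
    using xc by (simp add: a_minus_def A.add.m_assoc A.l_neg)
  ultimately have "\<one>\<^bsub>A\<^esub> \<in> P" by simp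
  then show False using P(2) P.one_imp_carrier by blast
qed

end

section \<open>The ideal of a cycle, its annihilator and the central element
  \<open>m\<close>\<close>

context gentle_cycle
begin

lemma cf_mult_pth:
  assumes "x \<in> carrier A" "y \<in> carrier A"
  shows "cf (x \<otimes>\<^bsub>A\<^esub> y) (pth i l) = (\<Sum>t\<le>l. cf x (pth i t) * cf y (pth (i + t) (l - t)))"
proof -
  have "cf (x \<otimes>\<^bsub>A\<^esub> y) (tail Q (a i), map a [i..<i + l]) =
    (\<Sum>t\<le>l. cf x (pth i t) * cf y (pth (i + t) (l - t)))"
  proof (subst cf_mult[OF assms])
    show "(tail Q (a i), map a [i..<i + l]) \<in> B" using pth_B[of i l] by (simp add: cycle_path_def)
    show "(\<Sum>t\<le>length (map a [i..<i + l]). cf x (tail Q (a i), take t (map a [i..<i + l])) *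
        cf y (tgt Q (tail Q (a i)) (take t (map a [i..<i + l])), drop t (map a [i..<i + l]))) =
      (\<Sum>t\<le>l. cf x (pth i t) * cf y (pth (i + t) (l - t)))"
    proof (rule sum.cong)
      fix t assume "t \<in> {..l}"
      then have t: "t \<le> l" by simp
      have "take t (map a [i..<i + l]) = map a [i..<i + t]" using t by (simp add: take_map)
      then have "tgt Q (tail Q (a i)) (take t (map a [i..<i + l])) = tail Q (a (i + t))" by simp
      then show "cf x (tail Q (a i), take t (map a [i..<i + l])) *
        cf y (tgt Q (tail Q (a i)) (take t (map a [i..<i + l])), drop t (map a [i..<i + l])) =
        cf x (pth i t) * cf y (pth (i + t) (l - t))"
        using pth_take[OF t] pth_drop[OF t] by simp
    qed simp
  qed
  then show ?thesis by (simp add: cycle_path_def)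
qed

lemma el_pth_mult: "el (pth i l) \<otimes>\<^bsub>A\<^esub> el (pth (i + l) l') = el (pth i (l + l'))"
proof -
  have "el (tail Q (a i), map a [i..<i + l]) \<otimes>\<^bsub>A\<^esub> el (tgt Q (tail Q (a i)) (map a [i..<i + l]), map a [i + l..<i + l + l'])
     = el (tail Q (a i), map a [i..<i + l] @ map a [i + l..<i + l + l'])"
    using pth_paths[of i l] pth_paths[of "i + l" l'] by (intro el_mult) (auto simp: cycle_path_def)
  then show ?thesis by (simp only: tgt_pth cycle_path_def pth_append)
qed

lemma el_pth_closed [simp]: "el (pth i l) \<in> carrier A" by (intro el_closed) simp

text \<open>The explicit form of \<open>path_ideal Q I gam\<close>. As \<open>l > 0\<close>, the
  paths here are determined by \<open>l\<close> and \<open>i\<close> modulo \<open>n\<close>, unlike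
  the stationary ones.\<close>

definition cycle_span :: "(('v, 'a) path \<Rightarrow>\<^sub>0 'k) set set" where
  "cycle_span = {x \<in> carrier A. \<forall>q\<in>B. cf x q \<noteq> 0 \<longrightarrow> q \<in> {pth i l | i l. l > 0}}"

lemma cycle_span_ideal: "ideal cycle_span A"
  unfolding cycle_span_def
proof (rule support_ideal)
  fix u as assume B: "(u, as) \<in> B"
    and "\<exists>bs cs. as = bs @ cs \<and> ((u, bs) \<in> {pth i l | i l. l > 0} \<or> (tgt Q u bs, cs) \<in> {pth i l | i l. l > 0})"
  then obtain bs cs i l where *: "as = bs @ cs" "l > 0" "(u, bs) = pth i l \<or> (tgt Q u bs, cs) = pth i l" by auto
  then have ai: "a i \<in> set as" by (auto simp: cycle_path_def)
  then obtain j where "(u, as) = pth j (length as)" using basis_path_in_cycle[OF B] by blast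
  moreover have "length as > 0" using ai by auto
  ultimately show "(u, as) \<in> {pth i l | i l. l > 0}" by blast
qed

lemma cycle_span_eqI:
  assumes "x \<in> cycle_span" "y \<in> cycle_span" "\<And>i l. l > 0 \<Longrightarrow> cf x (pth i l) = cf y (pth i l)"
  shows "x = y"
proof (rule cf_eqI)
  fix q assume q: "q \<in> B"
  show "cf x q = cf y q"
  proof (cases "q \<in> {pth i l | i l. l > 0}")
    case False
    then have "cf x q = 0" "cf y q = 0" using assms q unfolding cycle_span_def by blast+
    then show ?thesis by simp
  qed (use assms(3) in auto)
qed (use assms in \<open>auto simp: cycle_span_def\<close>)

lemma el_pth_in_span: "l > 0 \<Longrightarrow> el (pth i l) \<in> cycle_span"
  unfolding cycle_span_def by (auto simp: cf_el simp del: quot_closed split: if_splits)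

lemma path_ideal_eq: "path_ideal Q I gam = cycle_span"
proof
  have gens: "{el (arrow_path Q \<alpha>) |\<alpha>. \<alpha> \<in> arcs Q \<and> max_path_of Q I \<alpha> = gam} = {el (pth i 1) | i. True}"
    using max_path_of_gam by (auto simp: arrow_path_def cycle_path_def)
  have c: "{el (pth i 1) | i. True} \<subseteq> carrier A" by auto
  show "path_ideal Q I gam \<subseteq> cycle_span"
    unfolding path_ideal_def gens by (rule A.genideal_minimal[OF cycle_span_ideal]) (auto intro: el_pth_in_span)
  have id: "ideal (path_ideal Q I gam) A" unfolding path_ideal_def gens by (rule A.genideal_ideal[OF c])
  interpret J: ideal "path_ideal Q I gam" A by (rule id)
  have el1: "el (pth i 1) \<in> path_ideal Q I gam" for i
    using A.genideal_self[OF c] unfolding path_ideal_def gens by auto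
  show "cycle_span \<subseteq> path_ideal Q I gam"
  proof
    fix x assume x: "x \<in> cycle_span"
    show "x \<in> path_ideal Q I gam"
    proof (rule mem_ideal_if_support[OF id])
      fix q assume "q \<in> B" "cf x q \<noteq> 0"
      then obtain i l where q: "q = pth i l" "l > 0" using x by (auto simp: cycle_span_def)
      have "el (pth i 1) \<otimes>\<^bsub>A\<^esub> el (pth (i + 1) (l - 1)) \<in> path_ideal Q I gam"
        by (intro J.I_r_closed el1 el_pth_closed)
      then show "el q \<in> path_ideal Q I gam" unfolding el_pth_mult using q by simp
    qed (use x in \<open>simp add: cycle_span_def\<close>)
  qed
qed

lemma cf_mult_el_pth:
  assumes "x \<in> carrier A" "L > 0"
  shows "cf (x \<otimes>\<^bsub>A\<^esub> el (pth j L)) (pth i l) =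
    (if L \<le> l \<and> (i + (l - L)) mod n = j mod n then cf x (pth i (l - L)) else 0)"
proof -
  have "cf (x \<otimes>\<^bsub>A\<^esub> el (pth j L)) (pth i l) = (\<Sum>t\<le>l. if t = l - L then
      (if L \<le> l \<and> (i + (l - L)) mod n = j mod n then cf x (pth i (l - L)) else 0) else 0)"
    unfolding cf_mult_pth[OF assms(1) el_pth_closed]
  proof (intro sum.cong refl)
    fix t assume t: "t \<in> {..l}"
    have "pth j L = pth (i + t) (l - t) \<longleftrightarrow> t = l - L \<and> L \<le> l \<and> (i + (l - L)) mod n = j mod n"
      using t assms(2) pth_eq_iff[of L j "i + t" "l - t"] by auto
    then show "cf x (pth i t) * cf (el (pth j L)) (pth (i + t) (l - t)) = (if t = l - L then
      (if L \<le> l \<and> (i + (l - L)) mod n = j mod n then cf x (pth i (l - L)) else 0) else 0)"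
      by (auto simp: cf_el)
  qed
  then show ?thesis by simp
qed

lemma cf_el_pth_mult:
  assumes "x \<in> carrier A" "L > 0"
  shows "cf (el (pth j L) \<otimes>\<^bsub>A\<^esub> x) (pth i l) =
    (if L \<le> l \<and> i mod n = j mod n then cf x (pth (i + L) (l - L)) else 0)"
proof -
  have "cf (el (pth j L) \<otimes>\<^bsub>A\<^esub> x) (pth i l) = (\<Sum>t\<le>l. if t = L then
      (if L \<le> l \<and> i mod n = j mod n then cf x (pth (i + L) (l - L)) else 0) else 0)"
    unfolding cf_mult_pth[OF el_pth_closed assms(1)]
  proof (intro sum.cong refl)
    fix t assume t: "t \<in> {..l}"
    have "pth j L = pth i t \<longleftrightarrow> t = L \<and> L \<le> l \<and> i mod n = j mod n"
      using t assms(2) pth_eq_iff[of L j i t] by auto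
    then show "cf (el (pth j L)) (pth i t) * cf x (pth (i + t) (l - t)) = (if t = L then
      (if L \<le> l \<and> i mod n = j mod n then cf x (pth (i + L) (l - L)) else 0) else 0)"
      by (auto simp: cf_el)
  qed
  then show ?thesis by auto
qed

text \<open>Multiplication by the arrow \<open>a (i + l)\<close> moves the coefficient at
  \<open>pth i l\<close> to \<open>pth i (l + 1)\<close>, so an annihilating element has coefficient
  zero there, also for \<open>l = 0\<close>. Conversely, a nonzero term of x y with y in
  \<open>cycle_span\<close> would require a left piece on the cycle.\<close>

lemma ann_ideal_eq: "ann_ideal Q I gam = {x \<in> carrier A. \<forall>i l. cf x (pth i l) = 0}"
proof (intro Set.set_eqI iffI)
  fix x assume "x \<in> ann_ideal Q I gam"
  then have x: "x \<in> carrier A" "\<And>y. y \<in> cycle_span \<Longrightarrow> x \<otimes>\<^bsub>A\<^esub> y = \<zero>\<^bsub>A\<^esub>"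
    by (auto simp: ann_ideal_def annihilator_def path_ideal_eq)
  have "cf x (pth i l) = 0" for i l
  proof -
    have "cf (x \<otimes>\<^bsub>A\<^esub> el (pth (i + l) 1)) (pth i (l + 1)) = 0" using x(2) el_pth_in_span[of 1] by simp
    then show ?thesis using x(1) by (subst (asm) cf_mult_el_pth) auto
  qed
  then show "x \<in> {x \<in> carrier A. \<forall>i l. cf x (pth i l) = 0}" using x by simp
next
  fix x assume x: "x \<in> {x \<in> carrier A. \<forall>i l. cf x (pth i l) = 0}"
  have "x \<otimes>\<^bsub>A\<^esub> y = \<zero>\<^bsub>A\<^esub>" if y: "y \<in> cycle_span" for y
  proof (rule cf_eqI)
    have yc: "y \<in> carrier A" using y by (simp add: cycle_span_def)
    fix q assume q: "q \<in> B"
    obtain u as where ua: "q = (u, as)" by (cases q)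
    have "cf (x \<otimes>\<^bsub>A\<^esub> y) q = 0"
    proof (rule ccontr)
      assume "cf (x \<otimes>\<^bsub>A\<^esub> y) q \<noteq> 0"
      then obtain bs cs where as: "as = bs @ cs" "(tgt Q u bs, cs) \<in> B"
        and nz: "cf x (u, bs) \<noteq> 0" "cf y (tgt Q u bs, cs) \<noteq> 0"
        using cf_mult_nonzero[of x y u as] x yc q ua by blast
      then obtain j l where "(tgt Q u bs, cs) = pth j l" "l > 0" using y by (auto simp: cycle_span_def)
      then obtain i where "(u, bs) = pth i (length bs)"
        using basis_path_in_cycle_prefix[of u bs cs j l] q ua as by auto
      then show False using nz(1) x by simp
    qed
    then show "cf (x \<otimes>\<^bsub>A\<^esub> y) q = cf \<zero>\<^bsub>A\<^esub> q" using q by simp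
  qed (use x y in \<open>auto simp: cycle_span_def\<close>)
  then show "x \<in> ann_ideal Q I gam"
    using x by (simp add: ann_ideal_def annihilator_def path_ideal_eq)
qed

lemma ann_ideal_ideal: "ideal (ann_ideal Q I gam) A"
  unfolding ann_ideal_def path_ideal_eq by (rule A.annihilator_ideal[OF cycle_span_ideal])

abbreviation m :: "(('v, 'a) path \<Rightarrow>\<^sub>0 'k) set" where "m \<equiv> m_elem Q I gam"

lemma m_eq: "m = finsum A (\<lambda>i. el (pth i n)) {..<n}"
proof -
  have "a ` {..<n} = range a"
  proof
    show "range a \<subseteq> a ` {..<n}"
    proof
      fix \<alpha> assume "\<alpha> \<in> range a"
      then obtain i where "\<alpha> = a i" by auto
      then have "\<alpha> = a (i mod n)" by (simp add: a_eq_iff)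
      then show "\<alpha> \<in> a ` {..<n}" using n_pos by auto
    qed
  qed auto
  then have set: "{\<alpha> \<in> arcs Q. max_path_of Q I \<alpha> = gam} = a ` {..<n}"
    using max_path_of_gam by auto
  have inj: "inj_on a {..<n}" by (rule inj_onI) (simp add: a_eq_iff)
  have "m = finsum A (\<lambda>\<alpha>. el (gamma_r Q I \<alpha>)) (a ` {..<n})"
    unfolding m_elem_def set ..
  also have "\<dots> = finsum A (\<lambda>i. el (gamma_r Q I (a i))) {..<n}"
    by (rule A.finsum_reindex[OF _ inj]) (auto simp: gamma_r_a)
  finally show ?thesis by (simp add: gamma_r_a)
qed

lemma m_closed [simp]: "m \<in> carrier A" unfolding m_eq by (rule A.finsum_closed) auto

lemma cf_m:
  assumes "q \<in> B"
  shows "cf m q = (if q \<in> {pth i n | i. True} then 1 else 0)"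
proof -
  have "cf m q = (\<Sum>i<n. cf (el (pth i n)) q)" unfolding m_eq by (rule cf_finsum) (use assms in auto)
  also have "\<dots> = (\<Sum>i<n. if q = pth i n then 1 else 0)" using assms by (intro sum.cong) (auto simp: cf_el)
  also have "\<dots> = (if q \<in> {pth i n | i. True} then 1 else 0)"
  proof (cases "q \<in> {pth i n | i. True}")
    case True
    then obtain i where i: "q = pth i n" by auto
    have "(\<Sum>j<n. if q = pth j n then 1 else 0 :: 'k) = (\<Sum>j<n. if j = i mod n then 1 else 0)"
      using i n_pos pth_eq_iff[OF n_pos, of i _ n] by (intro sum.cong) auto
    then show ?thesis using True n_pos by simp
  qed auto
  finally show ?thesis .
qed

lemma cf_m_pth: "cf m (pth i l) = (if l = n then 1 else 0)"
  using pth_length_eq by (auto simp: cf_m)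

lemma m_in_span: "m \<in> cycle_span"
  using n_pos unfolding cycle_span_def by (auto simp: cf_m split: if_splits)

lemma cf_mult_m: "x \<in> carrier A \<Longrightarrow> cf (x \<otimes>\<^bsub>A\<^esub> m) (pth i l) = (if n \<le> l then cf x (pth i (l - n)) else 0)"
proof -
  assume x: "x \<in> carrier A"
  have "cf (x \<otimes>\<^bsub>A\<^esub> m) (pth i l) = (\<Sum>t\<le>l. if t = l - n then (if n \<le> l then cf x (pth i (l - n)) else 0) else 0)"
    unfolding cf_mult_pth[OF x m_closed] using n_pos by (intro sum.cong) (auto simp: cf_m_pth)
  then show ?thesis by simp
qed

text \<open>Both products lie in \<open>cycle_span\<close>, and both have at \<open>pth i l\<close>
  the coefficient of \<open>x\<close> at \<open>pth i (l - n)\<close>, or 0 if \<open>l < n\<close>: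
  removing a full turn at the start or at the end leaves the same path.\<close>

lemma m_central: "x \<in> carrier A \<Longrightarrow> x \<otimes>\<^bsub>A\<^esub> m = m \<otimes>\<^bsub>A\<^esub> x"
proof (rule cycle_span_eqI)
  assume x: "x \<in> carrier A"
  show "x \<otimes>\<^bsub>A\<^esub> m \<in> cycle_span" "m \<otimes>\<^bsub>A\<^esub> x \<in> cycle_span"
    using ideal.I_l_closed[OF cycle_span_ideal m_in_span x] ideal.I_r_closed[OF cycle_span_ideal m_in_span x] .
  fix i l
  have "cf (m \<otimes>\<^bsub>A\<^esub> x) (pth i l) = (\<Sum>t\<le>l. if t = n then (if n \<le> l then cf x (pth i (l - n)) else 0) else 0)"
    unfolding cf_mult_pth[OF m_closed x] by (intro sum.cong) (auto simp: cf_m_pth)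
  then show "cf (x \<otimes>\<^bsub>A\<^esub> m) (pth i l) = cf (m \<otimes>\<^bsub>A\<^esub> x) (pth i l)" using x by (auto simp: cf_mult_m)
qed

end

text \<open>If t = p g, then g vanishes at 0 because p does not; so t divides g, and cancelling t
  makes p a unit. In this form p(0) \<noteq> 0 enters primality.\<close>

lemma not_dvd_var:
  fixes p :: "'k::field poly"
  assumes p: "Factorial_Ring.irreducible p" "poly p 0 \<noteq> 0"
  shows "\<not> p dvd [:0, 1:]"
proof
  assume "p dvd [:0, 1:]"
  then obtain g where g: "[:0, 1:] = p * g" by (auto elim: dvdE)
  have "poly (p * g) 0 = 0" unfolding g[symmetric] by simp
  then have "poly g 0 = 0" using p(2) by simp
  then have "[:0, 1:] dvd g" by (simp add: poly_eq_0_iff_dvd)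
  then obtain h where "g = [:0, 1:] * h" by (auto elim: dvdE)
  then have "[:0, 1:] * 1 = [:0, 1:] * (p * h)" using g by (simp add: mult.left_commute)
  then have "1 = p * h" by (subst (asm) mult_cancel_left) simp
  then have "is_unit p" by (rule dvdI)
  then show False using p(1) by (simp add: Factorial_Ring.irreducible_def)
qed

lemma mod_add_left_cancel_nat:
  fixes i r s n :: nat
  shows "(i + s) mod n = (i + r) mod n \<longleftrightarrow> s mod n = r mod n"
proof (cases "s \<le> r")
  case True
  then show ?thesis using mod_eq_dvd_iff_nat[of "i + s" "i + r" n] mod_eq_dvd_iff_nat[of s r n] by auto
next
  case False
  then show ?thesis using mod_eq_dvd_iff_nat[of "i + r" "i + s" n] mod_eq_dvd_iff_nat[of r s n] by auto
qed

section \<open>Scalars, polynomials in \<open>m\<close>, and the matrix entries of an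
  element\<close>

context gentle_quiver
begin

lemma sc_central: "x \<in> carrier A \<Longrightarrow> sc c \<otimes>\<^bsub>A\<^esub> x = x \<otimes>\<^bsub>A\<^esub> sc c"
  by (rule cf_eqI) (auto simp: cf_sc_mult simp del: quot_closed)

lemma sc_zero: "sc 0 = \<zero>\<^bsub>A\<^esub>"
  by (rule cf_eqI) (auto simp: cf_sc simp del: quot_closed)

lemma sc_add: "sc (c + d) = sc c \<oplus>\<^bsub>A\<^esub> sc d"
  by (rule cf_eqI) (auto simp: cf_sc cf_add simp del: quot_closed)

lemma sc_mult: "sc (c * d) = sc c \<otimes>\<^bsub>A\<^esub> sc d"
  by (rule cf_eqI) (auto simp: cf_sc cf_sc_mult simp del: quot_closed)

end

context gentle_cycle
begin

abbreviation pe :: "'k poly \<Rightarrow> (('v, 'a) path \<Rightarrow>\<^sub>0 'k) set" where "pe f \<equiv> poly_eval Q I f m"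

lemma pe_eq: "Polynomial.degree f \<le> N \<Longrightarrow>
    pe f = finsum A (\<lambda>i. sc (Polynomial.coeff f i) \<otimes>\<^bsub>A\<^esub> (m [^]\<^bsub>A\<^esub> i)) {..N}"
proof (induction N)
  case (Suc N)
  show ?case
  proof (cases "Polynomial.degree f = Suc N")
    case False
    then have "Polynomial.degree f \<le> N" using Suc.prems by simp
    then show ?thesis using Suc.IH
      by (subst A.finsum_Suc) (auto simp: coeff_eq_0 sc_zero simp del: quot_closed)
  qed (simp add: poly_eval_def)
qed (simp add: poly_eval_def)

lemma pe_closed [simp]: "pe f \<in> carrier A"
  unfolding poly_eval_def by (rule A.finsum_closed) auto

text \<open>Horner's rule. Additivity, multiplicativity and centrality of evaluation then follow by
  induction on the polynomial, without handling powers of \<open>m\<close>.\<close>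

lemma pe_pCons: "pe (pCons c f) = pe f \<otimes>\<^bsub>A\<^esub> m \<oplus>\<^bsub>A\<^esub> sc c"
proof -
  let ?N = "Polynomial.degree f"
  have "pe (pCons c f) = finsum A (\<lambda>i. sc (Polynomial.coeff (pCons c f) i) \<otimes>\<^bsub>A\<^esub> (m [^]\<^bsub>A\<^esub> i)) {..Suc ?N}"
    by (rule pe_eq) (simp add: degree_pCons_le)
  also have "\<dots> = finsum A (\<lambda>i. sc (Polynomial.coeff f i) \<otimes>\<^bsub>A\<^esub> (m [^]\<^bsub>A\<^esub> i) \<otimes>\<^bsub>A\<^esub> m) {..?N} \<oplus>\<^bsub>A\<^esub> sc c"
    by (subst A.finsum_Suc2) (auto simp: A.m_assoc simp del: quot_closed)
  also have "finsum A (\<lambda>i. sc (Polynomial.coeff f i) \<otimes>\<^bsub>A\<^esub> (m [^]\<^bsub>A\<^esub> i) \<otimes>\<^bsub>A\<^esub> m) {..?N} = pe f \<otimes>\<^bsub>A\<^esub> m"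
    unfolding poly_eval_def by (rule A.finsum_ldistr[symmetric]) auto
  finally show ?thesis .
qed

lemma pe_0: "pe 0 = \<zero>\<^bsub>A\<^esub>"
  by (simp add: poly_eval_def sc_zero del: quot_closed)

lemma pe_1: "pe 1 = \<one>\<^bsub>A\<^esub>"
  by (simp add: poly_eval_def quot_one[symmetric] del: quot_closed)

lemma pe_var: "pe [:0, 1:] = m"
  using pe_1 by (simp add: pe_pCons sc_zero pe_0 quot_one[symmetric] one_pCons del: quot_closed)

lemma pe_central: "x \<in> carrier A \<Longrightarrow> pe f \<otimes>\<^bsub>A\<^esub> x = x \<otimes>\<^bsub>A\<^esub> pe f"
proof (induction f)
  case (pCons c f)
  have "pe (pCons c f) \<otimes>\<^bsub>A\<^esub> x = (pe f \<otimes>\<^bsub>A\<^esub> (m \<otimes>\<^bsub>A\<^esub> x)) \<oplus>\<^bsub>A\<^esub> sc c \<otimes>\<^bsub>A\<^esub> x"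
    using pCons.prems by (simp add: pe_pCons A.l_distr A.m_assoc del: quot_closed)
  also have "m \<otimes>\<^bsub>A\<^esub> x = x \<otimes>\<^bsub>A\<^esub> m" using m_central pCons.prems by simp
  also have "pe f \<otimes>\<^bsub>A\<^esub> (x \<otimes>\<^bsub>A\<^esub> m) = x \<otimes>\<^bsub>A\<^esub> (pe f \<otimes>\<^bsub>A\<^esub> m)"
    using pCons by (simp add: A.m_assoc[symmetric] del: quot_closed)
  finally show ?case using pCons.prems by (simp add: pe_pCons A.r_distr sc_central del: quot_closed)
qed (simp add: pe_0)

lemma pe_add: "pe (f + g) = pe f \<oplus>\<^bsub>A\<^esub> pe g"
proof (induction f g rule: poly_induct2)
  case (pCons c f d g)
  have "(pe f \<oplus>\<^bsub>A\<^esub> pe g) \<otimes>\<^bsub>A\<^esub> m \<oplus>\<^bsub>A\<^esub> (sc c \<oplus>\<^bsub>A\<^esub> sc d) =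
      (pe f \<otimes>\<^bsub>A\<^esub> m \<oplus>\<^bsub>A\<^esub> sc c) \<oplus>\<^bsub>A\<^esub> (pe g \<otimes>\<^bsub>A\<^esub> m \<oplus>\<^bsub>A\<^esub> sc d)"
    by (simp add: A.l_distr A.a_ac del: quot_closed)
  then show ?case by (simp add: pe_pCons sc_add pCons)
qed (simp add: pe_0)

lemma pe_smult: "pe (smult c f) = sc c \<otimes>\<^bsub>A\<^esub> pe f"
  by (induction f) (simp_all add: pe_0 pe_pCons sc_mult A.r_distr A.m_assoc del: quot_closed)

lemma pe_mult: "pe (f * g) = pe f \<otimes>\<^bsub>A\<^esub> pe g"
proof (induction f)
  case (pCons c f)
  have "pe f \<otimes>\<^bsub>A\<^esub> pe g \<otimes>\<^bsub>A\<^esub> m = pe f \<otimes>\<^bsub>A\<^esub> m \<otimes>\<^bsub>A\<^esub> pe g"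
    by (simp add: A.m_assoc m_central)
  then show ?case
    by (simp add: pe_add pe_smult pe_pCons pCons sc_zero A.l_distr A.a_comm del: quot_closed)
qed (simp add: pe_0)

lemma Idl_pe: "Idl\<^bsub>A\<^esub> {pe p} \<subseteq> {x \<otimes>\<^bsub>A\<^esub> pe p | x. x \<in> carrier A}"
  by (rule A.Idl_central) (auto simp: pe_central)

text \<open>Modulo the annihilator, \<open>A\<close> embeds into matrices over polynomials in the central
  element \<open>m\<close>; \<open>phi i r x\<close> is the entry of \<open>x\<close> for the paths from arrow \<open>i\<close> to
  arrow \<open>i + r\<close>.\<close>

definition phi :: "nat \<Rightarrow> nat \<Rightarrow> (('v, 'a) path \<Rightarrow>\<^sub>0 'k) set \<Rightarrow> 'k poly" where
  "phi i r x = Abs_poly (\<lambda>k. cf x (pth i (r + k * n)))"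

text \<open>\<open>Abs_poly\<close> is meaningful only if almost all coefficients vanish. Different
  \<open>k\<close> give paths of different lengths, so this follows from the finite support of
  \<open>x\<close>.\<close>

lemma coeff_phi: "x \<in> carrier A \<Longrightarrow> Polynomial.coeff (phi i r x) k = cf x (pth i (r + k * n))"
proof -
  assume x: "x \<in> carrier A"
  let ?K = "{k. cf x (pth i (r + k * n)) \<noteq> 0}"
  have "inj_on (\<lambda>k. pth i (r + k * n)) ?K"
    using n_pos by (intro inj_onI) (auto dest: pth_length_eq)
  moreover have "(\<lambda>k. pth i (r + k * n)) ` ?K \<subseteq> {q \<in> B. cf x q \<noteq> 0}" by auto
  ultimately have "finite ?K" using finite_cf[OF x] by (meson finite_imageD finite_subset)
  then obtain N where "\<forall>k\<in>?K. k \<le> N" using finite_nat_set_iff_bounded_le by blast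
  then have "\<And>k. k > N \<Longrightarrow> cf x (pth i (r + k * n)) = 0" by fastforce
  then show ?thesis unfolding phi_def by (subst coeff_Abs_poly) auto
qed

lemma phi_add: "\<lbrakk>x \<in> carrier A; y \<in> carrier A\<rbrakk> \<Longrightarrow> phi i r (x \<oplus>\<^bsub>A\<^esub> y) = phi i r x + phi i r y"
  by (rule poly_eqI) (simp add: coeff_phi cf_add)

lemma phi_zero: "phi i r \<zero>\<^bsub>A\<^esub> = 0"
  by (rule poly_eqI) (simp add: coeff_phi)

lemma phi_sc: "x \<in> carrier A \<Longrightarrow> phi i r (x \<otimes>\<^bsub>A\<^esub> sc c) = smult c (phi i r x)"
  by (rule poly_eqI) (simp add: coeff_phi cf_sc_mult del: quot_closed)

text \<open>Multiplication by \<open>m\<close> adds one turn, hence raises \<open>k\<close> by one.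
  At \<open>k = 0\<close> the length \<open>r < n\<close> is too short to contain a turn, which
  gives the constant coefficient 0.\<close>

lemma phi_m: "\<lbrakk>x \<in> carrier A; r < n\<rbrakk> \<Longrightarrow> phi i r (x \<otimes>\<^bsub>A\<^esub> m) = pCons 0 (phi i r x)"
  by (rule poly_eqI) (auto simp: coeff_phi cf_mult_m coeff_pCons split: nat.split)

lemma phi_pe: "\<lbrakk>x \<in> carrier A; r < n\<rbrakk> \<Longrightarrow> phi i r (x \<otimes>\<^bsub>A\<^esub> pe f) = phi i r x * f"
proof (induction f)
  case (pCons c f)
  have "x \<otimes>\<^bsub>A\<^esub> pe (pCons c f) = (x \<otimes>\<^bsub>A\<^esub> pe f) \<otimes>\<^bsub>A\<^esub> m \<oplus>\<^bsub>A\<^esub> x \<otimes>\<^bsub>A\<^esub> sc c"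
    using pCons by (simp add: pe_pCons A.r_distr A.m_assoc del: quot_closed)
  then show ?case using pCons
    by (simp add: phi_add phi_m phi_sc del: quot_closed)
qed (simp add: pe_0 phi_zero)

lemma phi_el_pth:
  assumes "L > 0" "r < n"
  shows "phi i r (el (pth j L)) = (if i mod n = j mod n \<and> r = L mod n then Polynomial.monom 1 (L div n) else 0)"
proof (rule poly_eqI)
  fix k
  have "L = r + k * n \<longleftrightarrow> r = L mod n \<and> k = L div n"
  proof
    assume "r = L mod n \<and> k = L div n"
    then show "L = r + k * n" by simp
  qed (use assms(2) in simp)
  then show "Polynomial.coeff (phi i r (el (pth j L))) k =
    Polynomial.coeff (if i mod n = j mod n \<and> r = L mod n then Polynomial.monom 1 (L div n) else 0) k"
    using pth_eq_iff[OF assms(1), of j i "r + k * n"] by (auto simp: coeff_phi cf_el)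
qed

lemma phi_one: "phi i 0 \<one>\<^bsub>A\<^esub> = 1"
  using n_pos by (intro poly_eqI) (auto simp: coeff_phi cf_one coeff_1)

lemma cycle_span_eqI_phi:
  assumes x: "x \<in> cycle_span" and y: "y \<in> cycle_span" and eq: "\<And>i r. r < n \<Longrightarrow> phi i r x = phi i r y"
  shows "x = y"
proof (rule cycle_span_eqI[OF x y])
  fix i l :: nat
  have "Polynomial.coeff (phi i (l mod n) x) (l div n) = Polynomial.coeff (phi i (l mod n) y) (l div n)"
    using eq n_pos by simp
  then show "cf x (pth i l) = cf y (pth i l)" using x y by (simp add: coeff_phi cycle_span_def)
qed

text \<open>The full turns keep only the terms of \<open>x\<close> at paths of the cycle from arrow
  \<open>i\<close> to arrow \<open>i + r\<close>, which have lengths \<open>r + k * n\<close>, and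
  lengthen them by \<open>2 * n\<close>. They also resolve stationary terms at a vertex passed
  twice, since the arrows next to the vertex are now visible. Both sides lie in
  \<open>cycle_span\<close> and can be compared entry by entry.\<close>

lemma sandwich:
  assumes x: "x \<in> carrier A" and r: "r < n"
  shows "el (pth i n) \<otimes>\<^bsub>A\<^esub> x \<otimes>\<^bsub>A\<^esub> el (pth (i + r) n) = el (pth i (2 * n + r)) \<otimes>\<^bsub>A\<^esub> pe (phi i r x)"
proof (rule cycle_span_eqI_phi)
  interpret S: ideal cycle_span A by (rule cycle_span_ideal)
  show "el (pth i n) \<otimes>\<^bsub>A\<^esub> x \<otimes>\<^bsub>A\<^esub> el (pth (i + r) n) \<in> cycle_span"
    "el (pth i (2 * n + r)) \<otimes>\<^bsub>A\<^esub> pe (phi i r x) \<in> cycle_span"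
    using n_pos x by (auto intro!: S.I_r_closed el_pth_in_span)
  fix j s assume s: "s < n"
  have "phi j s (el (pth i n) \<otimes>\<^bsub>A\<^esub> x \<otimes>\<^bsub>A\<^esub> el (pth (i + r) n)) =
    (if j mod n = i mod n \<and> s = r then pCons 0 (pCons 0 (phi i r x)) else 0)"
  proof (rule poly_eqI)
    fix k
    \<comment> \<open>The last turn starts at arrow \<open>i + r\<close>, so it only fits behind a
      path whose length is congruent to \<open>r\<close>.\<close>
    have *: "(j + (s + k * n - n)) mod n = (i + r) mod n \<longleftrightarrow> s = r" if "j mod n = i mod n" "n \<le> s + k * n"
    proof -
      have "(j + (s + k * n - n)) mod n = (i + s) mod n"
      proof -
        have "(j + (s + k * n - n)) mod n = (j + (s + k * n - n) + n) mod n" by simp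
        also have "j + (s + k * n - n) + n = j + s + k * n" using that(2) by simp
        also have "\<dots> mod n = (j + s) mod n" by simp
        also have "\<dots> = (i + s) mod n" using that(1) by (rule mod_add_cong) (rule refl)
        finally show ?thesis .
      qed
      moreover have "(i + s) mod n = (i + r) mod n \<longleftrightarrow> s = r"
        using mod_add_left_cancel_nat[of i s n r] s r by simp
      ultimately show ?thesis by simp
    qed
    have "Polynomial.coeff (phi j s (el (pth i n) \<otimes>\<^bsub>A\<^esub> x \<otimes>\<^bsub>A\<^esub> el (pth (i + r) n))) k =
      (if n \<le> s + k * n \<and> (j + (s + k * n - n)) mod n = (i + r) mod n \<and> n \<le> s + k * n - n \<and> j mod n = i mod n
       then cf x (pth j (s + k * n - n - n)) else 0)"
    proof -
      have ifs: "(if P then (if R then v else 0) else 0) = (if P \<and> R then v else 0)" for P R and v :: 'k by simp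
      have "el (pth i n) \<otimes>\<^bsub>A\<^esub> x \<otimes>\<^bsub>A\<^esub> el (pth (i + r) n) \<in> carrier A" "el (pth i n) \<otimes>\<^bsub>A\<^esub> x \<in> carrier A"
        using x by auto
      then show ?thesis
        by (simp only: coeff_phi cf_mult_el_pth[OF _ n_pos] cf_el_pth_mult[OF x n_pos] ifs pth_add_n conj_assoc)
    qed
    also have "\<dots> = (if j mod n = i mod n \<and> s = r \<and> k \<ge> 2 then cf x (pth i (r + (k - 2) * n)) else 0)"
    proof (cases "j mod n = i mod n")
      case True
      show ?thesis
      proof (cases "k \<ge> 2")
        case k2: True
        define k' where "k' = k - 2"
        have k: "k = Suc (Suc k')" using k2 by (simp add: k'_def)
        have le: "n \<le> s + k * n" "n \<le> s + k * n - n" and sub: "s + k * n - n - n = s + (k - 2) * n"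
          by (simp_all add: k)
        have "cf x (pth j l) = cf x (pth i l)" for l using pth_cong[OF True] by simp
        then show ?thesis using True le *[OF True le(1)] k2 unfolding sub by simp
      next
        case False
        then have "k = 0 \<or> k = 1" by auto
        then show ?thesis using s by auto
      qed
    qed simp
    also have "\<dots> = Polynomial.coeff (if j mod n = i mod n \<and> s = r then pCons 0 (pCons 0 (phi i r x)) else 0) k"
      using x by (auto simp: coeff_phi coeff_pCons numeral_2_eq_2 split: nat.split)
    finally show "Polynomial.coeff (phi j s (el (pth i n) \<otimes>\<^bsub>A\<^esub> x \<otimes>\<^bsub>A\<^esub> el (pth (i + r) n))) k = \<dots>" .
  qed
  \<comment> \<open>Length \<open>2 * n + r\<close> means entry \<open>r\<close> and exponent 2;
    this accounts for the two factors \<open>pCons 0\<close>.\<close>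
  also have "\<dots> = phi j s (el (pth i (2 * n + r)) \<otimes>\<^bsub>A\<^esub> pe (phi i r x))"
    using s r n_pos by (subst phi_pe) (auto simp: phi_el_pth monom_altdef power2_eq_square)
  finally show "phi j s (el (pth i n) \<otimes>\<^bsub>A\<^esub> x \<otimes>\<^bsub>A\<^esub> el (pth (i + r) n)) =
    phi j s (el (pth i (2 * n + r)) \<otimes>\<^bsub>A\<^esub> pe (phi i r x))" .
qed

text \<open>Unites the two families: for \<open>p = 0\<close> the entries must vanish, which
  describes the annihilator, and for p(0) nonzero the same condition describes
  \<open>poly_ideal\<close>.\<close>

definition div_ideal :: "'k poly \<Rightarrow> (('v, 'a) path \<Rightarrow>\<^sub>0 'k) set set" where
  "div_ideal p = {x \<in> carrier A. \<forall>i. \<forall>r<n. p dvd phi i r x}"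

lemma ann_ideal_div: "ann_ideal Q I gam = div_ideal 0"
proof (intro Set.set_eqI iffI)
  fix x assume "x \<in> ann_ideal Q I gam"
  then show "x \<in> div_ideal 0"
    by (auto simp: ann_ideal_eq div_ideal_def intro!: poly_eqI simp: coeff_phi)
next
  fix x assume x: "x \<in> div_ideal 0"
  have "cf x (pth i l) = 0" for i l
  proof -
    have "Polynomial.coeff (phi i (l mod n) x) (l div n) = 0" using x n_pos by (simp add: div_ideal_def)
    then show ?thesis using x by (simp add: coeff_phi div_ideal_def)
  qed
  then show "x \<in> ann_ideal Q I gam" using x by (simp add: ann_ideal_eq div_ideal_def)
qed

lemma poly_ideal_ideal: "ideal (poly_ideal Q I gam p) A"
  unfolding poly_ideal_def by (intro A.add_ideals ann_ideal_ideal A.genideal_ideal) simp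

lemma pe_in_poly_ideal: "pe p \<in> poly_ideal Q I gam p"
proof -
  have "\<zero>\<^bsub>A\<^esub> \<in> ann_ideal Q I gam" using ann_ideal_ideal by (simp add: additive_subgroup.zero_closed ideal.axioms)
  moreover have "pe p \<in> Idl\<^bsub>A\<^esub> {pe p}" using A.genideal_self'[of "pe p"] by simp
  ultimately have "\<zero>\<^bsub>A\<^esub> \<oplus>\<^bsub>A\<^esub> pe p \<in> poly_ideal Q I gam p"
    unfolding poly_ideal_def set_add_def' by blast
  then show ?thesis by simp
qed

lemma ann_subset_poly_ideal: "ann_ideal Q I gam \<subseteq> poly_ideal Q I gam p"
proof
  fix x assume x: "x \<in> ann_ideal Q I gam"
  have "ideal (Idl\<^bsub>A\<^esub> {pe p}) A" by (rule A.genideal_ideal) simp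
  then have "\<zero>\<^bsub>A\<^esub> \<in> Idl\<^bsub>A\<^esub> {pe p}" by (simp add: additive_subgroup.zero_closed ideal.axioms)
  then have "x \<oplus>\<^bsub>A\<^esub> \<zero>\<^bsub>A\<^esub> \<in> poly_ideal Q I gam p"
    using x unfolding poly_ideal_def set_add_def' by blast
  then show "x \<in> poly_ideal Q I gam p" using x by (simp add: ann_ideal_eq)
qed

text \<open>As \<open>m\<close> is invertible modulo \<open>p(m)\<close>, it suffices to know \<open>m x m\<close>, which is a
  sum of the products computed in \<open>sandwich\<close>.\<close>

lemma poly_ideal_div:
  assumes p: "poly p 0 \<noteq> 0"
  shows "poly_ideal Q I gam p = div_ideal p"
proof
  show "poly_ideal Q I gam p \<subseteq> div_ideal p"
  proof
    fix z assume "z \<in> poly_ideal Q I gam p"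
    then obtain x y where xy: "x \<in> ann_ideal Q I gam" "y \<in> Idl\<^bsub>A\<^esub> {pe p}" "z = x \<oplus>\<^bsub>A\<^esub> y"
      unfolding poly_ideal_def set_add_def' by blast
    then obtain w where w: "w \<in> carrier A" "y = w \<otimes>\<^bsub>A\<^esub> pe p" using Idl_pe by blast
    have x: "x \<in> carrier A" "\<And>i r. r < n \<Longrightarrow> phi i r x = 0"
      using xy(1) by (auto simp: ann_ideal_div div_ideal_def)
    show "z \<in> div_ideal p"
      using x w by (auto simp: xy(3) div_ideal_def phi_add phi_pe)
  qed
next
  define T where "T = poly_ideal Q I gam p"
  have T: "ideal T A" unfolding T_def by (rule poly_ideal_ideal)
  interpret T: ideal T A by (rule T)
  have peT: "pe p \<in> T" unfolding T_def by (rule pe_in_poly_ideal)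
  obtain c p' where cp: "p = pCons c p'" by (cases p)
  have c: "c \<noteq> 0" using p by (simp add: cp)
  \<comment> \<open>Write p = c + t p' with c nonzero. Then z p(m) - z p'(m) m = c z, so
    \<open>z\<close> lies in \<open>T\<close> as soon as z m does.\<close>
  have cancel: "z \<in> T" if z: "z \<in> carrier A" "z \<otimes>\<^bsub>A\<^esub> m \<in> T" for z
  proof -
    have 1: "z \<otimes>\<^bsub>A\<^esub> pe p \<in> T" using z peT by (intro T.I_l_closed)
    have "pe p' \<otimes>\<^bsub>A\<^esub> (z \<otimes>\<^bsub>A\<^esub> m) \<in> T" using T.I_l_closed[OF z(2)] by simp
    then have 2: "\<ominus>\<^bsub>A\<^esub> (z \<otimes>\<^bsub>A\<^esub> pe p' \<otimes>\<^bsub>A\<^esub> m) \<in> T"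
      using z by (simp add: A.m_assoc[symmetric] pe_central del: quot_closed)
    have "\<ominus>\<^bsub>A\<^esub> (z \<otimes>\<^bsub>A\<^esub> pe p' \<otimes>\<^bsub>A\<^esub> m) \<oplus>\<^bsub>A\<^esub> z \<otimes>\<^bsub>A\<^esub> pe p \<in> T" using 2 1 by (rule T.a_closed)
    also have "\<ominus>\<^bsub>A\<^esub> (z \<otimes>\<^bsub>A\<^esub> pe p' \<otimes>\<^bsub>A\<^esub> m) \<oplus>\<^bsub>A\<^esub> z \<otimes>\<^bsub>A\<^esub> pe p = z \<otimes>\<^bsub>A\<^esub> sc c"
      using z by (simp add: cp pe_pCons A.r_distr A.m_assoc A.a_assoc[symmetric] A.l_neg del: quot_closed)
    finally have "z \<otimes>\<^bsub>A\<^esub> sc c \<otimes>\<^bsub>A\<^esub> sc (inverse c) \<in> T" by (rule T.I_r_closed) simp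
    also have "z \<otimes>\<^bsub>A\<^esub> sc c \<otimes>\<^bsub>A\<^esub> sc (inverse c) = z"
      using z c by (simp add: A.m_assoc sc_mult[symmetric] quot_one[symmetric] del: quot_closed)
    finally show ?thesis .
  qed
  have mT: "m \<otimes>\<^bsub>A\<^esub> y \<in> T" if "y \<in> carrier A" "\<And>i. el (pth i n) \<otimes>\<^bsub>A\<^esub> y \<in> T" for y
    unfolding m_eq using that by (subst A.finsum_ldistr) (auto intro: T.finsum_closed_ideal)
  have Tm: "y \<otimes>\<^bsub>A\<^esub> m \<in> T" if "y \<in> carrier A" "\<And>i. y \<otimes>\<^bsub>A\<^esub> el (pth i n) \<in> T" for y
    unfolding m_eq using that by (subst A.finsum_rdistr) (auto intro: T.finsum_closed_ideal)
  show "div_ideal p \<subseteq> poly_ideal Q I gam p"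
  proof
    fix x assume x: "x \<in> div_ideal p"
    then have xc: "x \<in> carrier A" by (simp add: div_ideal_def)
    have "el (pth i n) \<otimes>\<^bsub>A\<^esub> x \<otimes>\<^bsub>A\<^esub> el (pth j n) \<in> T" for i j
    proof -
      \<comment> \<open>Makes \<open>i + r\<close> congruent to \<open>j\<close>, so that the right
        factor has the form required by \<open>sandwich\<close>.\<close>
      define r where "r = (j + (n - 1) * i) mod n"
      have r: "r < n" using n_pos by (simp add: r_def)
      have "(i + r) mod n = (i + (j + (n - 1) * i)) mod n" unfolding r_def by (rule mod_add_right_eq)
      also have "i + (j + (n - 1) * i) = j + n * i" using n_pos by (cases n) auto
      finally have "pth j n = pth (i + r) n" by (intro pth_cong) simp
      then have eq: "el (pth i n) \<otimes>\<^bsub>A\<^esub> x \<otimes>\<^bsub>A\<^esub> el (pth j n) = el (pth i (2 * n + r)) \<otimes>\<^bsub>A\<^esub> pe (phi i r x)"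
        using sandwich[OF xc r] by simp
      have "p dvd phi i r x" using x r unfolding div_ideal_def by blast
      then obtain g where "phi i r x = p * g" by (rule dvdE)
      then have "pe (phi i r x) \<in> T" using peT T.I_r_closed by (simp add: pe_mult)
      then show ?thesis unfolding eq by (intro T.I_l_closed) auto
    qed
    \<comment> \<open>Summing over the second and then the first starting arrow replaces the two
      turns by \<open>m\<close>; both copies are then moved to the right and cancelled.\<close>
    then have "el (pth i n) \<otimes>\<^bsub>A\<^esub> x \<otimes>\<^bsub>A\<^esub> m \<in> T" for i using xc by (intro Tm) auto
    then have "m \<otimes>\<^bsub>A\<^esub> (x \<otimes>\<^bsub>A\<^esub> m) \<in> T" using xc by (intro mT) (auto simp: A.m_assoc)
    then have "x \<otimes>\<^bsub>A\<^esub> m \<otimes>\<^bsub>A\<^esub> m \<in> T" using m_central[of "x \<otimes>\<^bsub>A\<^esub> m"] xc by simp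
    then have "x \<otimes>\<^bsub>A\<^esub> m \<in> T" using cancel[of "x \<otimes>\<^bsub>A\<^esub> m"] xc by simp
    then have "x \<in> T" using cancel[of x] xc by simp
    then show "x \<in> poly_ideal Q I gam p" by (simp add: T_def)
  qed
qed

text \<open>Choose entries of \<open>x\<close> and \<open>y\<close> not divisible by
  \<open>p\<close> and join the end of the first to the start of the second by a path of the cycle.
  Enclosed in full turns, the product has an entry equal to a power of t times the product of the
  two chosen ones, which \<open>p\<close> does not divide.\<close>

lemma div_ideal_prime:
  assumes id: "ideal (div_ideal p) A"
    and prime: "\<And>f g. p dvd f * g \<Longrightarrow> p dvd f \<or> p dvd g" and var: "\<not> p dvd [:0, 1:]"
  shows "nc_prime_ideal A (div_ideal p)"
proof (rule A.nc_prime_idealI[OF id])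
  interpret D: ideal "div_ideal p" A by (rule id)
  have monom: "\<not> p dvd Polynomial.monom 1 k" for k
  proof (induction k)
    case 0
    then show ?case using var dvd_trans by (auto simp: monom_0 one_pCons[symmetric])
  next
    case (Suc k)
    have "Polynomial.monom 1 (Suc k) = [:0, 1:] * Polynomial.monom (1 :: 'k) k" by (simp add: monom_Suc)
    then show ?case using Suc prime var by metis
  qed
  show "div_ideal p \<noteq> carrier A"
  proof
    assume "div_ideal p = carrier A"
    then have "\<one>\<^bsub>A\<^esub> \<in> div_ideal p" by simp
    then have "p dvd phi 0 0 \<one>\<^bsub>A\<^esub>" using n_pos unfolding div_ideal_def by blast
    then show False using monom[of 0] by (simp add: phi_one monom_0 one_pCons)
  qed
  fix x y assume x: "x \<in> carrier A" "x \<notin> div_ideal p" and y: "y \<in> carrier A" "y \<notin> div_ideal p"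
  obtain i r where r: "r < n" "\<not> p dvd phi i r x" using x unfolding div_ideal_def by blast
  obtain j s where s: "s < n" "\<not> p dvd phi j s y" using y unfolding div_ideal_def by blast
  \<comment> \<open>Makes \<open>i + r + n + d\<close> congruent to \<open>j\<close> without
    subtraction. The two turns in \<open>z\<close> around the piece of length \<open>d\<close> close
    the sandwich of \<open>x\<close> and open that of \<open>y\<close>.\<close>
  define d where "d = j + (i + r) * (n - 1)"
  define z where "z = el (pth (i + r) (n + (d + n)))"
  have z: "z \<in> carrier A" by (simp add: z_def)
  have j: "pth (i + r + n + d) l = pth j l" for l
  proof (rule pth_cong)
    have "i + r + n + d = j + n * (i + r + 1)" using n_pos by (cases n) (auto simp: d_def algebra_simps)
    then show "(i + r + n + d) mod n = j mod n" by (simp only: mod_mult_self2)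
  qed
  have z_eq: "z = el (pth (i + r) n) \<otimes>\<^bsub>A\<^esub> (el (pth (i + r + n) d) \<otimes>\<^bsub>A\<^esub> el (pth j n))"
    unfolding z_def j[symmetric] el_pth_mult ..
  let ?c = "el (pth (i + r + n) d)"
  let ?L = "2 * n + r + (d + (2 * n + s))"
  have "x \<otimes>\<^bsub>A\<^esub> z \<otimes>\<^bsub>A\<^esub> y \<notin> div_ideal p"
  proof
    assume "x \<otimes>\<^bsub>A\<^esub> z \<otimes>\<^bsub>A\<^esub> y \<in> div_ideal p"
    then have "el (pth i n) \<otimes>\<^bsub>A\<^esub> (x \<otimes>\<^bsub>A\<^esub> z \<otimes>\<^bsub>A\<^esub> y) \<otimes>\<^bsub>A\<^esub> el (pth (j + s) n) \<in> div_ideal p"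
      by (rule D.I_r_closed[OF D.I_l_closed]) auto
    also have "el (pth i n) \<otimes>\<^bsub>A\<^esub> (x \<otimes>\<^bsub>A\<^esub> z \<otimes>\<^bsub>A\<^esub> y) \<otimes>\<^bsub>A\<^esub> el (pth (j + s) n) =
      (el (pth i n) \<otimes>\<^bsub>A\<^esub> x \<otimes>\<^bsub>A\<^esub> el (pth (i + r) n)) \<otimes>\<^bsub>A\<^esub> ?c \<otimes>\<^bsub>A\<^esub> (el (pth j n) \<otimes>\<^bsub>A\<^esub> y \<otimes>\<^bsub>A\<^esub> el (pth (j + s) n))"
      unfolding z_eq using x y by (simp add: A.m_assoc)
    also have "\<dots> = (el (pth i (2 * n + r)) \<otimes>\<^bsub>A\<^esub> pe (phi i r x)) \<otimes>\<^bsub>A\<^esub> ?c \<otimes>\<^bsub>A\<^esub> (el (pth j (2 * n + s)) \<otimes>\<^bsub>A\<^esub> pe (phi j s y))"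
      using sandwich x y r s by simp
    also have "\<dots> = (el (pth i (2 * n + r)) \<otimes>\<^bsub>A\<^esub> (pe (phi i r x) \<otimes>\<^bsub>A\<^esub> (?c \<otimes>\<^bsub>A\<^esub> el (pth j (2 * n + s))))) \<otimes>\<^bsub>A\<^esub> pe (phi j s y)"
      by (simp add: A.m_assoc)
    also have "pe (phi i r x) \<otimes>\<^bsub>A\<^esub> (?c \<otimes>\<^bsub>A\<^esub> el (pth j (2 * n + s))) = ?c \<otimes>\<^bsub>A\<^esub> el (pth j (2 * n + s)) \<otimes>\<^bsub>A\<^esub> pe (phi i r x)"
      by (rule pe_central) auto
    also have "(el (pth i (2 * n + r)) \<otimes>\<^bsub>A\<^esub> (?c \<otimes>\<^bsub>A\<^esub> el (pth j (2 * n + s)) \<otimes>\<^bsub>A\<^esub> pe (phi i r x))) \<otimes>\<^bsub>A\<^esub> pe (phi j s y)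
      = (el (pth i (2 * n + r)) \<otimes>\<^bsub>A\<^esub> (?c \<otimes>\<^bsub>A\<^esub> el (pth j (2 * n + s)))) \<otimes>\<^bsub>A\<^esub> (pe (phi i r x) \<otimes>\<^bsub>A\<^esub> pe (phi j s y))"
      by (simp add: A.m_assoc)
    also have "?c \<otimes>\<^bsub>A\<^esub> el (pth j (2 * n + s)) = el (pth (i + r + n) (d + (2 * n + s)))"
      unfolding j[symmetric] el_pth_mult ..
    also have "pth (i + r + n) (d + (2 * n + s)) = pth (i + (2 * n + r)) (d + (2 * n + s))"
    proof (rule pth_cong)
      have "i + (2 * n + r) = i + r + n + n" by simp
      then show "(i + r + n) mod n = (i + (2 * n + r)) mod n" by (simp only: mod_add_self2)
    qed
    also have "el (pth i (2 * n + r)) \<otimes>\<^bsub>A\<^esub> el (pth (i + (2 * n + r)) (d + (2 * n + s))) = el (pth i ?L)"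
      by (rule el_pth_mult)
    finally have "el (pth i ?L) \<otimes>\<^bsub>A\<^esub> pe (phi i r x * phi j s y) \<in> div_ideal p" by (simp add: pe_mult)
    then have "p dvd phi i (?L mod n) (el (pth i ?L) \<otimes>\<^bsub>A\<^esub> pe (phi i r x * phi j s y))"
      using n_pos unfolding div_ideal_def by simp
    also have "\<dots> = Polynomial.monom 1 (?L div n) * (phi i r x * phi j s y)"
      using n_pos by (subst phi_pe) (auto simp: phi_el_pth)
    finally show False using prime monom r s by metis
  qed
  then show "\<exists>z\<in>carrier A. x \<otimes>\<^bsub>A\<^esub> z \<otimes>\<^bsub>A\<^esub> y \<notin> div_ideal p" using z by blast
qed

lemma ann_ideal_prime: "nc_prime_ideal A (ann_ideal Q I gam)"
  using div_ideal_prime[of 0] ann_ideal_ideal unfolding ann_ideal_div by simp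

lemma poly_ideal_prime:
  assumes p: "Factorial_Ring.irreducible p" "poly p 0 \<noteq> 0"
  shows "nc_prime_ideal A (poly_ideal Q I gam p)"
  unfolding poly_ideal_div[OF p(2)]
proof (rule div_ideal_prime)
  show "ideal (div_ideal p) A" using poly_ideal_ideal[of p] poly_ideal_div[OF p(2)] by simp
  have pp: "prime_elem p" using p(1) by (rule field_poly_irreducible_imp_prime)
  show "p dvd f \<or> p dvd g" if "p dvd f * g" for f g using prime_elem_dvd_multD[OF pp that] .
  show "\<not> p dvd [:0, 1:]" by (rule not_dvd_var[OF p])
qed

end

section \<open>Classification of the prime ideals\<close>

text \<open>A root at 0 splits off the factor t, irreducibility makes the cofactor constant, and the
  leading coefficient makes it 1. This turns \<open>p \<noteq> [:0, 1:]\<close> into p(0) \<noteq> 0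
  for the last claim of the theorem.\<close>

lemma irreducible_monic_root_0:
  fixes p :: "'k::field poly"
  assumes p: "Factorial_Ring.irreducible p" "Polynomial.lead_coeff p = 1" "poly p 0 = 0"
  shows "p = [:0, 1:]"
proof -
  obtain q where q: "p = [:0, 1:] * q" using p(3) by (auto simp: poly_eq_0_iff_dvd elim: dvdE)
  have q0: "q \<noteq> 0" using p(1) q by auto
  have "\<not> is_unit ([:0, 1:] :: 'k poly)" by (subst is_unit_iff_degree) auto
  then have "is_unit q" using p(1) q unfolding Factorial_Ring.irreducible_def by blast
  then have "Polynomial.degree q = 0" using q0 is_unit_iff_degree by blast
  then obtain c where c: "q = [:c:]" by (rule degree_eq_zeroE)
  then show ?thesis using p(2) q q0 by simp
qed

lemma irreducible_nonzero: "Factorial_Ring.irreducible p \<Longrightarrow> p \<noteq> 0"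
  by (auto simp: Factorial_Ring.irreducible_def)

lemma irreducible_degree_pos:
  fixes p :: "'k::field poly"
  assumes "Factorial_Ring.irreducible p"
  shows "Polynomial.degree p \<ge> 1"
proof -
  have "p \<noteq> 0" "\<not> is_unit p" using assms by (auto simp: Factorial_Ring.irreducible_def)
  then show ?thesis using is_unit_iff_degree[of p] by (cases "Polynomial.degree p") auto
qed

text \<open>A smaller prime gives a chain of length one, and the last step of any chain of positive
  length exhibits a smaller prime.\<close>

lemma prime_height_0_iff:
  assumes P: "nc_prime_ideal R P"
  shows "prime_height R P = 0 \<longleftrightarrow> \<not> (\<exists>P'. nc_prime_ideal R P' \<and> P' \<subset> P)"
proof
  assume h: "prime_height R P = 0"
  show "\<not> (\<exists>P'. nc_prime_ideal R P' \<and> P' \<subset> P)"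
  proof
    assume "\<exists>P'. nc_prime_ideal R P' \<and> P' \<subset> P"
    then obtain P' where P': "nc_prime_ideal R P'" "P' \<subset> P" by blast
    define C where "C i = (if i = 0 then P' else P)" for i :: nat
    have "enat 1 \<in> {enat n | n. \<exists>C. (\<forall>i\<le>n. nc_prime_ideal R (C i)) \<and> (\<forall>i<n. C i \<subset> C (Suc i)) \<and> C n = P}"
      using P P' by (intro CollectI exI[of _ 1] conjI refl exI[of _ C]) (auto simp: C_def)
    then have "enat 1 \<le> prime_height R P" unfolding prime_height_def by (rule Sup_upper)
    then show False using h by (simp add: zero_enat_def)
  qed
next
  assume none: "\<not> (\<exists>P'. nc_prime_ideal R P' \<and> P' \<subset> P)"
  have "prime_height R P \<le> 0"
    unfolding prime_height_def
  proof (rule Sup_least)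
    fix x assume "x \<in> {enat n | n. \<exists>C. (\<forall>i\<le>n. nc_prime_ideal R (C i)) \<and> (\<forall>i<n. C i \<subset> C (Suc i)) \<and> C n = P}"
    then obtain n C where C: "x = enat n" "\<forall>i\<le>n. nc_prime_ideal R (C i)" "\<forall>i<n. C i \<subset> C (Suc i)" "C n = P" by auto
    have "n = 0"
    proof (rule ccontr)
      assume "n \<noteq> 0"
      then obtain k where "n = Suc k" by (cases n) auto
      then have "C k \<subset> P" "nc_prime_ideal R (C k)" using C by auto
      then show False using none by blast
    qed
    then show "x \<le> 0" using C(1) by (simp add: zero_enat_def)
  qed
  then show "prime_height R P = 0" by simp
qed

section \<open>Primes containing all arrows, and arrows outside a prime\<close>

context gentle_quiver
begin

text \<open>All nonstationary paths lie in \<open>P\<close>, but not all stationary ones, as 1 is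
  their sum. For \<open>w \<noteq> v\<close> only nonstationary paths lead from \<open>v\<close> to
  \<open>w\<close>, so primeness puts the stationary path at \<open>w\<close> into \<open>P\<close>
  once that at \<open>v\<close> is outside. Thus \<open>P\<close> contains a vertex ideal, and these
  are maximal.\<close>

lemma prime_containing_arrows:
  assumes P: "nc_prime_ideal A P" and arrows: "\<And>\<alpha>. \<alpha> \<in> arcs Q \<Longrightarrow> el (tail Q \<alpha>, [\<alpha>]) \<in> P"
  shows "\<exists>v\<in>verts Q. P = vertex_ideal Q I v"
proof -
  have id: "ideal P A" and ne: "P \<noteq> carrier A" using P by (auto simp: nc_prime_ideal_def)
  interpret P: ideal P A by (rule id)
  have pos: "el (u, as) \<in> P" if B: "(u, as) \<in> B" and ne: "as \<noteq> []" for u as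
  proof -
    obtain \<alpha> bs where as: "as = \<alpha> # bs" using ne by (cases as) auto
    have p: "\<alpha> \<in> arcs Q" "u = tail Q \<alpha>" "(head Q \<alpha>, bs) \<in> paths Q"
      using B_paths[OF B] by (auto simp: as mem_paths_Cons)
    have "el (u, [\<alpha>]) \<otimes>\<^bsub>A\<^esub> el (tgt Q u [\<alpha>], bs) \<in> P"
      using p arrows[OF p(1)] by (intro P.I_r_closed) auto
    then show ?thesis using p by (subst (asm) el_mult) (auto simp: as)
  qed
  have "\<exists>v\<in>verts Q. el (v, []) \<notin> P"
  proof (rule ccontr)
    assume "\<not> ?thesis"
    then have stat: "el (v, []) \<in> P" if "v \<in> verts Q" for v using that by blast
    have "\<one>\<^bsub>A\<^esub> \<in> P"
    proof (rule mem_ideal_if_support[OF id])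
      fix q assume q: "q \<in> B" "cf \<one>\<^bsub>A\<^esub> q \<noteq> 0"
      obtain u as where ua: "q = (u, as)" by (cases q)
      then show "el q \<in> P" using q stat by (auto simp: cf_one split: if_splits)
    qed simp
    then show False using ne P.one_imp_carrier by blast
  qed
  then obtain v where v: "v \<in> verts Q" "el (v, []) \<notin> P" by blast
  have other: "el (w, []) \<in> P" if w: "w \<in> verts Q" "w \<noteq> v" for w
  proof -
    have "el (v, []) \<otimes>\<^bsub>A\<^esub> z \<otimes>\<^bsub>A\<^esub> el (w, []) \<in> P" if z: "z \<in> carrier A" for z
    proof (rule mem_ideal_if_support[OF id])
      have [simp]: "el (v, []) \<in> carrier A" "el (w, []) \<in> carrier A" using v w by (auto intro!: el_closed)
      fix q assume q: "q \<in> B" "cf (el (v, []) \<otimes>\<^bsub>A\<^esub> z \<otimes>\<^bsub>A\<^esub> el (w, [])) q \<noteq> 0"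
      obtain u as where ua: "q = (u, as)" by (cases q)
      have "as \<noteq> []"
      proof
        assume "as = []"
        then show False using q v w z by (simp add: ua cf_mult cf_el split: if_splits del: quot_closed)
      qed
      then show "el q \<in> P" using pos q ua by blast
    next
      show "el (v, []) \<otimes>\<^bsub>A\<^esub> z \<otimes>\<^bsub>A\<^esub> el (w, []) \<in> carrier A"
        using v w z by (intro A.m_closed el_closed) auto
    qed
    then show ?thesis using A.nc_prime_idealD[OF P, of "el (v, [])" "el (w, [])"] v w by auto
  qed
  have "vertex_ideal Q I v \<subseteq> P"
  proof
    fix x assume "x \<in> vertex_ideal Q I v"
    then have x: "x \<in> carrier A" "cf x (v, []) = 0" using v by (auto simp: vertex_ideal_eq)
    show "x \<in> P"
    proof (rule mem_ideal_if_support[OF id x(1)])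
      fix q assume q: "q \<in> B" "cf x q \<noteq> 0"
      obtain u as where ua: "q = (u, as)" by (cases q)
      show "el q \<in> P"
      proof (cases "as = []")
        case True
        then show ?thesis using other[of u] q x ua by auto
      qed (use pos q ua in auto)
    qed
  qed
  then show ?thesis using vertex_ideal_maximal[OF v(1) id ne] v(1) by blast
qed

lemma prime_not_containing_arrow:
  assumes P: "nc_prime_ideal A P" and \<alpha>: "\<alpha> \<in> arcs Q" "el (tail Q \<alpha>, [\<alpha>]) \<notin> P"
  shows "\<exists>a n. gentle_cycle Q I a n \<and> a 0 = \<alpha>"
proof -
  let ?e = "el (tail Q \<alpha>, [\<alpha>])"
  have id: "ideal P A" using P by (auto simp: nc_prime_ideal_def)
  have p: "(tail Q \<alpha>, [\<alpha>]) \<in> paths Q" using \<alpha> by simp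
  then have e: "?e \<in> carrier A" by (rule el_closed)
  obtain z where z: "z \<in> carrier A" "?e \<otimes>\<^bsub>A\<^esub> z \<otimes>\<^bsub>A\<^esub> ?e \<notin> P"
    using A.nc_prime_idealD[OF P e e] \<alpha>(2) by blast
  then obtain q where q: "q \<in> B" "cf (?e \<otimes>\<^bsub>A\<^esub> z \<otimes>\<^bsub>A\<^esub> ?e) q \<noteq> 0"
    using mem_ideal_if_support[OF id, of "?e \<otimes>\<^bsub>A\<^esub> z \<otimes>\<^bsub>A\<^esub> ?e"] e by blast
  obtain u as where ua: "q = (u, as)" by (cases q)
  obtain cs where cs: "as = cs @ [\<alpha>]" "cf (?e \<otimes>\<^bsub>A\<^esub> z) (u, cs) \<noteq> 0"
    using q ua cf_mult_el[OF A.m_closed[OF e z(1)] p, of u as] by (auto split: if_splits)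
  have B: "(u, cs) \<in> B" using q(1) by (simp add: ua cs(1) B_append)
  \<comment> \<open>What remains after removing the final \<alpha> still begins with \<alpha>, so
    the two occurrences are different and \<alpha> truly recurs.\<close>
  obtain ds where "cs = [\<alpha>] @ ds" using cs(2) cf_el_mult[OF z(1) p B] by (auto split: if_splits)
  then have "successively good (\<alpha> # ds @ [\<alpha>])" using q(1) by (simp add: ua cs(1) B_iff)
  then show ?thesis by (rule cycle_through)
qed

end

section \<open>A prime ideal that avoids an arrow of the cycle\<close>

context gentle_cycle
begin

context
  fixes P assumes P: "nc_prime_ideal A P" and start: "el (pth 0 1) \<notin> P"
begin

lemma P_ideal: "ideal P A" using P by (simp add: nc_prime_ideal_def)

interpretation P: ideal P A by (rule P_ideal)

lemma ann_subset_prime: "ann_ideal Q I gam \<subseteq> P"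
proof
  fix x assume x: "x \<in> ann_ideal Q I gam"
  have p: "(tail Q (a 0), [a 0]) \<in> paths Q" by simp
  have pth01: "pth 0 1 = (tail Q (a 0), [a 0])" by (simp add: cycle_path_def)
  show "x \<in> P"
  proof (rule mem_ideal_if_support[OF P_ideal])
    show "x \<in> carrier A" using x by (simp add: ann_ideal_eq)
    fix q assume q: "q \<in> B" "cf x q \<noteq> 0"
    obtain w bs where wb: "q = (w, bs)" by (cases q)
    have qp: "(w, bs) \<in> paths Q" using B_paths q wb by blast
    have "el (pth 0 1) \<otimes>\<^bsub>A\<^esub> z \<otimes>\<^bsub>A\<^esub> el q \<in> P" if z: "z \<in> carrier A" for z
    proof (rule mem_ideal_if_support[OF P_ideal])
      show "el (pth 0 1) \<otimes>\<^bsub>A\<^esub> z \<otimes>\<^bsub>A\<^esub> el q \<in> carrier A" using z qp wb by (intro A.m_closed) (auto intro!: el_closed)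
      fix q' assume q': "q' \<in> B" "cf (el (pth 0 1) \<otimes>\<^bsub>A\<^esub> z \<otimes>\<^bsub>A\<^esub> el q) q' \<noteq> 0"
      obtain u as where ua: "q' = (u, as)" by (cases q')
      have ez: "el (pth 0 1) \<otimes>\<^bsub>A\<^esub> z \<in> carrier A" using z by auto
      obtain cs where cs: "as = cs @ bs" "tgt Q u cs = w" "cf (el (pth 0 1) \<otimes>\<^bsub>A\<^esub> z) (u, cs) \<noteq> 0"
        using q' cf_mult_el[OF ez qp, of u as] by (auto simp: ua wb split: if_splits)
      have B: "(u, cs) \<in> B" using q'(1) by (simp add: ua cs(1) B_append)
      obtain ds where "cs = [a 0] @ ds" using cs(3) cf_el_mult[OF z p B] unfolding pth01 by (auto split: if_splits)
      then have "a 0 \<in> set cs" "length cs > 0" by auto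
      then obtain i where i: "(u, cs) = pth i (length cs)" using basis_path_in_cycle[OF B] by blast
      \<comment> \<open>A path beginning with \<open>a 0\<close> runs along the cycle, and so does
        its suffix \<open>q\<close>, where \<open>x\<close> has no coefficient. So no
        \<open>q'\<close> of this kind exists and the product is in fact zero.\<close>
      then obtain j where "(tgt Q u cs, bs) = pth j (length bs)"
        using basis_path_in_cycle_suffix[of u cs bs, OF _ i \<open>length cs > 0\<close>] q'(1) by (auto simp: ua cs(1))
      then show "el q' \<in> P" using q(2) x by (simp add: ann_ideal_eq wb cs(2))
    qed
    then show "el q \<in> P" using A.nc_prime_idealD[OF P el_pth_closed el_closed[OF qp], of 0 1] start wb by blast
  qed
qed

lemma cycle_span_in_P:
  assumes x: "x \<in> cycle_span" and "\<And>i l. \<lbrakk>l > 0; cf x (pth i l) \<noteq> 0\<rbrakk> \<Longrightarrow> el (pth i l) \<in> P"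
  shows "x \<in> P"
proof (rule mem_ideal_if_support[OF P_ideal])
  show "x \<in> carrier A" using x by (simp add: cycle_span_def)
  fix q assume q: "q \<in> B" "cf x q \<noteq> 0"
  then obtain i l where "q = pth i l" "l > 0" using x unfolding cycle_span_def by blast
  then show "el q \<in> P" using assms(2) q by blast
qed

text \<open>If a path of the cycle were in \<open>P\<close>, so would be all long ones; then descend on the
  length of the paths starting at arrow \<open>0\<close>, using that \<open>x A x\<close> contains only longer paths.\<close>

lemma el_pth_notin_P:
  assumes L: "L > 0"
  shows "el (pth i L) \<notin> P"
proof
  assume iL: "el (pth i L) \<in> P"
  have big: "el (pth j l) \<in> P" if "l \<ge> n + L" for j l
  proof -
    \<comment> \<open>The offset below \<open>n\<close> for which \<open>j + t\<close> is congruent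
      to \<open>i\<close>: a path of length at least \<open>n + L\<close> contains
      \<open>pth i L\<close> as a factor.\<close>
    define t where "t = (i + (n - 1) * j) mod n"
    have t: "t < n" using n_pos by (simp add: t_def)
    have "(j + t) mod n = (j + (i + (n - 1) * j)) mod n" unfolding t_def by (rule mod_add_right_eq)
    also have "j + (i + (n - 1) * j) = i + n * j" using n_pos by (cases n) auto
    finally have "pth (j + t) L = pth i L" by (intro pth_cong) simp
    then have "el (pth j t) \<otimes>\<^bsub>A\<^esub> (el (pth (j + t) L) \<otimes>\<^bsub>A\<^esub> el (pth (j + t + L) (l - t - L))) \<in> P"
      using iL by (intro P.I_l_closed P.I_r_closed) auto
    then show ?thesis unfolding el_pth_mult using that t by simp
  qed
  have descent: "\<not> (\<forall>l\<ge>Suc M. el (pth 0 l) \<in> P)" for M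
  proof (induction M)
    case 0
    then show ?case using start by auto
  next
    case (Suc M)
    show ?case
    proof
      assume all: "\<forall>l\<ge>Suc (Suc M). el (pth 0 l) \<in> P"
      let ?e = "el (pth 0 (Suc M))"
      have "?e \<otimes>\<^bsub>A\<^esub> z \<otimes>\<^bsub>A\<^esub> ?e \<in> P" if z: "z \<in> carrier A" for z
      proof (rule cycle_span_in_P)
        show "?e \<otimes>\<^bsub>A\<^esub> z \<otimes>\<^bsub>A\<^esub> ?e \<in> cycle_span"
          using z by (intro ideal.I_l_closed[OF cycle_span_ideal] el_pth_in_span) auto
        fix i l assume "cf (?e \<otimes>\<^bsub>A\<^esub> z \<otimes>\<^bsub>A\<^esub> ?e) (pth i l) \<noteq> 0"
        \<comment> \<open>The path contains two disjoint copies of length \<open>Suc M\<close>, so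
          \<open>l\<close> is at least \<open>2 * Suc M\<close>, hence at least
          \<open>Suc (Suc M)\<close>.\<close>
        then have "Suc M \<le> l - Suc M" "i mod n = 0 mod n"
          using z by (auto simp: cf_mult_el_pth cf_el_pth_mult split: if_splits)
        moreover from this(2) have "pth i l = pth 0 l" by (rule pth_cong)
        ultimately show "el (pth i l) \<in> P" using all by auto
      qed
      then have "?e \<in> P" using A.nc_prime_idealD[OF P, of ?e ?e] by auto
      then have "\<forall>l\<ge>Suc M. el (pth 0 l) \<in> P" using all by (metis le_antisym not_less_eq_eq)
      then show False using Suc by blast
    qed
  qed
  show False using descent[of "n + L"] big by auto
qed

text \<open>The first arrow times \<open>m\<close> is the path of length \<open>1 + n\<close>, which
  is already known to lie outside \<open>P\<close>.\<close>

lemma m_notin_P: "m \<notin> P"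
proof
  assume "m \<in> P"
  then have "el (pth 0 1) \<otimes>\<^bsub>A\<^esub> m \<in> P" by (intro P.I_l_closed) auto
  also have "el (pth 0 1) \<otimes>\<^bsub>A\<^esub> m = el (pth 0 (1 + n))"
  proof (rule cycle_span_eqI)
    show "el (pth 0 1) \<otimes>\<^bsub>A\<^esub> m \<in> cycle_span"
      by (intro ideal.I_r_closed[OF cycle_span_ideal] el_pth_in_span) auto
    fix i l
    show "cf (el (pth 0 1) \<otimes>\<^bsub>A\<^esub> m) (pth i l) = cf (el (pth 0 (1 + n))) (pth i l)"
      using pth_eq_iff[of 1 0 i "l - n"] pth_eq_iff[of "1 + n" 0 i l] by (auto simp: cf_mult_m cf_el)
  qed (auto intro: el_pth_in_span)
  finally show False using el_pth_notin_P[of "1 + n" 0] by simp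
qed

text \<open>As p(m) is central, a single product in \<open>P\<close> yields all products with an
  element in between, and primeness applies. It removes the path that \<open>sandwich\<close> leaves
  in front of the polynomial.\<close>

lemma pe_cancel: "\<lbrakk>L > 0; el (pth i L) \<otimes>\<^bsub>A\<^esub> pe f \<in> P\<rbrakk> \<Longrightarrow> pe f \<in> P"
proof -
  assume L: "L > 0" and P': "el (pth i L) \<otimes>\<^bsub>A\<^esub> pe f \<in> P"
  have "el (pth i L) \<otimes>\<^bsub>A\<^esub> z \<otimes>\<^bsub>A\<^esub> pe f \<in> P" if z: "z \<in> carrier A" for z
  proof -
    have "el (pth i L) \<otimes>\<^bsub>A\<^esub> z \<otimes>\<^bsub>A\<^esub> pe f = el (pth i L) \<otimes>\<^bsub>A\<^esub> pe f \<otimes>\<^bsub>A\<^esub> z"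
      using z by (simp add: A.m_assoc pe_central)
    then show ?thesis using P' z P.I_r_closed by simp
  qed
  then show "pe f \<in> P" using A.nc_prime_idealD[OF P, of "el (pth i L)" "pe f"] el_pth_notin_P[OF L] by auto
qed

text \<open>The preimage of \<open>P\<close> under evaluation is a prime ideal of the polynomial
  ring because the values are central; an element of least degree generates it by division with
  remainder. It does not contain t since \<open>m\<close> is outside \<open>P\<close>, hence p(0)
  \<noteq> 0.\<close>

lemma pe_generator:
  "\<exists>p. (\<forall>f. pe f \<in> P \<longleftrightarrow> p dvd f) \<and> (p = 0 \<or> Factorial_Ring.irreducible p \<and> poly p 0 \<noteq> 0)"
proof (cases "\<exists>f. f \<noteq> 0 \<and> pe f \<in> P")
  case False
  then have "\<forall>f. pe f \<in> P \<longleftrightarrow> 0 dvd f" using P.zero_closed by (auto simp: pe_0)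
  then show ?thesis by blast
next
  case True
  then obtain p where p: "p \<noteq> 0" "pe p \<in> P" and
    min: "\<And>f. f \<noteq> 0 \<Longrightarrow> pe f \<in> P \<Longrightarrow> Polynomial.degree p \<le> Polynomial.degree f"
    using ex_has_least_nat[of "\<lambda>f. f \<noteq> 0 \<and> pe f \<in> P" _ Polynomial.degree] by blast
  have mult: "pe (g * f) \<in> P" if "pe f \<in> P" for f g
    unfolding pe_mult using that by (intro P.I_l_closed) auto
  have dvd: "pe f \<in> P \<longleftrightarrow> p dvd f" for f
  proof
    assume f: "pe f \<in> P"
    have "pe (f + (- (f div p)) * p) \<in> P"
      unfolding pe_add by (intro P.a_closed f mult p)
    moreover have "f + (- (f div p)) * p = f mod p" by (simp add: minus_div_mult_eq_mod[symmetric])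
    ultimately have "f mod p = 0"
      using min[of "f mod p"] degree_mod_less[OF p(1), of f] by fastforce
    then show "p dvd f" by (simp add: mod_eq_0_iff_dvd)
  next
    assume "p dvd f"
    then obtain g where "f = p * g" by (rule dvdE)
    then show "pe f \<in> P" using mult[OF p(2), of g] by (simp add: mult.commute)
  qed
  have prime: "p dvd f \<or> p dvd g" if "p dvd f * g" for f g
  proof -
    have "pe f \<otimes>\<^bsub>A\<^esub> z \<otimes>\<^bsub>A\<^esub> pe g \<in> P" if z: "z \<in> carrier A" for z
    proof -
      have "pe f \<otimes>\<^bsub>A\<^esub> z \<otimes>\<^bsub>A\<^esub> pe g = z \<otimes>\<^bsub>A\<^esub> pe (f * g)"
        using z by (simp add: pe_central[OF z] pe_mult A.m_assoc)
      then show ?thesis using \<open>p dvd f * g\<close> dvd z P.I_l_closed by simp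
    qed
    then show ?thesis using A.nc_prime_idealD[OF P, of "pe f" "pe g"] dvd by auto
  qed
  have "\<not> is_unit p"
    using dvd[of 1] P P.one_imp_carrier by (auto simp: pe_1 nc_prime_ideal_def)
  then have "prime_elem p" using p(1) prime by (intro prime_elemI)
  then have irr: "Factorial_Ring.irreducible p" by (rule prime_elem_imp_irreducible)
  have "poly p 0 \<noteq> 0"
  proof
    assume "poly p 0 = 0"
    then have "[:0, 1:] dvd p" by (simp add: poly_eq_0_iff_dvd)
    then obtain q where q: "p = [:0, 1:] * q" by (rule dvdE)
    have "\<not> p dvd [:0, 1:]" using dvd[of "[:0, 1:]"] m_notin_P by (simp add: pe_var)
    then have "p dvd q" using prime[of "[:0, 1:]" q] q by simp
    moreover have "q \<noteq> 0" using p(1) q by auto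
    ultimately have "Polynomial.degree p \<le> Polynomial.degree q" by (rule dvd_imp_degree_le)
    then show False using q \<open>q \<noteq> 0\<close> by simp
  qed
  then show ?thesis using dvd irr by blast
qed

text \<open>Sandwiching an element of \<open>P\<close> shows that its entries evaluate into
  \<open>P\<close>, so \<open>P\<close> lies in \<open>div_ideal p\<close>. In the other direction
  \<open>P\<close> contains the annihilator and p(m), which generate that ideal.\<close>

lemma prime_over_cycle:
  "P = ann_ideal Q I gam \<or>
    (\<exists>p. Factorial_Ring.irreducible p \<and> poly p 0 \<noteq> 0 \<and> P = poly_ideal Q I gam p)"
proof -
  obtain p where dvd: "\<And>f. pe f \<in> P \<longleftrightarrow> p dvd f"
    and p: "p = 0 \<or> Factorial_Ring.irreducible p \<and> poly p 0 \<noteq> 0"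
    using pe_generator by blast
  have sub: "P \<subseteq> div_ideal p"
  proof
    fix x assume x: "x \<in> P"
    then have xc: "x \<in> carrier A" by (rule P.Icarr)
    have "p dvd phi i r x" if r: "r < n" for i r
    proof -
      have "el (pth i n) \<otimes>\<^bsub>A\<^esub> x \<otimes>\<^bsub>A\<^esub> el (pth (i + r) n) \<in> P"
        by (rule P.I_r_closed[OF P.I_l_closed[OF x]]) auto
      then have "pe (phi i r x) \<in> P"
        unfolding sandwich[OF xc r] using n_pos by (intro pe_cancel[of "2 * n + r" i]) auto
      then show ?thesis using dvd by blast
    qed
    then show "x \<in> div_ideal p" using xc by (simp add: div_ideal_def)
  qed
  show ?thesis
    using p
  proof
    assume "p = 0"
    then show ?thesis using sub ann_subset_prime unfolding ann_ideal_div by blast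
  next
    assume p: "Factorial_Ring.irreducible p \<and> poly p 0 \<noteq> 0"
    have "Idl\<^bsub>A\<^esub> {pe p} \<subseteq> P" using dvd[of p] by (intro A.genideal_minimal[OF P_ideal]) simp
    then have "poly_ideal Q I gam p \<subseteq> P"
      using ann_subset_prime P.a_closed unfolding poly_ideal_def set_add_def' by blast
    then have "P = poly_ideal Q I gam p" using sub poly_ideal_div p by blast
    then show ?thesis using p by blast
  qed
qed

end

section \<open>Inclusions and witnesses against inclusions\<close>

lemma ann_psubset_poly_ideal:
  assumes "p \<noteq> 0"
  shows "ann_ideal Q I gam \<subset> poly_ideal Q I gam p"
proof -
  \<comment> \<open>p(m) itself separates the ideals: its entry at (0, 0) is p.\<close>
  have "phi 0 0 (pe p) = p" using phi_pe[of "\<one>\<^bsub>A\<^esub>" 0 0 p] n_pos by (simp add: phi_one)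
  then have "\<not> 0 dvd phi 0 0 (pe p)" using assms by simp
  then have "pe p \<notin> ann_ideal Q I gam" using n_pos unfolding ann_ideal_div div_ideal_def by blast
  then show ?thesis using pe_in_poly_ideal ann_subset_poly_ideal by blast
qed

text \<open>The stationary path at \<open>v\<close> belongs to the cycle as \<open>pth i 0\<close>,
  which gives the inclusion; the arrow of the cycle leaving \<open>v\<close> shows that it is
  strict.\<close>

lemma ann_psubset_vertex_ideal:
  assumes v: "passes_through Q gam v"
  shows "ann_ideal Q I gam \<subset> vertex_ideal Q I v"
proof -
  obtain i where i: "v = tail Q (a i)" using v passes_through_gam by blast
  then have vv: "v \<in> verts Q" by simp
  have 0: "(v, []) = pth i 0" by (simp add: i cycle_path_def)
  have "ann_ideal Q I gam \<subseteq> vertex_ideal Q I v" using vv unfolding vertex_ideal_eq[OF vv] ann_ideal_eq 0 by auto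
  moreover have "el (pth i 1) \<in> vertex_ideal Q I v"
    unfolding vertex_ideal_eq[OF vv] 0 using pth_length_eq by (auto simp: cf_el simp del: quot_closed)
  moreover have "el (pth i 1) \<notin> ann_ideal Q I gam"
  proof
    assume "el (pth i 1) \<in> ann_ideal Q I gam"
    then have "cf (el (pth i 1)) (pth i 1) = 0" unfolding ann_ideal_eq by blast
    then show False by (simp add: cf_el)
  qed
  ultimately show ?thesis by blast
qed

lemma ann_not_subset_vertex_ideal:
  assumes "v \<in> verts Q" "\<not> passes_through Q gam v"
  shows "\<not> ann_ideal Q I gam \<subseteq> vertex_ideal Q I v"
proof -
  have "(v, []) \<noteq> pth i l" for i l using assms(2) passes_through_gam by (auto simp: cycle_path_def)
  then have "el (v, []) \<in> ann_ideal Q I gam"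
    using assms(1) unfolding ann_ideal_eq by (auto simp: cf_el intro!: el_closed simp del: quot_closed)
  moreover have "el (v, []) \<notin> vertex_ideal Q I v"
    using assms(1) by (simp add: vertex_ideal_eq cf_el)
  ultimately show ?thesis by blast
qed

text \<open>The witness is \<open>m\<close>: it has no stationary terms, but an entry equal to t,
  which \<open>p\<close> does not divide.\<close>

lemma vertex_ideal_not_subset_poly_ideal:
  assumes v: "v \<in> verts Q" and p: "Factorial_Ring.irreducible p" "poly p 0 \<noteq> 0"
  shows "\<not> vertex_ideal Q I v \<subseteq> poly_ideal Q I gam p"
proof -
  have "m \<in> vertex_ideal Q I v"
    using v n_pos unfolding vertex_ideal_eq[OF v] by (auto simp: cf_m cycle_path_def)
  moreover have "phi 0 0 m = [:0, 1:]"
    using phi_m[of "\<one>\<^bsub>A\<^esub>" 0 0] n_pos by (simp add: phi_one one_pCons)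
  then have "m \<notin> poly_ideal Q I gam p"
    using not_dvd_var[OF p] n_pos unfolding poly_ideal_div[OF p(2)] div_ideal_def mem_Collect_eq by metis
  ultimately show ?thesis by blast
qed

text \<open>The witness is p(m), whose coefficient at the stationary path of \<open>v\<close> is
  p(0).\<close>

lemma poly_ideal_not_subset_vertex_ideal:
  assumes v: "v \<in> verts Q" and p: "poly p 0 \<noteq> 0"
  shows "\<not> poly_ideal Q I gam p \<subseteq> vertex_ideal Q I v"
proof -
  obtain c f where cf: "p = pCons c f" by (cases p)
  have m0: "cf m (v, []) = 0" using v n_pos by (auto simp: cf_m cycle_path_def)
  have "cf (pe p) (v, []) = c"
    using v m0 by (simp add: cf pe_pCons cf_add cf_mult cf_sc del: quot_closed)
  then have "pe p \<notin> vertex_ideal Q I v" using p v by (simp add: cf vertex_ideal_eq)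
  then show ?thesis using pe_in_poly_ideal by blast
qed

text \<open>Together with \<open>ann_arrow\<close> this recovers the arrows of the cycle, and
  thereby the maximal path, from the annihilator.\<close>

lemma ann_contains_other_arrows:
  assumes \<alpha>: "\<alpha> \<in> arcs Q" "\<alpha> \<notin> range a"
  shows "el (tail Q \<alpha>, [\<alpha>]) \<in> ann_ideal Q I gam"
proof -
  have "(tail Q \<alpha>, [\<alpha>]) \<noteq> pth i l" for i l
  proof
    assume e: "(tail Q \<alpha>, [\<alpha>]) = pth i l"
    then have "set [\<alpha>] = set (map a [i..<i + l])" by (simp add: cycle_path_def)
    then show False using \<alpha>(2) by auto
  qed
  then show ?thesis
    using \<alpha>(1) unfolding ann_ideal_eq by (auto simp: cf_el intro!: el_closed simp del: quot_closed)
qed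

lemma ann_arrow: "el (tail Q (a i), [a i]) \<notin> ann_ideal Q I gam"
proof
  assume *: "el (tail Q (a i), [a i]) \<in> ann_ideal Q I gam"
  have "(tail Q (a i), [a i]) = pth i 1" by (simp add: cycle_path_def)
  then have "cf (el (pth i 1)) (pth i 1) = 0" using * unfolding ann_ideal_eq by simp
  then show False by (simp add: cf_el)
qed

end

section \<open>Assembly of the classification, the prime ring criterion and the primes of height
  zero\<close>

context gentle_quiver
begin

lemma ann_ideal_inj:
  assumes \<gamma>: "\<gamma> \<in> infinite_max_paths Q I" and \<delta>: "\<delta> \<in> infinite_max_paths Q I"
    and sub: "ann_ideal Q I \<gamma> \<subseteq> ann_ideal Q I \<delta>"
  shows "\<gamma> = \<delta>"
proof -
  obtain a n where c: "gentle_cycle Q I a n" "\<gamma> = cycle_max_path Q a n"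
    using \<gamma> unfolding infinite_max_paths_iff by blast
  obtain b k where d: "gentle_cycle Q I b k" "\<delta> = cycle_max_path Q b k"
    using \<delta> unfolding infinite_max_paths_iff by blast
  interpret c: gentle_cycle Q I a n by (rule c(1))
  interpret d: gentle_cycle Q I b k by (rule d(1))
  have "el (tail Q (b 0), [b 0]) \<notin> ann_ideal Q I \<gamma>" using d.ann_arrow[of 0] sub d(2) by blast
  then have "b 0 \<in> range a" using c.ann_contains_other_arrows[of "b 0"] c(2) by auto
  then have "max_path_of Q I (b 0) = \<gamma>" using c.max_path_of_gam c(2) by simp
  moreover have "max_path_of Q I (b 0) = \<delta>" using d.max_path_of_gam d(2) by simp
  ultimately show ?thesis by simp
qed

lemma prime_ideals_iff:
  "nc_prime_ideal A P \<longleftrightarrow> (\<exists>v\<in>verts Q. P = vertex_ideal Q I v) \<or>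
     (\<exists>\<gamma>\<in>infinite_max_paths Q I. P = ann_ideal Q I \<gamma>) \<or>
     (\<exists>\<gamma>\<in>infinite_max_paths Q I. \<exists>p. Factorial_Ring.irreducible p \<and> poly p 0 \<noteq> 0 \<and> P = poly_ideal Q I \<gamma> p)"
    (is "_ \<longleftrightarrow> ?R")
proof
  assume P: "nc_prime_ideal A P"
  show ?R
  proof (cases "\<forall>\<alpha>\<in>arcs Q. el (tail Q \<alpha>, [\<alpha>]) \<in> P")
    case True
    then show ?thesis using prime_containing_arrows[OF P] by blast
  next
    case False
    then obtain \<alpha> where \<alpha>: "\<alpha> \<in> arcs Q" "el (tail Q \<alpha>, [\<alpha>]) \<notin> P" by blast
    then obtain a n where c: "gentle_cycle Q I a n" "a 0 = \<alpha>" using prime_not_containing_arrow[OF P] by blast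
    interpret gentle_cycle Q I a n by (rule c(1))
    have "pth 0 1 = (tail Q \<alpha>, [\<alpha>])" by (simp add: cycle_path_def c(2))
    then show ?thesis using prime_over_cycle[OF P] \<alpha>(2) gam_infinite by auto
  qed
next
  assume ?R
  then consider (vertex) v where "v \<in> verts Q" "P = vertex_ideal Q I v"
    | (ann) \<gamma> where "\<gamma> \<in> infinite_max_paths Q I" "P = ann_ideal Q I \<gamma>"
    | (poly) \<gamma> p where "\<gamma> \<in> infinite_max_paths Q I" "Factorial_Ring.irreducible p" "poly p 0 \<noteq> 0" "P = poly_ideal Q I \<gamma> p"
    by blast
  then show "nc_prime_ideal A P"
  proof cases
    case vertex
    then show ?thesis using vertex_ideal_prime by simp
  next
    case ann
    then obtain a n where c: "gentle_cycle Q I a n" "\<gamma> = cycle_max_path Q a n"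
      unfolding infinite_max_paths_iff by blast
    then show ?thesis using gentle_cycle.ann_ideal_prime ann by metis
  next
    case poly
    then obtain a n where c: "gentle_cycle Q I a n" "\<gamma> = cycle_max_path Q a n"
      unfolding infinite_max_paths_iff by blast
    then show ?thesis using gentle_cycle.poly_ideal_prime[OF c(1)] poly by simp
  qed
qed

lemma ann_psubset_poly:
  "\<lbrakk>\<gamma> \<in> infinite_max_paths Q I; p \<noteq> 0\<rbrakk> \<Longrightarrow> ann_ideal Q I \<gamma> \<subset> poly_ideal Q I \<gamma> p"
  unfolding infinite_max_paths_iff using gentle_cycle.ann_psubset_poly_ideal by metis

lemma ann_subset_vertex_iff:
  assumes \<gamma>: "\<gamma> \<in> infinite_max_paths Q I" and v: "v \<in> verts Q"
  shows "ann_ideal Q I \<gamma> \<subseteq> vertex_ideal Q I v \<longleftrightarrow> passes_through Q \<gamma> v"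
    and "passes_through Q \<gamma> v \<Longrightarrow> ann_ideal Q I \<gamma> \<subset> vertex_ideal Q I v"
proof -
  obtain a n where c: "gentle_cycle Q I a n" "\<gamma> = cycle_max_path Q a n"
    using \<gamma> unfolding infinite_max_paths_iff by blast
  interpret gentle_cycle Q I a n by (rule c(1))
  show "ann_ideal Q I \<gamma> \<subseteq> vertex_ideal Q I v \<longleftrightarrow> passes_through Q \<gamma> v"
    "passes_through Q \<gamma> v \<Longrightarrow> ann_ideal Q I \<gamma> \<subset> vertex_ideal Q I v"
    using ann_psubset_vertex_ideal[of v] ann_not_subset_vertex_ideal[OF v] unfolding c(2) by blast+
qed

lemma el_arrow_nonzero: "\<alpha> \<in> arcs Q \<Longrightarrow> el (tail Q \<alpha>, [\<alpha>]) \<noteq> \<zero>\<^bsub>A\<^esub>"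
  using cf_el[of "(tail Q \<alpha>, [\<alpha>])" "(tail Q \<alpha>, [\<alpha>])"] by (metis B_single cf_zero B_paths zero_neq_one)

text \<open>By the classification a prime zero ideal must be an annihilator: a vertex ideal contains
  every arrow, and the ideals of polynomials properly contain annihilators. An annihilator that is
  zero leaves no arrow off its cycle. Conversely, if \<gamma> is the only maximal path, every basis
  path runs along it and its annihilator is zero.\<close>

lemma prime_ring_iff:
  "nc_prime_ring A \<longleftrightarrow> (\<exists>\<gamma>. max_paths Q I = {\<gamma>} \<and> \<gamma> \<in> infinite_max_paths Q I)"
proof
  assume "nc_prime_ring A"
  then have "nc_prime_ideal A {\<zero>\<^bsub>A\<^esub>}" by (simp add: nc_prime_ring_def)
  then consider (vertex) v where "v \<in> verts Q" "{\<zero>\<^bsub>A\<^esub>} = vertex_ideal Q I v"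
    | (ann) \<gamma> where "\<gamma> \<in> infinite_max_paths Q I" "{\<zero>\<^bsub>A\<^esub>} = ann_ideal Q I \<gamma>"
    | (poly) \<gamma> p where "\<gamma> \<in> infinite_max_paths Q I" "Factorial_Ring.irreducible p" "{\<zero>\<^bsub>A\<^esub>} = poly_ideal Q I \<gamma> p"
    unfolding prime_ideals_iff by blast
  then show "\<exists>\<gamma>. max_paths Q I = {\<gamma>} \<and> \<gamma> \<in> infinite_max_paths Q I"
  proof cases
    case vertex
    obtain \<alpha> where \<alpha>: "\<alpha> \<in> arcs Q" using quiver by (auto simp: quiver_def)
    have "el (tail Q \<alpha>, [\<alpha>]) \<in> vertex_ideal Q I v"
      using \<alpha> vertex(1) by (auto simp: vertex_ideal_eq cf_el intro!: el_closed simp del: quot_closed)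
    then show ?thesis using el_arrow_nonzero[OF \<alpha>] vertex(2) by blast
  next
    case ann
    then obtain a n where c: "gentle_cycle Q I a n" "\<gamma> = cycle_max_path Q a n"
      unfolding infinite_max_paths_iff by blast
    interpret gentle_cycle Q I a n by (rule c(1))
    have "\<delta> = \<gamma>" if \<delta>: "\<delta> \<in> max_paths Q I" for \<delta>
    proof -
      obtain \<alpha> where \<alpha>: "\<alpha> \<in> arcs Q" "max_path_of Q I \<alpha> = \<delta>" using max_path_has_arrow[OF \<delta>] by blast
      have "\<alpha> \<in> range a"
        using ann_contains_other_arrows[OF \<alpha>(1)] el_arrow_nonzero[OF \<alpha>(1)] ann(2) c(2) by blast
      then show ?thesis using max_path_of_gam[OF \<alpha>(1)] \<alpha>(2) c(2) by simp
    qed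
    then have "max_paths Q I = {\<gamma>}" using gam_max c(2) by blast
    then show ?thesis using ann(1) by blast
  next
    case poly
    have "ann_ideal Q I \<gamma> \<subset> {\<zero>\<^bsub>A\<^esub>}"
      using ann_psubset_poly[OF poly(1) irreducible_nonzero[OF poly(2)]] poly(3) by simp
    moreover have "\<zero>\<^bsub>A\<^esub> \<in> ann_ideal Q I \<gamma>"
      using poly(1) prime_ideals_iff[of "ann_ideal Q I \<gamma>"]
      by (auto simp: nc_prime_ideal_def ideal_def additive_subgroup.zero_closed)
    ultimately show ?thesis by blast
  qed
next
  assume "\<exists>\<gamma>. max_paths Q I = {\<gamma>} \<and> \<gamma> \<in> infinite_max_paths Q I"
  then obtain \<gamma> where \<gamma>: "max_paths Q I = {\<gamma>}" "\<gamma> \<in> infinite_max_paths Q I" by blast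
  then obtain a n where c: "gentle_cycle Q I a n" "\<gamma> = cycle_max_path Q a n"
    unfolding infinite_max_paths_iff by blast
  interpret gentle_cycle Q I a n by (rule c(1))
  have all: "\<alpha> \<in> range a" if "\<alpha> \<in> arcs Q" for \<alpha>
    using max_path_of_eq_iff[OF that, of "max_path_of Q I \<alpha>"] max_path_of_gam[OF that] \<gamma>(1) c(2) by blast
  have "ann_ideal Q I \<gamma> = {\<zero>\<^bsub>A\<^esub>}"
  proof (intro Set.set_eqI iffI)
    fix x assume "x \<in> ann_ideal Q I \<gamma>"
    then have x: "x \<in> carrier A" "\<And>i l. cf x (pth i l) = 0" by (auto simp: c(2) ann_ideal_eq)
    have "x = \<zero>\<^bsub>A\<^esub>"
    proof (rule cf_eqI[OF x(1)])
      fix q assume q: "q \<in> B"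
      obtain u as where ua: "q = (u, as)" by (cases q)
      have "\<exists>i l. q = pth i l"
      \<comment> \<open>A stationary path has no arrow to compare, so an arrow at its vertex is used
        to place it on the cycle.\<close>
      proof (cases "as = []")
        case True
        then have "u \<in> verts Q" using q ua by simp
        then obtain \<beta> where "\<beta> \<in> arcs Q" "u = tail Q \<beta> \<or> u = head Q \<beta>" using vertex_has_arrow by blast
        then obtain i where "u = tail Q (a i)" using all[of \<beta>] head_a by auto
        then have "q = pth i 0" by (simp add: ua True cycle_path_def)
        then show ?thesis by blast
      next
        case False
        then have "hd as \<in> arcs Q" using B_paths[OF q] paths_arcs ua hd_in_set by blast
        then obtain i where "hd as = a i" using all by blast
        then show ?thesis using basis_path_from_cycle[of u as i] q ua False by blast
      qed
      then show "cf x q = cf \<zero>\<^bsub>A\<^esub> q" using x(2) q by auto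
    qed simp
    then show "x \<in> {\<zero>\<^bsub>A\<^esub>}" by simp
  next
    fix x assume "x \<in> {\<zero>\<^bsub>A\<^esub>}"
    then show "x \<in> ann_ideal Q I \<gamma>" by (simp add: c(2) ann_ideal_eq)
  qed
  then show "nc_prime_ring A" using ann_ideal_prime c(2) by (simp add: nc_prime_ring_def)
qed

text \<open>Vertex ideals are maximal, annihilators are pairwise incomparable, and each ideal of a
  polynomial lies properly above an annihilator. So minimality is decided by annihilators alone, and
  a vertex ideal contains one iff that infinite path passes through the vertex.\<close>

lemma height_zero_primes:
  "{P. nc_prime_ideal A P \<and> prime_height A P = 0} =
     {ann_ideal Q I \<gamma> | \<gamma>. \<gamma> \<in> infinite_max_paths Q I} \<union>
     {vertex_ideal Q I v | v. v \<in> verts Q \<and> \<not> (\<exists>\<gamma>\<in>infinite_max_paths Q I. passes_through Q \<gamma> v)}"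
    (is "?H = ?A \<union> ?V")
proof (intro Set.set_eqI iffI)
  fix P assume "P \<in> ?H"
  then have P: "nc_prime_ideal A P" and min: "\<And>P'. nc_prime_ideal A P' \<Longrightarrow> \<not> P' \<subset> P"
    using prime_height_0_iff by blast+
  have ann: "nc_prime_ideal A (ann_ideal Q I \<gamma>)" if "\<gamma> \<in> infinite_max_paths Q I" for \<gamma>
    unfolding prime_ideals_iff using that by blast
  show "P \<in> ?A \<union> ?V"
    using P unfolding prime_ideals_iff
  proof (elim disjE bexE exE conjE)
    fix v assume v: "v \<in> verts Q" "P = vertex_ideal Q I v"
    then have "\<not> passes_through Q \<gamma> v" if "\<gamma> \<in> infinite_max_paths Q I" for \<gamma>
      using min[OF ann[OF that]] ann_subset_vertex_iff(2)[OF that] by blast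
    then show ?thesis using v by blast
  next
    fix \<gamma> p assume "\<gamma> \<in> infinite_max_paths Q I" "Factorial_Ring.irreducible p" "P = poly_ideal Q I \<gamma> p"
    then show ?thesis using min[OF ann] ann_psubset_poly irreducible_nonzero by blast
  qed blast
next
  fix P assume "P \<in> ?A \<union> ?V"
  then have P: "nc_prime_ideal A P" unfolding prime_ideals_iff by blast
  have vmax: "\<not> vertex_ideal Q I w \<subset> P" if "w \<in> verts Q" for w
    using vertex_ideal_maximal[OF that, of P] P by (auto simp: nc_prime_ideal_def)
  have amin: "\<not> ann_ideal Q I \<delta> \<subset> P" if \<delta>: "\<delta> \<in> infinite_max_paths Q I" for \<delta>
    using \<open>P \<in> ?A \<union> ?V\<close>
  proof
    assume "P \<in> ?A"
    then show ?thesis using ann_ideal_inj[OF \<delta>] by blast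
  next
    assume "P \<in> ?V"
    then show ?thesis using ann_subset_vertex_iff(1)[OF \<delta>] \<delta> by blast
  qed
  have "\<not> P' \<subset> P" if "nc_prime_ideal A P'" for P'
    using that unfolding prime_ideals_iff
  proof (elim disjE bexE exE conjE)
    fix \<gamma> p assume \<gamma>: "\<gamma> \<in> infinite_max_paths Q I" and p: "Factorial_Ring.irreducible p" "P' = poly_ideal Q I \<gamma> p"
    show ?thesis using amin[OF \<gamma>] ann_psubset_poly[OF \<gamma> irreducible_nonzero[OF p(1)]] p(2) by blast
  qed (use vmax amin in blast)+
  then show "P \<in> ?H" using prime_height_0_iff[OF P] P by blast
qed

lemma inclusions:
  assumes \<gamma>: "\<gamma> \<in> infinite_max_paths Q I" and v: "v \<in> verts Q" "passes_through Q \<gamma> v"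
    and p: "Factorial_Ring.irreducible p" "Polynomial.lead_coeff p = 1" "p \<noteq> [:0, 1:]"
  shows "ann_ideal Q I \<gamma> \<subset> vertex_ideal Q I v" "ann_ideal Q I \<gamma> \<subset> poly_ideal Q I \<gamma> p"
    "\<not> vertex_ideal Q I v \<subseteq> poly_ideal Q I \<gamma> p" "\<not> poly_ideal Q I \<gamma> p \<subseteq> vertex_ideal Q I v"
proof -
  have p0: "poly p 0 \<noteq> 0" using irreducible_monic_root_0 p by blast
  obtain a n where c: "gentle_cycle Q I a n" "\<gamma> = cycle_max_path Q a n"
    using \<gamma> unfolding infinite_max_paths_iff by blast
  interpret gentle_cycle Q I a n by (rule c(1))
  show "ann_ideal Q I \<gamma> \<subset> vertex_ideal Q I v" using ann_psubset_vertex_ideal v(2) c(2) by simp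
  show "ann_ideal Q I \<gamma> \<subset> poly_ideal Q I \<gamma> p" using ann_psubset_poly_ideal[OF irreducible_nonzero[OF p(1)]] c(2) by simp
  show "\<not> vertex_ideal Q I v \<subseteq> poly_ideal Q I \<gamma> p"
    using vertex_ideal_not_subset_poly_ideal[OF v(1) p(1) p0] c(2) by simp
  show "\<not> poly_ideal Q I \<gamma> p \<subseteq> vertex_ideal Q I v"
    using poly_ideal_not_subset_vertex_ideal[OF v(1) p0] c(2) by simp
qed

end
theorem theorem3p4:
  fixes Q :: "('v, 'a) pre_digraph"
    and I :: "(('v, 'a) path \<Rightarrow>\<^sub>0 'k::field_char_0) set"
  assumes "quiver Q"
    and "gentle Q I \<or> locally_gentle Q I"
  shows
    "{P. nc_prime_ideal (quiver_algebra Q I) P} =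
       {vertex_ideal Q I v | v. v \<in> verts Q} \<union>
       {ann_ideal Q I \<gamma> | \<gamma>. \<gamma> \<in> infinite_max_paths Q I} \<union>
       {poly_ideal Q I \<gamma> p | \<gamma> p. \<gamma> \<in> infinite_max_paths Q I \<and>
          Factorial_Ring.irreducible p \<and> Polynomial.degree p \<ge> 1 \<and> poly p 0 \<noteq> 0}
     \<and> (nc_prime_ring (quiver_algebra Q I) \<longleftrightarrow>
         (\<exists>\<gamma>. max_paths Q I = {\<gamma>} \<and> \<gamma> \<in> infinite_max_paths Q I))
     \<and> {P. nc_prime_ideal (quiver_algebra Q I) P \<and> prime_height (quiver_algebra Q I) P = 0} =
       {ann_ideal Q I \<gamma> | \<gamma>. \<gamma> \<in> infinite_max_paths Q I} \<union>
       {vertex_ideal Q I v | v. v \<in> verts Q \<and>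
          \<not> (\<exists>\<gamma>\<in>infinite_max_paths Q I. passes_through Q \<gamma> v)}
     \<and> (\<forall>\<gamma>\<in>infinite_max_paths Q I. \<forall>v\<in>verts Q. \<forall>p.
         passes_through Q \<gamma> v \<and> Factorial_Ring.irreducible p \<and>
         Polynomial.lead_coeff p = 1 \<and> p \<noteq> [:0, 1:] \<longrightarrow>
           ann_ideal Q I \<gamma> \<subset> vertex_ideal Q I v \<and>
           ann_ideal Q I \<gamma> \<subset> poly_ideal Q I \<gamma> p \<and>
           \<not> vertex_ideal Q I v \<subseteq> poly_ideal Q I \<gamma> p \<and>
           \<not> poly_ideal Q I \<gamma> p \<subseteq> vertex_ideal Q I v)"
proof -
  interpret gentle_quiver Q I
    using assms by unfold_locales (auto simp: gentle_def locally_gentle_def)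
  have primes: "{P. nc_prime_ideal A P} = {vertex_ideal Q I v | v. v \<in> verts Q} \<union>
      {ann_ideal Q I \<gamma> | \<gamma>. \<gamma> \<in> infinite_max_paths Q I} \<union>
      {poly_ideal Q I \<gamma> p | \<gamma> p. \<gamma> \<in> infinite_max_paths Q I \<and>
        Factorial_Ring.irreducible p \<and> Polynomial.degree p \<ge> 1 \<and> poly p 0 \<noteq> 0}"
    unfolding prime_ideals_iff using irreducible_degree_pos by blast
  show ?thesis
    by (intro conjI primes prime_ring_iff height_zero_primes ballI allI impI)
      (elim conjE, rule inclusions; assumption)+
qed

end
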